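(* Let $G$ be a finite simple graph on $[n]=\{1,\dots,n\}$ with binomial edge ideal $J_G$, let $s\in[n]$, and let $J_G=J_{G_1}+J_{G_2}$ be the $s$-partition of $G$. Let $c(s)$ be the size of the largest clique of $G$ that contains $s$. Then $$\beta_{i,j}(J_G)=\beta_{i,j}(J_{G_1})+\beta_{i,j}(J_{G_2})+\beta_{i-1,j}(J_{G_1}\cap J_{G_2})$$ for all $(i,j)$ with $i\geq c(s)$ or $j\geq i+4$. In other words, $J_G=J_{G_1}+J_{G_2}$ is a $(c(s),4)$-Betti splitting.
   Context: Let $k$ be a field and $R=k[x_1,\ldots,x_n,y_1,\ldots,y_n]$ with the standard $\mathbb{N}$-grading. For a graph $H$ with $V(H)\subseteq[n]$, its binomial edge ideal is $J_H=\langle x_iy_j-x_jy_i\mid\{i,j\}\in E(H)\rangle\subseteq R$. For $s\in V(G)$, the $s$-partition of $J_G$ is the splitting $J_G=J_{G_1}+J_{G_2}$, where $G_1$ is the subgraph of $G$ with $V(G_1)=N_G[s]=N_G(s)\cup\{s\}$ and $E(G_1)=\{\{s,t\}\mid t\in N_G(s)\}$, and $G_2=G\setminus\{s\}$ is the graph obtained from $G$ by deleting the vertex $s$. Here $N_G(s)$ is the set of neighbours of $s$. A clique is an induced subgraph that is complete; its size is its number of vertices. Graded Betti numbers are $\beta_{i,j}(L)=\dim_k\mathrm{Tor}_i(k,L)_j$, with $\beta_{i,j}(L)=0$ if $i<0$. If $I=J+K$ are homogeneous ideals such that a minimal homogeneous generating set of $I$ is the disjoint union of minimal homogeneous generating sets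 of $J$ and $K$, then $I=J+K$ is an $(r,t)$-Betti splitting if $\beta_{i,j}(I)=\beta_{i,j}(J)+\beta_{i,j}(K)+\beta_{i-1,j}(J\cap K)$ for all $(i,j)$ with $i\geq r$ or $j\geq i+t$. *)

theory Defs
  imports Complex_Main "HOL-Library.Poly_Mapping" "HOL-Library.Function_Algebras"
begin

section \<open>The polynomial ring\<close>

text \<open>Polynomials are taken over the indeterminates \<open>x\<^sub>i, y\<^sub>i\<close> for all natural numbers \<open>i\<close>;
  the ring \<open>R = k[x\<^sub>1,\<dots>,x\<^sub>n,y\<^sub>1,\<dots>,y\<^sub>n]\<close> is the subring \<open>polyring n\<close>, and all ideals
  below are ideals of that subring.\<close>

datatype indet = Xvar nat | Yvar nat

type_synonym 'k mpoly = "(indet \<Rightarrow>\<^sub>0 nat) \<Rightarrow>\<^sub>0 'k"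

definition var :: "indet \<Rightarrow> 'k::field mpoly" where
  "var v = Poly_Mapping.single (Poly_Mapping.single v 1) 1"

definition const :: "'k::field \<Rightarrow> 'k mpoly" where
  "const c = Poly_Mapping.single 0 c"

definition polyring :: "nat \<Rightarrow> 'k::field mpoly set" where
  "polyring n = {p. \<forall>m\<in>Poly_Mapping.keys p. Poly_Mapping.keys m \<subseteq> Xvar ` {1..n} \<union> Yvar ` {1..n}}"

definition mdeg :: "(indet \<Rightarrow>\<^sub>0 nat) \<Rightarrow> nat" where
  "mdeg m = (\<Sum>v\<in>Poly_Mapping.keys m. Poly_Mapping.lookup m v)"

text \<open>Zero is homogeneous of every degree, and it is the only element that is homogeneous of a
  negative degree.\<close>

definition homogeneous :: "int \<Rightarrow> 'k::field mpoly \<Rightarrow> bool" where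
  "homogeneous d p \<longleftrightarrow> (\<forall>m\<in>Poly_Mapping.keys p. int (mdeg m) = d)"

definition is_ideal :: "nat \<Rightarrow> 'k::field mpoly set \<Rightarrow> bool" where
  "is_ideal n I \<longleftrightarrow> I \<subseteq> polyring n \<and> 0 \<in> I \<and> (\<forall>p\<in>I. \<forall>q\<in>I. p + q \<in> I) \<and>
     (\<forall>r\<in>polyring n. \<forall>p\<in>I. r * p \<in> I)"

definition ideal_gen :: "nat \<Rightarrow> 'k::field mpoly set \<Rightarrow> 'k mpoly set" where
  "ideal_gen n S = \<Inter> {I. is_ideal n I \<and> S \<subseteq> I}"

definition ideal_sum :: "'k::field mpoly set \<Rightarrow> 'k mpoly set \<Rightarrow> 'k mpoly set" where
  "ideal_sum I J = {p + q | p q. p \<in> I \<and> q \<in> J}"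

definition homogeneous_gens :: "nat \<Rightarrow> 'k::field mpoly set \<Rightarrow> 'k mpoly set \<Rightarrow> bool" where
  "homogeneous_gens n I A \<longleftrightarrow>
     A \<subseteq> polyring n \<and> (\<forall>p\<in>A. \<exists>d. homogeneous d p) \<and> ideal_gen n A = I"

definition homogeneous_ideal :: "nat \<Rightarrow> 'k::field mpoly set \<Rightarrow> bool" where
  "homogeneous_ideal n I \<longleftrightarrow> (\<exists>A. homogeneous_gens n I A)"

definition minimal_homogeneous_gens :: "nat \<Rightarrow> 'k::field mpoly set \<Rightarrow> 'k mpoly set \<Rightarrow> bool" where
  "minimal_homogeneous_gens n I A \<longleftrightarrow>
     homogeneous_gens n I A \<and> (\<forall>A'. A' \<subset> A \<longrightarrow> ideal_gen n A' \<noteq> I)"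


section \<open>Graded free resolutions of the residue field\<close>

text \<open>A complex \<open>\<dots> \<rightarrow> F\<^sub>2 \<rightarrow> F\<^sub>1 \<rightarrow> F\<^sub>0 \<rightarrow> k\<close> of free \<open>R\<close>-modules of finite rank:
  \<open>F\<^sub>i\<close> has the basis \<open>e\<^sub>i\<^sub>,\<^sub>a\<close> with \<open>a < rk F i\<close>, where \<open>e\<^sub>i\<^sub>,\<^sub>a\<close> sits in degree \<open>shift F i a\<close>.
  The differential \<open>F\<^sub>i\<^sub>+\<^sub>1 \<rightarrow> F\<^sub>i\<close> sends the basis element with index \<open>a\<close> to the combination of the
  \<open>e\<^sub>i\<^sub>,\<^sub>b\<close> with coefficients \<open>mat F i a b\<close>, and the augmentation \<open>F\<^sub>0 \<rightarrow> k\<close> sends \<open>e\<^sub>0\<^sub>,\<^sub>a\<close> to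
  \<open>aug F a\<close>. Here \<open>k = R / (x\<^sub>1,\<dots>,x\<^sub>n,y\<^sub>1,\<dots>,y\<^sub>n)\<close> sits in degree 0, so a polynomial acts on \<open>k\<close>
  through its constant coefficient.\<close>

record (overloaded) 'k free_complex =
  rk :: "nat \<Rightarrow> nat"
  shift :: "nat \<Rightarrow> nat \<Rightarrow> int"
  mat :: "nat \<Rightarrow> nat \<Rightarrow> nat \<Rightarrow> 'k mpoly"
  aug :: "nat \<Rightarrow> 'k"

text \<open>As \<open>F\<^sub>i\<close> is free, \<open>F\<^sub>i \<otimes>\<^sub>R L\<close> is the module of vectors of length \<open>rk F i\<close> with entries in \<open>L\<close>;
  in particular \<open>tensor F (polyring n) i\<close> is \<open>F\<^sub>i\<close> itself. The map \<open>bd F i\<close> is the differential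
  \<open>F\<^sub>i\<^sub>+\<^sub>1 \<otimes>\<^sub>R L \<rightarrow> F\<^sub>i \<otimes>\<^sub>R L\<close>, for every \<open>L\<close>.\<close>

definition tensor :: "'k::field free_complex \<Rightarrow> 'k mpoly set \<Rightarrow> nat \<Rightarrow> (nat \<Rightarrow> 'k mpoly) set" where
  "tensor F L i = {v. (\<forall>a<rk F i. v a \<in> L) \<and> (\<forall>a\<ge>rk F i. v a = 0)}"

definition bd :: "'k::field free_complex \<Rightarrow> nat \<Rightarrow> (nat \<Rightarrow> 'k mpoly) \<Rightarrow> (nat \<Rightarrow> 'k mpoly)" where
  "bd F i v = (\<lambda>b. if b < rk F i then (\<Sum>a<rk F (Suc i). v a * mat F i a b) else 0)"

definition augmentation :: "'k::field free_complex \<Rightarrow> (nat \<Rightarrow> 'k mpoly) \<Rightarrow> 'k" where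
  "augmentation F v = (\<Sum>a<rk F 0. Poly_Mapping.lookup (v a) 0 * aug F a)"

definition graded_free_complex :: "nat \<Rightarrow> 'k::field free_complex \<Rightarrow> bool" where
  "graded_free_complex n F \<longleftrightarrow>
     (\<forall>i. \<forall>a<rk F (Suc i). \<forall>b<rk F i.
        mat F i a b \<in> polyring n \<and> homogeneous (shift F (Suc i) a - shift F i b) (mat F i a b)) \<and>
     (\<forall>a<rk F 0. aug F a \<noteq> 0 \<longrightarrow> shift F 0 a = 0)"

definition residue_field_resolution :: "nat \<Rightarrow> 'k::field free_complex \<Rightarrow> bool" where
  "residue_field_resolution n F \<longleftrightarrow>
     graded_free_complex n F \<and>
     augmentation F ` tensor F (polyring n) 0 = UNIV \<and>
     {v \<in> tensor F (polyring n) 0. augmentation F v = 0} = bd F 0 ` tensor F (polyring n) 1 \<and>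
     (\<forall>i. {v \<in> tensor F (polyring n) (Suc i). bd F i v = 0} =
            bd F (Suc i) ` tensor F (polyring n) (Suc (Suc i)))"


section \<open>Tor and graded Betti numbers\<close>

definition graded_tensor ::
  "'k::field free_complex \<Rightarrow> 'k mpoly set \<Rightarrow> nat \<Rightarrow> int \<Rightarrow> (nat \<Rightarrow> 'k mpoly) set" where
  "graded_tensor F L i j =
     {v \<in> tensor F L i. \<forall>a<rk F i. homogeneous (j - shift F i a) (v a)}"

definition tor_cycles ::
  "'k::field free_complex \<Rightarrow> 'k mpoly set \<Rightarrow> nat \<Rightarrow> int \<Rightarrow> (nat \<Rightarrow> 'k mpoly) set" where
  "tor_cycles F L i j = {v \<in> graded_tensor F L i j. i = 0 \<or> bd F (i - 1) v = 0}"

definition tor_boundaries ::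
  "'k::field free_complex \<Rightarrow> 'k mpoly set \<Rightarrow> nat \<Rightarrow> int \<Rightarrow> (nat \<Rightarrow> 'k mpoly) set" where
  "tor_boundaries F L i j = bd F i ` graded_tensor F L (Suc i) j"

definition scale_vec :: "'k::field \<Rightarrow> (nat \<Rightarrow> 'k mpoly) \<Rightarrow> (nat \<Rightarrow> 'k mpoly)" where
  "scale_vec c v = (\<lambda>a. const c * v a)"

lemma const_add: "const (a + b) = const a + const b"
  by (simp add: const_def single_add)

lemma const_mult: "const (a * b) = const a * const b"
  by (simp add: const_def mult_single)

lemma const_1: "const 1 = 1"
  by (simp add: const_def single_one)

lemma vector_space_scale_vec: "vector_space scale_vec"
  by unfold_locales
    (auto simp: scale_vec_def fun_eq_iff const_add const_mult const_1 algebra_simps)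

text \<open>\<open>Tor\<^sub>i(k,L)\<close> is the \<open>i\<close>-th homology of \<open>F \<otimes>\<^sub>R L\<close> for a graded free resolution \<open>F\<close> of \<open>k\<close>;
  one exists (over \<open>R\<close> even of finite rank and finite length), and up to isomorphism the homology
  does not depend on it, so an arbitrary \<open>F\<close> is chosen. The component of degree \<open>j\<close> is the quotient
  of the cycles of degree \<open>j\<close> by the subspace of boundaries of degree \<open>j\<close>. These \<open>k\<close>-spaces are of
  finite dimension, so the dimension of the quotient is the difference of the dimensions.\<close>

definition dim_tor :: "'k::field free_complex \<Rightarrow> 'k mpoly set \<Rightarrow> nat \<Rightarrow> int \<Rightarrow> nat" where
  "dim_tor F L i j = vector_space.dim scale_vec (tor_cycles F L i j) -
     vector_space.dim scale_vec (tor_boundaries F L i j)"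

definition betti :: "nat \<Rightarrow> 'k::field mpoly set \<Rightarrow> int \<Rightarrow> int \<Rightarrow> nat" where
  "betti n L i j =
     (if i < 0 then 0 else dim_tor (SOME F. residue_field_resolution n F) L (nat i) j)"

definition betti_splitting ::
  "nat \<Rightarrow> int \<Rightarrow> int \<Rightarrow> 'k::field mpoly set \<Rightarrow> 'k mpoly set \<Rightarrow> 'k mpoly set \<Rightarrow> bool" where
  "betti_splitting n r t I J K \<longleftrightarrow>
     homogeneous_ideal n I \<and> homogeneous_ideal n J \<and> homogeneous_ideal n K \<and>
     I = ideal_sum J K \<and>
     (\<exists>A B. minimal_homogeneous_gens n J A \<and> minimal_homogeneous_gens n K B \<and> A \<inter> B = {} \<and>
        minimal_homogeneous_gens n I (A \<union> B)) \<and>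
     (\<forall>i j. i \<ge> r \<or> j \<ge> i + t \<longrightarrow>
        betti n I i j = betti n J i j + betti n K i j + betti n (J \<inter> K) (i - 1) j)"


section \<open>Graphs and binomial edge ideals\<close>

record graph =
  verts :: "nat set"
  edges :: "nat set set"

definition simple_graph :: "graph \<Rightarrow> bool" where
  "simple_graph G \<longleftrightarrow> finite (verts G) \<and> (\<forall>e\<in>edges G. e \<subseteq> verts G \<and> card e = 2)"

definition neighbours :: "graph \<Rightarrow> nat \<Rightarrow> nat set" where
  "neighbours G s = {t. {s, t} \<in> edges G}"

definition star_at :: "graph \<Rightarrow> nat \<Rightarrow> graph" where
  "star_at G s =
     \<lparr>verts = neighbours G s \<union> {s}, edges = {{s, t} | t. t \<in> neighbours G s}\<rparr>"

definition delete_vertex :: "graph \<Rightarrow> nat \<Rightarrow> graph" where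
  "delete_vertex G s = \<lparr>verts = verts G - {s}, edges = {e \<in> edges G. s \<notin> e}\<rparr>"

definition clique :: "graph \<Rightarrow> nat set \<Rightarrow> bool" where
  "clique G C \<longleftrightarrow> C \<subseteq> verts G \<and> (\<forall>u\<in>C. \<forall>v\<in>C. u \<noteq> v \<longrightarrow> {u, v} \<in> edges G)"

definition clique_size_at :: "graph \<Rightarrow> nat \<Rightarrow> nat" where
  "clique_size_at G s = Max {card C | C. clique G C \<and> s \<in> C}"

definition binomial_edge_ideal :: "nat \<Rightarrow> graph \<Rightarrow> 'k::field mpoly set" where
  "binomial_edge_ideal n H = ideal_gen n
     {var (Xvar i) * var (Yvar j) - var (Xvar j) * var (Yvar i) | i j. {i, j} \<in> edges H}"

end

theory Submission
  imports Defs
begin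

text \<open>Write \<open>N\<close> for the neighbourhood of \<open>s\<close>. By the long exact sequence of
  \<open>0 \<rightarrow> J\<^sub>1 \<inter> J\<^sub>2 \<rightarrow> J\<^sub>1 \<oplus> J\<^sub>2 \<rightarrow> J \<rightarrow> 0\<close> it suffices that the maps
  \<open>Tor\<^sub>k(J\<^sub>1 \<inter> J\<^sub>2)\<^sub>j \<rightarrow> Tor\<^sub>k(J\<^sub>1)\<^sub>j\<close> and \<open>Tor\<^sub>k(J\<^sub>1 \<inter> J\<^sub>2)\<^sub>j \<rightarrow> Tor\<^sub>k(J\<^sub>2)\<^sub>j\<close> vanish for
  \<open>k = i\<close> and \<open>k = i - 1\<close>; this is seen on the Koszul complex, since zero maps are transferred between
  resolutions of \<open>k\<close> by a homotopy equivalence. The second map is always zero: the elements of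
  \<open>J\<^sub>1 \<inter> J\<^sub>2\<close> have no terms free of \<open>x\<^sub>s, y\<^sub>s\<close>, whereas \<open>J\<^sub>2\<close> is extended from a ring without these
  indeterminates, so dividing by \<open>x\<^sub>s\<close> and \<open>y\<^sub>s\<close> gives a contracting homotopy. For the first map,
  \<open>J\<^sub>1 = (x\<^sub>s, y\<^sub>s) \<inter> J\<^sub>K\<close> with \<open>K\<close> the complete graph on \<open>N \<union> {s}\<close>, whence \<open>J\<^sub>1\<close> has regularity at
  most \<open>3\<close> because \<open>J\<^sub>K\<close> has regularity at most \<open>2\<close>; this settles \<open>j \<ge> k + 4\<close>. In degrees
  \<open>j \<le> k + 3\<close> a cycle over \<open>J\<^sub>1 \<inter> J\<^sub>2\<close> is the boundary of a chain whose coefficients are combinations of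
  minors on edges inside \<open>N\<close>, and comparing coefficients shows that a nonzero coefficient produces a clique
  with \<open>k + 2\<close> vertices that contains \<open>s\<close>, which is impossible for \<open>k \<ge> c(s) - 1\<close>.\<close>

text \<open>A chain that bounds a \<open>k\<close>-cycle of degree \<open>j\<close> has coefficients
  of degree \<open>j - k - 1\<close>, and the elements of \<open>J\<^sub>2\<close> have no terms of
  degree below 2. So for \<open>j \<le> k + 3\<close> these coefficients are constant combinations
  of minors, and all higher degrees are left to the regularity of \<open>J\<^sub>1\<close>; this is
  the origin of the constant 4. The obstacle in low degrees is that the chain \<open>w\<close>
  obtained by dividing by x_s and y_s is not a cycle, as its boundary is the given cycle. But every
  term of that boundary contains x_s or y_s, so its coefficients at monomials in the other columns
  vanish, and these equations suffice. An exterior monomial on which \<open>w\<close> has a nonzero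
  minor for \<open>t, u\<close> has \<open>k + 1\<close> factors. At most two of them are x_s and
  y_s, and the others belong to distinct vertices different from \<open>t\<close> and
  \<open>u\<close>; together with \<open>s, t, u\<close> this makes at least
  \<open>(k - 1) + 3\<close> vertices. All dimension counts are made with spaces of cycles and
  boundaries, so that no quotient spaces occur.\<close>

abbreviation lookup :: "('a \<Rightarrow>\<^sub>0 'b::zero) \<Rightarrow> 'a \<Rightarrow> 'b" where "lookup \<equiv> Poly_Mapping.lookup"
abbreviation keys :: "('a \<Rightarrow>\<^sub>0 'b::zero) \<Rightarrow> 'a set" where "keys \<equiv> Poly_Mapping.keys"
abbreviation single :: "'a \<Rightarrow> 'b \<Rightarrow> ('a \<Rightarrow>\<^sub>0 'b::zero)" where "single \<equiv> Poly_Mapping.single"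

section \<open>Polynomials and their ideals\<close>

definition vars :: "nat \<Rightarrow> indet set" where
  "vars n = Xvar ` {1..n} \<union> Yvar ` {1..n}"

lemma finite_vars [simp]: "finite (vars n)"
  by (simp add: vars_def)

lemma polyring_alt: "polyring n = {p. \<forall>m\<in>keys p. keys m \<subseteq> vars n}"
  by (simp add: polyring_def vars_def)

lemma lookup_single_mult_add:
  fixes p :: "'k::field mpoly"
  shows "lookup (single a c * p) (a + b) = c * lookup p b"
proof -
  have "lookup (single a c * p) (a + b) =
      (\<Sum>l. lookup (single a c) l * (\<Sum>q. lookup p q when a + b = l + q))"
    by (simp add: lookup_mult)
  also have "\<dots> = (\<Sum>l. (c * (\<Sum>q. lookup p q when a + b = l + q)) when a = l)"
    by (rule Sum_any.cong) (simp add: lookup_single when_mult)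
  also have "\<dots> = c * lookup p b"
    by (simp add: Sum_any_when_equal)
  finally show ?thesis .
qed

lemma lookup_single_mult_not:
  fixes p :: "'k::field mpoly"
  assumes "\<And>b. m \<noteq> a + b"
  shows "lookup (single a c * p) m = 0"
proof -
  have "lookup (single a c * p) m =
      (\<Sum>l. lookup (single a c) l * (\<Sum>q. lookup p q when m = l + q))"
    by (simp add: lookup_mult)
  also have "\<dots> = (\<Sum>l. (c * (\<Sum>q. lookup p q when m = l + q)) when a = l)"
    by (rule Sum_any.cong) (simp add: lookup_single when_mult)
  also have "\<dots> = 0"
    using assms by (simp add: Sum_any_when_equal)
  finally show ?thesis .
qed

lemma add_single_minus: "lookup m v \<noteq> 0 \<Longrightarrow> single v (Suc 0) + (m - single v (Suc 0)) = m"
  for m :: "indet \<Rightarrow>\<^sub>0 nat"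
  by (rule poly_mapping_eqI) (auto simp: lookup_add lookup_minus lookup_single when_def)

lemma lookup_var_mult:
  "lookup (var v * p) m = (if lookup m v = 0 then 0 else lookup p (m - single v (Suc 0)))"
proof (cases "lookup m v = 0")
  case True
  have "m \<noteq> single v 1 + b" for b
    using True by (auto simp: lookup_add)
  then show ?thesis
    using True lookup_single_mult_not[of m "single v 1" 1 p] by (simp add: var_def)
next
  case False
  then show ?thesis
    using lookup_single_mult_add[of "single v 1" 1 p "m - single v 1"] add_single_minus[OF False]
    by (simp add: var_def)
qed

lemma poly_decomp: "p = (\<Sum>m\<in>keys p. single m (lookup p m))"
proof (rule poly_mapping_eqI)
  fix m
  have "lookup (\<Sum>m\<in>keys p. single m (lookup p m)) m = (\<Sum>m'\<in>keys p. lookup p m' when m' = m)"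
    by (simp add: lookup_sum lookup_single)
  also have "\<dots> = (\<Sum>m'\<in>keys p. if m' = m then lookup p m else 0)"
    by (rule sum.cong) (auto simp: when_def)
  also have "\<dots> = lookup p m"
    by (simp add: in_keys_iff)
  finally show "lookup p m = lookup (\<Sum>m\<in>keys p. single m (lookup p m)) m" ..
qed

lemma polyring_keys: "p \<in> polyring n \<Longrightarrow> m \<in> keys p \<Longrightarrow> keys m \<subseteq> vars n"
  by (auto simp: polyring_alt)

lemma polyring_0 [simp]: "0 \<in> polyring n"
  by (simp add: polyring_def)

lemma polyring_add [intro]: "p \<in> polyring n \<Longrightarrow> q \<in> polyring n \<Longrightarrow> p + q \<in> polyring n"
  using keys_add[of p q] by (auto simp: polyring_alt)

lemma polyring_single: "keys m \<subseteq> vars n \<Longrightarrow> single m c \<in> polyring n"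
  by (auto simp: polyring_alt split: if_splits)

lemma keys_add_nat: "keys (a + b) = keys a \<union> keys b" for a b :: "indet \<Rightarrow>\<^sub>0 nat"
  by (auto simp: in_keys_iff lookup_add)

lemma polyring_mult [intro]: "p \<in> polyring n \<Longrightarrow> q \<in> polyring n \<Longrightarrow> p * q \<in> polyring n"
  using keys_mult[of p q] by (fastforce simp: polyring_alt keys_add_nat)

lemma polyring_uminus [intro]: "p \<in> polyring n \<Longrightarrow> - p \<in> polyring n"
  by (auto simp: polyring_alt in_keys_iff)

lemma polyring_diff [intro]: "p \<in> polyring n \<Longrightarrow> q \<in> polyring n \<Longrightarrow> p - q \<in> polyring n"
  using polyring_add[of p n "- q"] polyring_uminus[of q n] by simp

lemma polyring_1 [simp]: "1 \<in> polyring n"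
  by (simp add: polyring_alt)

lemma polyring_const [simp]: "const c \<in> polyring n"
  by (simp add: const_def polyring_single)

lemma polyring_var: "v \<in> vars n \<Longrightarrow> var v \<in> polyring n"
  by (auto simp: var_def intro!: polyring_single)

lemma is_ideal_polyring: "is_ideal n (polyring n)"
  by (auto simp: is_ideal_def)

text \<open>Closure under multiplication by single terms suffices, since every element of the ring
  is a finite sum of terms. The criterion serves for sets that are cut out by conditions on
  coefficients.\<close>

lemma is_idealI:
  fixes I :: "'k::field mpoly set"
  assumes "I \<subseteq> polyring n" "0 \<in> I" and add: "\<And>p q. p \<in> I \<Longrightarrow> q \<in> I \<Longrightarrow> p + q \<in> I"
    and mon: "\<And>a c p. keys a \<subseteq> vars n \<Longrightarrow> p \<in> I \<Longrightarrow> single a c * p \<in> I"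
  shows "is_ideal n I"
proof -
  have "r * p \<in> I" if r: "r \<in> polyring n" and p: "p \<in> I" for r p
  proof -
    have "(\<Sum>m\<in>M. single m (lookup r m) * p) \<in> I" if "finite M" "M \<subseteq> keys r" for M
      using that
      by (induction M) (auto intro!: add mon p polyring_keys[OF r] simp: assms(2))
    from this[of "keys r"] show ?thesis
      by (subst poly_decomp[of r]) (simp add: sum_distrib_right)
  qed
  with assms show ?thesis
    by (auto simp: is_ideal_def)
qed

lemma idealD:
  assumes "is_ideal n I"
  shows ideal_sub: "p \<in> I \<Longrightarrow> p \<in> polyring n" and ideal_0: "0 \<in> I"
    and ideal_add: "p \<in> I \<Longrightarrow> q \<in> I \<Longrightarrow> p + q \<in> I"
    and ideal_mult: "r \<in> polyring n \<Longrightarrow> p \<in> I \<Longrightarrow> r * p \<in> I"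
    and ideal_mult_right: "r \<in> polyring n \<Longrightarrow> p \<in> I \<Longrightarrow> p * r \<in> I"
  using assms by (auto simp: is_ideal_def mult.commute)

lemma ideal_uminus: "is_ideal n I \<Longrightarrow> p \<in> I \<Longrightarrow> - p \<in> I"
  using ideal_mult[of n I "- 1" p] polyring_uminus[of 1 n] by simp

lemma ideal_diff: "is_ideal n I \<Longrightarrow> p \<in> I \<Longrightarrow> q \<in> I \<Longrightarrow> p - q \<in> I"
  using ideal_add[of n I p "- q"] ideal_uminus[of n I q] by simp

lemma ideal_sum_mem: "is_ideal n I \<Longrightarrow> (\<And>x. x \<in> A \<Longrightarrow> f x \<in> I) \<Longrightarrow> sum f A \<in> I"
  by (induction A rule: infinite_finite_induct) (auto intro: ideal_0 ideal_add)

lemma is_ideal_Int: "is_ideal n I \<Longrightarrow> is_ideal n J \<Longrightarrow> is_ideal n (I \<inter> J)"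
  by (auto simp: is_ideal_def)

lemma is_ideal_gen: "S \<subseteq> polyring n \<Longrightarrow> is_ideal n (ideal_gen n S)"
proof -
  assume S: "S \<subseteq> polyring n"
  have "ideal_gen n S \<subseteq> polyring n"
    using is_ideal_polyring S by (auto simp: ideal_gen_def)
  moreover have "0 \<in> ideal_gen n S"
    by (auto simp: ideal_gen_def is_ideal_def)
  moreover have "p + q \<in> ideal_gen n S" if "p \<in> ideal_gen n S" "q \<in> ideal_gen n S" for p q
    using that by (simp add: ideal_gen_def is_ideal_def)
  moreover have "r * p \<in> ideal_gen n S" if "p \<in> ideal_gen n S" "r \<in> polyring n" for r p
    using that by (simp add: ideal_gen_def is_ideal_def)
  ultimately show ?thesis
    by (simp add: is_ideal_def)
qed

lemma ideal_gen_base: "p \<in> S \<Longrightarrow> p \<in> ideal_gen n S"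
  by (auto simp: ideal_gen_def)

lemma ideal_gen_least: "is_ideal n I \<Longrightarrow> S \<subseteq> I \<Longrightarrow> ideal_gen n S \<subseteq> I"
  by (auto simp: ideal_gen_def)

lemma ideal_gen_mono: "S \<subseteq> T \<Longrightarrow> ideal_gen n S \<subseteq> ideal_gen n T"
  by (auto simp: ideal_gen_def)

lemma is_ideal_sum:
  fixes I J :: "'k::field mpoly set"
  assumes "is_ideal n I" "is_ideal n J"
  shows "is_ideal n (ideal_sum I J)"
proof -
  have "p + q \<in> ideal_sum I J" if p: "p \<in> ideal_sum I J" and q: "q \<in> ideal_sum I J" for p q
  proof -
    obtain a b c d where *: "p = a + b" "q = c + d" "a \<in> I" "b \<in> J" "c \<in> I" "d \<in> J"
      using p q by (auto simp: ideal_sum_def)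
    have "p + q = (a + c) + (b + d)" by (simp add: *)
    then show ?thesis
      using * ideal_add[OF assms(1)] ideal_add[OF assms(2)] unfolding ideal_sum_def by blast
  qed
  moreover have "r * p \<in> ideal_sum I J" if r: "r \<in> polyring n" and p: "p \<in> ideal_sum I J" for r p
  proof -
    obtain a b where *: "p = a + b" "a \<in> I" "b \<in> J"
      using p by (auto simp: ideal_sum_def)
    have "r * p = r * a + r * b" by (simp add: * algebra_simps)
    then show ?thesis
      using * ideal_mult[OF assms(1) r] ideal_mult[OF assms(2) r] unfolding ideal_sum_def by blast
  qed
  moreover have "ideal_sum I J \<subseteq> polyring n"
    using ideal_sub[OF assms(1)] ideal_sub[OF assms(2)] by (auto simp: ideal_sum_def)
  moreover have "0 + 0 \<in> ideal_sum I J"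
    using ideal_0[OF assms(1)] ideal_0[OF assms(2)] unfolding ideal_sum_def by blast
  ultimately show ?thesis
    by (auto simp: is_ideal_def)
qed

lemma ideal_sum_left: "is_ideal n J \<Longrightarrow> p \<in> I \<Longrightarrow> p \<in> ideal_sum I J"
  unfolding ideal_sum_def using ideal_0[of n J] by force

lemma ideal_sum_right: "is_ideal n I \<Longrightarrow> p \<in> J \<Longrightarrow> p \<in> ideal_sum I J"
  unfolding ideal_sum_def using ideal_0[of n I] by force

lemma ideal_gen_Un:
  assumes "S \<subseteq> polyring n" "T \<subseteq> polyring n"
  shows "ideal_gen n (S \<union> T) = ideal_sum (ideal_gen n S) (ideal_gen n T)" (is "?L = ?R")
proof
  have I: "is_ideal n (ideal_gen n S)" "is_ideal n (ideal_gen n T)"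
    using assms by (auto intro: is_ideal_gen)
  show "?L \<subseteq> ?R"
    using I by (intro ideal_gen_least is_ideal_sum)
      (auto intro: ideal_sum_left ideal_sum_right ideal_gen_base)
  have "is_ideal n ?L"
    using assms by (auto intro: is_ideal_gen)
  then show "?R \<subseteq> ?L"
    using ideal_gen_mono[of S "S \<union> T" n] ideal_gen_mono[of T "S \<union> T" n]
    by (auto simp: ideal_sum_def intro!: ideal_add)
qed

lemma ideal_gen_single:
  assumes "f \<in> polyring n"
  shows "ideal_gen n {f} = {f * q |q. q \<in> polyring n}"
proof
  have "f * q + f * r \<in> {f * q |q. q \<in> polyring n}" if "q \<in> polyring n" "r \<in> polyring n" for q r
    using polyring_add[OF that] by (auto simp flip: distrib_left)
  moreover have "r * (f * q) \<in> {f * q |q. q \<in> polyring n}" if "q \<in> polyring n" "r \<in> polyring n" for q r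
    using polyring_mult[OF that] by (auto simp: algebra_simps intro: exI[of _ "q * r"])
  moreover have "0 \<in> {f * q |q. q \<in> polyring n}"
    by (auto intro: exI[of _ 0])
  ultimately have "is_ideal n {f * q |q. q \<in> polyring n}"
    using assms by (auto simp: is_ideal_def)
  moreover have "f * 1 \<in> {f * q |q. q \<in> polyring n}"
    using polyring_1 by blast
  ultimately show "ideal_gen n {f} \<subseteq> {f * q |q. q \<in> polyring n}"
    by (intro ideal_gen_least) auto
  show "{f * q |q. q \<in> polyring n} \<subseteq> ideal_gen n {f}"
    using assms ideal_gen_base[of f "{f}" n] by (auto intro!: ideal_mult_right[OF is_ideal_gen])
qed

lemma ideal_gen_insertE:
  assumes "f \<in> polyring n" "S \<subseteq> polyring n" "p \<in> ideal_gen n (insert f S)"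
  obtains a q where "a \<in> ideal_gen n S" "q \<in> polyring n" "p = a + f * q"
proof -
  have "p \<in> ideal_sum (ideal_gen n S) (ideal_gen n {f})"
    using assms by (subst ideal_gen_Un[symmetric]) auto
  then show ?thesis
    using that assms(1) by (auto simp: ideal_sum_def ideal_gen_single)
qed

section \<open>The grading\<close>

lemma mdeg_superset: "finite V \<Longrightarrow> keys m \<subseteq> V \<Longrightarrow> mdeg m = (\<Sum>v\<in>V. lookup m v)"
  unfolding mdeg_def by (rule sum.mono_neutral_left) (auto simp: in_keys_iff)

lemma mdeg_add: "mdeg (a + b) = mdeg a + mdeg b"
proof -
  have "mdeg (a + b) = (\<Sum>v\<in>keys a \<union> keys b. lookup (a + b) v)"
    by (rule mdeg_superset) (auto simp: keys_add_nat)
  also have "\<dots> = mdeg a + mdeg b"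
    using mdeg_superset[of "keys a \<union> keys b" a] mdeg_superset[of "keys a \<union> keys b" b]
    by (simp add: lookup_add sum.distrib)
  finally show ?thesis .
qed

lemma mdeg_0 [simp]: "mdeg 0 = 0"
  by (simp add: mdeg_def)

lemma mdeg_single [simp]: "mdeg (single v k) = k"
  by (simp add: mdeg_def)

lemma mdeg_eq_0: "mdeg m = 0 \<longleftrightarrow> m = 0"
proof -
  have "mdeg m = 0 \<Longrightarrow> m = 0"
    by (rule poly_mapping_eqI) (auto simp: mdeg_def in_keys_iff)
  then show ?thesis
    by auto
qed

text \<open>Degrees are integers, so that the degree \<open>d - e\<close> in
  \<open>hom_comp_mult\<close> makes sense for every \<open>d\<close>; a component of negative
  degree is 0.\<close>

lift_definition hom_comp :: "int \<Rightarrow> 'k::field mpoly \<Rightarrow> 'k mpoly" is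
  "\<lambda>d p m. if int (mdeg m) = d then p m else 0"
  by (erule rev_finite_subset) auto

lemma lookup_hom_comp: "lookup (hom_comp d p) m = (if int (mdeg m) = d then lookup p m else 0)"
  by transfer simp

lemma homogeneous_iff: "homogeneous d p \<longleftrightarrow> (\<forall>m. lookup p m \<noteq> 0 \<longrightarrow> int (mdeg m) = d)"
  by (auto simp: homogeneous_def in_keys_iff)

lemma homogeneous_hom_comp [simp]: "homogeneous d (hom_comp d p)"
  by (simp add: homogeneous_iff lookup_hom_comp)

lemma hom_comp_homogeneous: "homogeneous d p \<Longrightarrow> hom_comp d p = p"
  by (rule poly_mapping_eqI) (auto simp: homogeneous_iff lookup_hom_comp)

lemma hom_comp_add: "hom_comp d (p + q) = hom_comp d p + hom_comp d q"
  by (rule poly_mapping_eqI) (simp add: lookup_hom_comp lookup_add)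

lemma hom_comp_0 [simp]: "hom_comp d 0 = 0"
  by (rule poly_mapping_eqI) (simp add: lookup_hom_comp)

lemma hom_comp_sum: "hom_comp d (sum f A) = (\<Sum>x\<in>A. hom_comp d (f x))"
  by (induction A rule: infinite_finite_induct) (simp_all add: hom_comp_add)

lemma hom_comp_polyring: "p \<in> polyring n \<Longrightarrow> hom_comp d p \<in> polyring n"
  by (auto simp: polyring_alt in_keys_iff lookup_hom_comp split: if_splits)

lemma hom_comp_single_mult:
  "hom_comp d (single a c * p) = single a c * hom_comp (d - int (mdeg a)) p"
proof (rule poly_mapping_eqI)
  fix m
  show "lookup (hom_comp d (single a c * p)) m = lookup (single a c * hom_comp (d - int (mdeg a)) p) m"
  proof (cases "\<exists>b. m = a + b")
    case True
    then obtain b where "m = a + b" ..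
    then show ?thesis
      by (simp only: lookup_hom_comp lookup_single_mult_add mdeg_add) auto
  next
    case False
    then show ?thesis
      by (simp add: lookup_hom_comp lookup_single_mult_not)
  qed
qed

lemma hom_comp_mult:
  assumes "homogeneous e q"
  shows "hom_comp d (q * p) = q * hom_comp (d - e) p"
proof -
  have "hom_comp d (q * p) = (\<Sum>m\<in>keys q. hom_comp d (single m (lookup q m) * p))"
    by (subst poly_decomp[of q]) (simp add: sum_distrib_right hom_comp_sum)
  also have "\<dots> = (\<Sum>m\<in>keys q. single m (lookup q m) * hom_comp (d - e) p)"
    using assms by (intro sum.cong) (auto simp: hom_comp_single_mult homogeneous_def)
  also have "\<dots> = q * hom_comp (d - e) p"
    by (subst (3) poly_decomp[of q]) (simp add: sum_distrib_right)
  finally show ?thesis .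
qed

lemma homogeneous_0 [simp]: "homogeneous d 0"
  by (simp add: homogeneous_iff)

lemma homogeneous_add: "homogeneous d p \<Longrightarrow> homogeneous d q \<Longrightarrow> homogeneous d (p + q)"
  by (metis hom_comp_add hom_comp_homogeneous homogeneous_hom_comp)

lemma homogeneous_uminus: "homogeneous d p \<Longrightarrow> homogeneous d (- p)"
  by (simp add: homogeneous_iff)

lemma homogeneous_diff: "homogeneous d p \<Longrightarrow> homogeneous d q \<Longrightarrow> homogeneous d (p - q)"
  using homogeneous_add[of d p "- q"] homogeneous_uminus[of d q] by simp

lemma homogeneous_sum: "(\<And>x. x \<in> A \<Longrightarrow> homogeneous d (f x)) \<Longrightarrow> homogeneous d (sum f A)"
  by (induction A rule: infinite_finite_induct) (auto intro: homogeneous_add)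

lemma homogeneous_mult: "homogeneous d p \<Longrightarrow> homogeneous e q \<Longrightarrow> homogeneous (d + e) (p * q)"
  by (metis add_diff_cancel_left' hom_comp_homogeneous hom_comp_mult homogeneous_hom_comp)

lemma homogeneous_mult': "homogeneous d p \<Longrightarrow> homogeneous e q \<Longrightarrow> k = d + e \<Longrightarrow> homogeneous k (p * q)"
  by (simp add: homogeneous_mult)

lemma homogeneous_single: "homogeneous (int (mdeg a)) (single a c)"
  by (simp add: homogeneous_iff lookup_single when_def)

lemma homogeneous_var [simp]: "homogeneous 1 (var v)"
  using homogeneous_single[of "single v 1"] by (simp add: var_def)

lemma homogeneous_const [simp]: "homogeneous 0 (const c)"
  using homogeneous_single[of 0 c] by (simp add: const_def)

lemma homogeneous_1 [simp]: "homogeneous 0 1"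
  using homogeneous_const[of 1] by (simp add: const_1)

text \<open>Homogeneity in the form in which it is applied: a decomposition of a homogeneous element
  may be projected to its degree without leaving the ideals.\<close>

definition graded_ideal :: "nat \<Rightarrow> 'k::field mpoly set \<Rightarrow> bool" where
  "graded_ideal n I \<longleftrightarrow> is_ideal n I \<and> (\<forall>p\<in>I. \<forall>d. hom_comp d p \<in> I)"

lemma graded_idealD:
  assumes "graded_ideal n I"
  shows graded_ideal_ideal: "is_ideal n I" and graded_ideal_comp: "p \<in> I \<Longrightarrow> hom_comp d p \<in> I"
  using assms by (auto simp: graded_ideal_def)

lemma graded_ideal_polyring: "graded_ideal n (polyring n)"
  by (simp add: graded_ideal_def is_ideal_polyring hom_comp_polyring)

text \<open>The elements all of whose components lie in the ideal form an ideal that contains the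
  generators, hence everything. The same closure argument is used below for other properties of the
  elements of a generated ideal.\<close>

lemma graded_ideal_gen:
  assumes S: "S \<subseteq> polyring n" and hom: "\<forall>f\<in>S. \<exists>d. homogeneous d f"
  shows "graded_ideal n (ideal_gen n S)"
proof -
  let ?I = "ideal_gen n S"
  let ?J = "{p \<in> ?I. \<forall>d. hom_comp d p \<in> ?I}"
  have I: "is_ideal n ?I"
    by (rule is_ideal_gen[OF S])
  have "is_ideal n ?J"
  proof (rule is_idealI)
    show "?J \<subseteq> polyring n" "0 \<in> ?J"
      using ideal_sub[OF I] ideal_0[OF I] by auto
    show "p + q \<in> ?J" if "p \<in> ?J" "q \<in> ?J" for p q
      using that ideal_add[OF I] by (simp add: hom_comp_add)
    show "single a c * p \<in> ?J" if "keys a \<subseteq> vars n" "p \<in> ?J" for a c p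
      using that ideal_mult[OF I polyring_single[OF that(1)]] by (simp add: hom_comp_single_mult)
  qed
  moreover have "hom_comp d f \<in> ?I" if f: "f \<in> S" for d f
  proof -
    obtain e where e: "homogeneous e f" using hom f by blast
    have "hom_comp d f = 0" if "d \<noteq> e"
    proof (rule poly_mapping_eqI)
      show "lookup (hom_comp d f) m = lookup 0 m" for m
        using e that unfolding homogeneous_iff lookup_hom_comp lookup_zero by metis
    qed
    then have "hom_comp d f = (if d = e then f else 0)"
      using hom_comp_homogeneous[OF e] by simp
    then show ?thesis
      using ideal_0[OF I] ideal_gen_base[OF f] by simp
  qed
  ultimately have "?I \<subseteq> ?J"
    by (intro ideal_gen_least) (auto intro: ideal_gen_base)
  with I show ?thesis
    by (auto simp: graded_ideal_def)
qed

section \<open>Division by an indeterminate\<close>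

text \<open>The operator \<open>divar v\<close> divides by \<open>v\<close> and drops the terms free of \<open>v\<close>.\<close>

definition divar :: "indet \<Rightarrow> 'k::field mpoly \<Rightarrow> 'k mpoly" where
  "divar v = Poly_Mapping.map_key (\<lambda>m. single v (Suc 0) + m)"

lemma lookup_divar: "lookup (divar v p) m = lookup p (single v (Suc 0) + m)"
  by (simp add: divar_def map_key.rep_eq inj_def)

lemma divar_0 [simp]: "divar v 0 = 0"
  by (rule poly_mapping_eqI) (simp add: lookup_divar)

lemma divar_add: "divar v (p + q) = divar v p + divar v q"
  by (rule poly_mapping_eqI) (simp add: lookup_divar lookup_add)

lemma divar_uminus: "divar v (- p) = - divar v p"
  by (rule poly_mapping_eqI) (simp add: lookup_divar)

lemma divar_diff: "divar v (p - q) = divar v p - divar v q"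
  by (rule poly_mapping_eqI) (simp add: lookup_divar lookup_minus)

lemma divar_sum: "divar v (sum f A) = (\<Sum>x\<in>A. divar v (f x))"
  by (induction A rule: infinite_finite_induct) (simp_all add: divar_add)

lemma divar_var_mult [simp]: "divar v (var v * p) = p"
  by (rule poly_mapping_eqI) (simp add: lookup_divar lookup_var_mult lookup_add)

lemma lookup_mult_divar: "lookup (var v * divar v p) m = (if lookup m v = 0 then 0 else lookup p m)"
  by (simp add: lookup_var_mult lookup_divar add_single_minus)

lemma divar_polyring: "p \<in> polyring n \<Longrightarrow> divar v p \<in> polyring n"
  by (fastforce simp: polyring_alt in_keys_iff lookup_divar lookup_add subset_iff)

lemma homogeneous_divar: "homogeneous d p \<Longrightarrow> homogeneous (d - 1) (divar v p)"
  by (fastforce simp: homogeneous_iff lookup_divar mdeg_add)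

lemma divar_single_mult_free:
  assumes "lookup a v = 0"
  shows "divar v (single a c * p) = single a c * divar v p"
proof (rule poly_mapping_eqI)
  fix m
  show "lookup (divar v (single a c * p)) m = lookup (single a c * divar v p) m"
  proof (cases "\<exists>b. m = a + b")
    case True
    then obtain b where b: "m = a + b" ..
    then have "lookup (single a c * p) (single v (Suc 0) + m) = c * lookup p (single v (Suc 0) + b)"
      using lookup_single_mult_add[of a c p "single v (Suc 0) + b"] by (simp add: algebra_simps)
    then show ?thesis
      by (simp add: lookup_divar b lookup_single_mult_add)
  next
    case False
    have "single v (Suc 0) + m \<noteq> a + b" for b
    proof
      assume eq: "single v (Suc 0) + m = a + b"
      then have "lookup b v \<noteq> 0"
        using assms by (metis lookup_add lookup_single_eq add_0 add_is_0 nat.distinct(1))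
      then have "single v (Suc 0) + m = single v (Suc 0) + (a + (b - single v (Suc 0)))"
        using eq add_single_minus[of b v] by (simp add: algebra_simps)
      then show False
        using False by auto
    qed
    with False show ?thesis
      by (simp add: lookup_divar lookup_single_mult_not)
  qed
qed

lemma divar_var_mult_free: "u \<noteq> v \<Longrightarrow> divar v (var u * p) = var u * divar v p"
  using divar_single_mult_free[of "single u 1" v 1 p] by (simp add: var_def lookup_single)

lemma divar_single_mult:
  assumes "lookup a v \<noteq> 0"
  shows "divar v (single a c * p) = single (a - single v (Suc 0)) c * p"
proof -
  have "single a c * p = var v * (single (a - single v (Suc 0)) c * p)"
    using add_single_minus[OF assms] by (simp add: var_def mult_single mult.assoc[symmetric])
  then show ?thesis
    by simp
qed

text \<open>Typical for ideals extended from a ring without \<open>v\<close>. It makes the Koszul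
  contraction along \<open>v\<close> preserve chains with coefficients in \<open>I\<close>.\<close>

definition divar_closed :: "indet \<Rightarrow> 'k::field mpoly set \<Rightarrow> bool" where
  "divar_closed v I \<longleftrightarrow> (\<forall>p\<in>I. divar v p \<in> I)"

lemma divar_closed_polyring: "divar_closed v (polyring n)"
  by (simp add: divar_closed_def divar_polyring)

text \<open>If a term \<open>a\<close> contains \<open>v\<close>, dividing its product with
  \<open>p\<close> by \<open>v\<close> changes only \<open>a\<close>; otherwise the division acts on
  \<open>p\<close> alone. So it is enough to look at the generators.\<close>

lemma divar_closed_ideal_gen:
  assumes S: "S \<subseteq> polyring n" and free: "\<And>f. f \<in> S \<Longrightarrow> divar v f \<in> ideal_gen n S"
  shows "divar_closed v (ideal_gen n S)"
proof -
  let ?I = "ideal_gen n S"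
  let ?J = "{p \<in> ?I. divar v p \<in> ?I}"
  have I: "is_ideal n ?I"
    by (rule is_ideal_gen[OF S])
  have "single a c * p \<in> ?J" if "keys a \<subseteq> vars n" "p \<in> ?J" for a c p
  proof (cases "lookup a v = 0")
    case True
    then show ?thesis
      using that ideal_mult[OF I polyring_single[OF that(1)]] by (simp add: divar_single_mult_free)
  next
    case False
    have "keys (a - single v (Suc 0)) \<subseteq> vars n"
      using that by (auto simp: in_keys_iff lookup_minus subset_iff)
    then show ?thesis
      using False that ideal_mult[OF I polyring_single] by (simp add: divar_single_mult)
  qed
  then have "is_ideal n ?J"
  proof (intro is_idealI)
    show "?J \<subseteq> polyring n" "0 \<in> ?J"
      using ideal_sub[OF I] ideal_0[OF I] by auto
    show "p + q \<in> ?J" if "p \<in> ?J" "q \<in> ?J" for p q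
      using that ideal_add[OF I] by (simp add: divar_add)
  qed
  then have "?I \<subseteq> ?J"
    using free by (intro ideal_gen_least) (auto intro: ideal_gen_base)
  then show ?thesis
    by (auto simp: divar_closed_def)
qed

text \<open>\<open>p\<close> is recovered from the product by dividing by \<open>v\<close>, so
  \<open>v\<close> is a nonzerodivisor modulo \<open>I\<close>.\<close>

lemma divar_closed_colon: "divar_closed v I \<Longrightarrow> var v * p \<in> I \<Longrightarrow> p \<in> I"
  by (metis divar_closed_def divar_var_mult)

section \<open>The Koszul complex\<close>

text \<open>Chains are functions on sets of indeterminates; the value at \<open>S\<close> is the coefficient of the
  exterior monomial on \<open>S\<close>.\<close>

fun idx :: "indet \<Rightarrow> nat" where
  "idx (Xvar i) = 2 * i"
| "idx (Yvar i) = Suc (2 * i)"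

lemma idx_inj: "idx u = idx v \<longleftrightarrow> u = v"
  by (cases u; cases v) (auto, presburger+)

text \<open>The sign that moves \<open>v\<close> to its place in the exterior monomial on
  \<open>T\<close>. It is a polynomial, not a scalar, so that it multiplies coefficients
  directly.\<close>

definition sg :: "indet \<Rightarrow> indet set \<Rightarrow> 'k::field mpoly" where
  "sg v T = (- 1) ^ card {u \<in> T. idx u < idx v}"

lemma sg_cases: "(sg v T :: 'k::field mpoly) = 1 \<or> sg v T = (- 1 :: 'k mpoly)"
  unfolding sg_def by (cases "even (card {u \<in> T. idx u < idx v})") simp_all

lemma sg_square [simp]:
  fixes p :: "'k::field mpoly"
  shows "sg v T * (sg v T * p) = p"
  using sg_cases[of v T, where 'k = 'k] by auto

lemma sg_insert:
  assumes "finite T" "u \<notin> T"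
  shows "sg v (insert u T) = (if idx u < idx v then - sg v T else sg v T :: 'k::field mpoly)"
proof (cases "idx u < idx v")
  case True
  then have "{w \<in> insert u T. idx w < idx v} = insert u {w \<in> T. idx w < idx v}"
    by auto
  with True assms show ?thesis
    by (simp add: sg_def)
next
  case False
  then have "{w \<in> insert u T. idx w < idx v} = {w \<in> T. idx w < idx v}"
    by auto
  with False show ?thesis
    by (simp add: sg_def)
qed

lemma sg_insert_same [simp]: "sg v (insert v T) = (sg v T :: 'k::field mpoly)"
proof -
  have "{u \<in> insert v T. idx u < idx v} = {u \<in> T. idx u < idx v}"
    by auto
  then show ?thesis
    by (simp add: sg_def)
qed

lemma sg_swap:
  assumes "finite T" "u \<notin> T" "v \<notin> T" "u \<noteq> v"
  shows "sg v T * sg u (insert v T) = - (sg u T * sg v (insert u T) :: 'k::field mpoly)"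
  unfolding sg_insert[OF assms(1,2)] sg_insert[OF assms(1,3)]
  using assms(4) idx_inj[of u v] by (cases "idx u < idx v") (simp_all add: mult.commute)

lemma divar_sg:
  fixes p :: "'k::field mpoly"
  shows "divar v (sg u T * p) = sg u T * divar v p"
  using sg_cases[of u T, where 'k = 'k] by (auto simp: divar_uminus)

lemma sg_polyring [simp]: "(sg v T :: 'k::field mpoly) \<in> polyring n"
  using sg_cases[of v T, where 'k = 'k] polyring_uminus[of 1 n] by auto

lemma homogeneous_sg:
  fixes p :: "'k::field mpoly"
  shows "homogeneous d p \<Longrightarrow> homogeneous d (sg u T * p)"
  using sg_cases[of u T, where 'k = 'k] by (auto intro: homogeneous_uminus)

text \<open>The Koszul differential read off at a target \<open>T\<close>: the exterior monomial on
  \<open>insert v T\<close> contributes \<open>v\<close> times its coefficient, so the sum runs over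
  the indeterminates missing from \<open>T\<close>.\<close>

definition kd :: "nat \<Rightarrow> (indet set \<Rightarrow> 'k::field mpoly) \<Rightarrow> indet set \<Rightarrow> 'k mpoly" where
  "kd n \<omega> T = (if T \<subseteq> vars n
     then \<Sum>v\<in>vars n - T. sg v T * (var v * \<omega> (insert v T)) else 0)"

text \<open>Division of the coefficients by \<open>v\<close> followed by exterior multiplication
  with the basis element of \<open>v\<close>; terms free of \<open>v\<close> are sent to 0.\<close>

definition kh :: "indet \<Rightarrow> (indet set \<Rightarrow> 'k::field mpoly) \<Rightarrow> indet set \<Rightarrow> 'k mpoly" where
  "kh v \<omega> S = (if v \<in> S then sg v S * divar v (\<omega> (S - {v})) else 0)"

text \<open>The part in which \<open>v\<close> occurs neither in the exterior monomial nor in the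
  coefficient: what the contraction along \<open>v\<close> leaves over.\<close>

definition kpi :: "indet \<Rightarrow> (indet set \<Rightarrow> 'k::field mpoly) \<Rightarrow> indet set \<Rightarrow> 'k mpoly" where
  "kpi v \<omega> S = (if v \<in> S then 0 else \<omega> S - var v * divar v (\<omega> S))"

lemma kd_add: "kd n (\<alpha> + \<beta>) = kd n \<alpha> + kd n \<beta>"
  by (rule ext) (simp add: kd_def algebra_simps sum.distrib)

lemma kd_mult: "kd n (\<lambda>S. f * \<beta> S) T = f * kd n \<beta> T"
  by (simp add: kd_def sum_distrib_left algebra_simps)

lemma kd_0 [simp]: "kd n 0 = 0"
  by (rule ext) (simp add: kd_def)

lemma kd_uminus: "kd n (- \<alpha>) = - kd n \<alpha>"
  by (rule ext) (simp add: kd_def sum_negf)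

lemma kd_diff: "kd n (\<alpha> - \<beta>) = kd n \<alpha> - kd n \<beta>"
  using kd_add[of n \<alpha> "- \<beta>"] by (simp add: kd_uminus)

text \<open>Adding one element at a time cancels \<open>f a v\<close> against \<open>f v a\<close>.
  Concluding from the fact that the sum equals its own negative would fail in characteristic
  2.\<close>

lemma antisym_sum_zero:
  fixes f :: "indet \<Rightarrow> indet \<Rightarrow> 'a::ab_group_add"
  assumes fin: "finite A"
    and anti: "\<And>u v. u \<in> A \<Longrightarrow> v \<in> A \<Longrightarrow> u \<noteq> v \<Longrightarrow> f u v = - f v u"
  shows "(\<Sum>v\<in>A. \<Sum>u\<in>A - {v}. f v u) = 0"
  using assms
proof (induction A)
  case empty
  then show ?case by simp
next
  case (insert a A)
  have "(\<Sum>v\<in>insert a A. \<Sum>u\<in>insert a A - {v}. f v u) =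
      (\<Sum>u\<in>A. f a u) + (\<Sum>v\<in>A. \<Sum>u\<in>insert a A - {v}. f v u)"
    using insert.hyps by (simp add: insert_Diff_if)
  also have "(\<Sum>v\<in>A. \<Sum>u\<in>insert a A - {v}. f v u) = (\<Sum>v\<in>A. f v a + (\<Sum>u\<in>A - {v}. f v u))"
  proof (rule sum.cong)
    fix v assume v: "v \<in> A"
    then have "insert a A - {v} = insert a (A - {v})" using insert.hyps by auto
    then show "(\<Sum>u\<in>insert a A - {v}. f v u) = f v a + (\<Sum>u\<in>A - {v}. f v u)"
      using insert.hyps by simp
  qed simp
  also have "\<dots> = (\<Sum>v\<in>A. f v a)"
  proof -
    have "(\<Sum>v\<in>A. \<Sum>u\<in>A - {v}. f v u) = 0"
      by (rule insert.IH) (use insert.prems in blast)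
    then show ?thesis
      by (simp only: sum.distrib add_0_right)
  qed
  also have "\<dots> = (\<Sum>v\<in>A. - f a v)"
    using insert.hyps by (intro sum.cong refl insert.prems) auto
  finally show ?case
    by (simp add: sum_negf)
qed

lemma kd_kd:
  fixes \<omega> :: "indet set \<Rightarrow> 'k::field mpoly"
  shows "kd n (kd n \<omega>) = 0"
proof
  fix T
  show "kd n (kd n \<omega>) T = 0 T"
  proof (cases "T \<subseteq> vars n")
    case True
    then have fin: "finite T" by (rule finite_subset) simp
    define f where "f v u = sg v T * (var v * (sg u (insert v T) * (var u * \<omega> (insert u (insert v T)))))" for v u
    have "kd n (kd n \<omega>) T = (\<Sum>v\<in>vars n - T. \<Sum>u\<in>vars n - insert v T. f v u)"
      using True by (simp add: kd_def f_def sum_distrib_left)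
    also have "\<dots> = (\<Sum>v\<in>vars n - T. \<Sum>u\<in>(vars n - T) - {v}. f v u)"
      by (intro sum.cong) auto
    also have "\<dots> = 0"
    proof (rule antisym_sum_zero)
      fix u v assume uv: "u \<in> vars n - T" "v \<in> vars n - T" "u \<noteq> v"
      have f_alt: "f v u = (sg v T * sg u (insert v T)) * (var v * (var u * \<omega> (insert u (insert v T))))" for u v
        by (simp add: f_def ac_simps)
      show "f u v = - f v u"
        unfolding f_alt using sg_swap[OF fin, of v u, where 'k = 'k] uv
        by (simp add: insert_commute mult.left_commute)
    qed simp
    finally show ?thesis by simp
  qed (simp add: kd_def)
qed

text \<open>For the indeterminate \<open>v\<close> alone this is the contraction of multiplication
  by \<open>v\<close> on \<open>k[v]\<close> onto the constants. Multiplication by any other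
  indeterminate commutes with division by \<open>v\<close>, and its two contributions cancel by the
  sign of a transposition.\<close>

theorem koszul_homotopy:
  fixes \<omega> :: "indet set \<Rightarrow> 'k::field mpoly"
  assumes v: "v \<in> vars n" and supp: "\<And>S. \<omega> S \<noteq> 0 \<Longrightarrow> S \<subseteq> vars n"
  shows "kd n (kh v \<omega>) + kh v (kd n \<omega>) = \<omega> - kpi v \<omega>"
proof
  fix T
  show "(kd n (kh v \<omega>) + kh v (kd n \<omega>)) T = (\<omega> - kpi v \<omega>) T"
  proof (cases "T \<subseteq> vars n")
    case False
    then have "\<omega> T = 0" using supp by blast
    moreover have "kd n \<omega> (T - {v}) = 0" if "v \<in> T"
      using False v by (auto simp: kd_def)
    ultimately show ?thesis
      using False by (simp add: kd_def[of n "kh v \<omega>"] kh_def[of v "kd n \<omega>"] kpi_def)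
  next
    case True
    then have fin: "finite T" by (rule finite_subset) simp
    show ?thesis
    proof (cases "v \<in> T")
      case False
      have "kd n (kh v \<omega>) T = (\<Sum>u\<in>vars n - T. if u = v then var v * divar v (\<omega> T) else 0)"
        unfolding kd_def if_P[OF True]
        using False by (intro sum.cong) (auto simp: kh_def mult.left_commute[of "var v"])
      also have "\<dots> = var v * divar v (\<omega> T)"
        using v False by simp
      finally show ?thesis
        using False by (simp add: kh_def[of v "kd n \<omega>"] kpi_def)
    next
      case vT: True
      define T' where "T' = T - {v}"
      have T: "T = insert v T'" "v \<notin> T'" "finite T'" "T' \<subseteq> vars n"
        using vT fin True by (auto simp: T'_def)
      define X where "X = (\<Sum>u\<in>vars n - T. sg u T' * (var u * divar v (\<omega> (insert u T'))))"
      have "kd n (kh v \<omega>) T =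
          (\<Sum>u\<in>vars n - T. - (sg v T * (sg u T' * (var u * divar v (\<omega> (insert u T'))))))"
        unfolding kd_def if_P[OF True]
      proof (rule sum.cong)
        fix u assume u: "u \<in> vars n - T"
        then have uv: "u \<noteq> v" "u \<notin> T'" "insert u T - {v} = insert u T'"
          using T by auto
        have sgn: "sg u T * sg v (insert u T) = - (sg v T' * sg u T' :: 'k mpoly)"
        proof -
          have "sg u T = (if idx v < idx u then - sg u T' else sg u T' :: 'k mpoly)"
            unfolding T(1) by (rule sg_insert[OF T(3,2)])
          moreover have "sg v (insert u T) = (if idx u < idx v then - sg v T' else sg v T' :: 'k mpoly)"
            unfolding T(1) insert_commute[of u v] sg_insert_same by (rule sg_insert[OF T(3) uv(2)])
          ultimately show ?thesis
            using uv(1) idx_inj[of u v] by (cases "idx u < idx v") (simp_all add: mult.commute)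
        qed
        have "sg u T * (var u * (sg v (insert u T) * divar v (\<omega> (insert u T')))) =
            (sg u T * sg v (insert u T)) * (var u * divar v (\<omega> (insert u T')))"
          by (simp only: ac_simps)
        then have "sg u T * (var u * (sg v (insert u T) * divar v (\<omega> (insert u T')))) =
            - (sg v T' * sg u T') * (var u * divar v (\<omega> (insert u T')))"
          by (simp only: sgn)
        then show "sg u T * (var u * kh v \<omega> (insert u T)) =
            - (sg v T * (sg u T' * (var u * divar v (\<omega> (insert u T')))))"
          using uv vT T by (simp add: kh_def mult.assoc)
      qed simp
      then have "kd n (kh v \<omega>) T = - (sg v T * X)"
        by (simp add: X_def sum_negf sum_distrib_left)
      moreover have "kh v (kd n \<omega>) T = sg v T * divar v (kd n \<omega> T')"
        using vT by (simp add: kh_def T'_def)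
      moreover have "kd n \<omega> T' = sg v T' * (var v * \<omega> T) +
          (\<Sum>u\<in>vars n - T. sg u T' * (var u * \<omega> (insert u T')))"
      proof -
        have V: "vars n - T' = insert v (vars n - T)" and vT: "v \<notin> vars n - T"
          using T v by auto
        have "(\<Sum>u\<in>vars n - T'. sg u T' * (var u * \<omega> (insert u T'))) =
            sg v T' * (var v * \<omega> (insert v T')) + (\<Sum>u\<in>vars n - T. sg u T' * (var u * \<omega> (insert u T')))"
          unfolding V by (rule sum.insert[OF _ vT]) simp
        then show ?thesis
          using T(4) by (simp add: kd_def T(1)[symmetric])
      qed
      moreover have "divar v (\<Sum>u\<in>vars n - T. sg u T' * (var u * \<omega> (insert u T'))) =
          X"
        unfolding divar_sum X_def using \<open>v \<in> T\<close> by (intro sum.cong refl) (metis DiffD2 divar_sg divar_var_mult_free)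
      moreover have "sg v T = (sg v T' :: 'k mpoly)"
        unfolding T(1) by (rule sg_insert_same)
      ultimately show ?thesis
        using vT by (simp only: kpi_def divar_add divar_sg distrib_left divar_var_mult
          sg_square plus_fun_apply minus_apply if_True) simp
    qed
  qed
qed

section \<open>Contraction along several indeterminates\<close>

lemma lookup_kpi: "lookup (kpi v \<omega> S) m = (if v \<in> S \<or> lookup m v \<noteq> 0 then 0 else lookup (\<omega> S) m)"
  by (simp add: kpi_def lookup_minus lookup_mult_divar)

text \<open>Each contraction is applied to what the preceding ones have left over, so that the
  homotopies add up.\<close>

fun kH :: "indet list \<Rightarrow> (indet set \<Rightarrow> 'k::field mpoly) \<Rightarrow> indet set \<Rightarrow> 'k mpoly" where
  "kH [] \<omega> = 0"
| "kH (v # vs) \<omega> = kh v \<omega> + kH vs (kpi v \<omega>)"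

fun kP :: "indet list \<Rightarrow> (indet set \<Rightarrow> 'k::field mpoly) \<Rightarrow> indet set \<Rightarrow> 'k mpoly" where
  "kP [] \<omega> = \<omega>"
| "kP (v # vs) \<omega> = kP vs (kpi v \<omega>)"

lemma lookup_kP: "lookup (kP vs \<omega> S) m =
    (if S \<inter> set vs = {} \<and> keys m \<inter> set vs = {} then lookup (\<omega> S) m else 0)"
  by (induction vs arbitrary: \<omega>) (auto simp: lookup_kpi in_keys_iff)

text \<open>By the homotopy formula a cycle differs from its projection by a boundary; hence the
  projection is again a cycle and the induction can go on.\<close>

lemma kd_kH:
  assumes "set vs \<subseteq> vars n" "\<And>S. \<omega> S \<noteq> 0 \<Longrightarrow> S \<subseteq> vars n" "kd n \<omega> = 0"
  shows "kd n (kH vs \<omega>) = \<omega> - kP vs \<omega>"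
  using assms
proof (induction vs arbitrary: \<omega>)
  case Nil
  show ?case
    by (simp only: kH.simps kP.simps diff_self kd_0)
next
  case (Cons v vs)
  have kh0: "kh v 0 = 0"
    by (rule ext) (simp add: kh_def)
  have 1: "kd n (kh v \<omega>) = \<omega> - kpi v \<omega>"
    using koszul_homotopy[of v n \<omega>] Cons.prems unfolding Cons.prems(3) kh0 by simp
  then have "kpi v \<omega> = \<omega> - kd n (kh v \<omega>)"
    by (simp add: algebra_simps)
  then have 2: "kd n (kpi v \<omega>) = 0"
    by (simp only: kd_diff kd_kd Cons.prems(3) diff_self)
  have "kd n (kH vs (kpi v \<omega>)) = kpi v \<omega> - kP vs (kpi v \<omega>)"
  proof (rule Cons.IH)
    show "set vs \<subseteq> vars n" "kd n (kpi v \<omega>) = 0"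
      using Cons.prems(1) 2 by auto
    show "S \<subseteq> vars n" if "kpi v \<omega> S \<noteq> 0" for S
    proof (rule Cons.prems(2))
      show "\<omega> S \<noteq> 0"
        using that by (auto simp: kpi_def split: if_splits)
    qed
  qed
  with 1 show ?case
    by (simp only: kH.simps kP.simps kd_add) (simp add: fun_eq_iff)
qed

section \<open>Chains with coefficients in an ideal, with exterior degree and internal
  degree\<close>

definition uchain :: "nat \<Rightarrow> 'k::field mpoly set \<Rightarrow> int \<Rightarrow> (indet set \<Rightarrow> 'k mpoly) set" where
  "uchain n L i = {\<omega>. \<forall>S. \<omega> S \<in> L \<and> (\<omega> S \<noteq> 0 \<longrightarrow> S \<subseteq> vars n \<and> int (card S) = i)}"

text \<open>An exterior monomial on \<open>i\<close> indeterminates has degree \<open>i\<close>,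
  whence coefficients of degree \<open>j - i\<close>. The index \<open>i\<close> is an integer, so
  that the differential of a chain of exterior degree 0 lands in degree -1, where only 0
  exists.\<close>

definition chain :: "nat \<Rightarrow> 'k::field mpoly set \<Rightarrow> int \<Rightarrow> int \<Rightarrow> (indet set \<Rightarrow> 'k mpoly) set" where
  "chain n L i j = {\<omega> \<in> uchain n L i. \<forall>S. homogeneous (j - i) (\<omega> S)}"

lemma uchainD:
  assumes "\<omega> \<in> uchain n L i"
  shows "\<omega> S \<in> L" "\<omega> S \<noteq> 0 \<Longrightarrow> S \<subseteq> vars n" "\<omega> S \<noteq> 0 \<Longrightarrow> int (card S) = i"
  using assms by (auto simp: uchain_def)

lemma chainD:
  assumes "\<omega> \<in> chain n L i j"
  shows "\<omega> S \<in> L" "\<omega> S \<noteq> 0 \<Longrightarrow> S \<subseteq> vars n" "\<omega> S \<noteq> 0 \<Longrightarrow> int (card S) = i"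
    "homogeneous (j - i) (\<omega> S)"
  using assms by (auto simp: uchain_def chain_def)

lemma uchain_0: "0 \<in> L \<Longrightarrow> 0 \<in> uchain n L i"
  by (simp add: uchain_def)

lemma chain_0: "0 \<in> L \<Longrightarrow> 0 \<in> chain n L i j"
  by (simp add: chain_def uchain_0)

lemma chain_mono: "L \<subseteq> L' \<Longrightarrow> chain n L i j \<subseteq> chain n L' i j"
  by (auto simp: chain_def uchain_def)

lemma uchain_add:
  assumes L: "is_ideal n L" and "\<alpha> \<in> uchain n L i" "\<beta> \<in> uchain n L i"
  shows "\<alpha> + \<beta> \<in> uchain n L i"
proof -
  have "S \<subseteq> vars n \<and> int (card S) = i" if "\<alpha> S + \<beta> S \<noteq> 0" for S
  proof -
    have "\<alpha> S \<noteq> 0 \<or> \<beta> S \<noteq> 0" using that by auto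
    then show ?thesis using assms(2,3) by (auto simp: uchain_def)
  qed
  then show ?thesis
    using assms by (simp add: uchain_def ideal_add[OF L])
qed

lemma chain_add:
  "is_ideal n L \<Longrightarrow> \<alpha> \<in> chain n L i j \<Longrightarrow> \<beta> \<in> chain n L i j \<Longrightarrow> \<alpha> + \<beta> \<in> chain n L i j"
  by (simp add: chain_def uchain_add homogeneous_add)

lemma chain_mult:
  assumes f: "homogeneous e f" and fL: "\<And>p. p \<in> L \<Longrightarrow> f * p \<in> L'" and \<omega>: "\<omega> \<in> chain n L i j"
  shows "(\<lambda>S. f * \<omega> S) \<in> chain n L' i (j + e)"
proof -
  have "homogeneous (j + e - i) (f * \<omega> S)" for S
    by (rule homogeneous_mult'[OF f chainD(4)[OF \<omega>]]) simp
  moreover have "\<omega> S \<noteq> 0" if "f * \<omega> S \<noteq> 0" for S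
    using that by auto
  ultimately show ?thesis
    using chainD(1,2,3)[OF \<omega>] fL by (simp add: chain_def uchain_def)
qed

lemma chain_uminus:
  assumes L: "is_ideal n L" and \<omega>: "\<omega> \<in> chain n L i j"
  shows "- \<omega> \<in> chain n L i j"
  using \<omega> by (simp add: chain_def uchain_def homogeneous_uminus ideal_uminus[OF L])

lemma chain_diff:
  "is_ideal n L \<Longrightarrow> \<alpha> \<in> chain n L i j \<Longrightarrow> \<beta> \<in> chain n L i j \<Longrightarrow> \<alpha> - \<beta> \<in> chain n L i j"
  using chain_add[of n L \<alpha> i j "- \<beta>"] chain_uminus[of n L \<beta> i j] by simp

lemma kd_uchain:
  assumes L: "is_ideal n L" and \<omega>: "\<omega> \<in> uchain n L i"
  shows "kd n \<omega> \<in> uchain n L (i - 1)"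
proof -
  have "kd n \<omega> T \<in> L" for T
    using uchainD(1)[OF \<omega>]
    by (auto simp: kd_def intro!: ideal_sum_mem[OF L] ideal_mult[OF L] polyring_var ideal_0[OF L])
  moreover have "T \<subseteq> vars n \<and> int (card T) = i - 1" if "kd n \<omega> T \<noteq> 0" for T
  proof -
    have T: "T \<subseteq> vars n"
      using that by (auto simp: kd_def split: if_splits)
    then have "finite T"
      using finite_subset finite_vars by blast
    have "\<exists>v\<in>vars n - T. \<omega> (insert v T) \<noteq> 0"
    proof (rule ccontr)
      assume "\<not> ?thesis"
      then have "kd n \<omega> T = 0" by (simp add: kd_def)
      with that show False ..
    qed
    then obtain v where "v \<in> vars n - T" "\<omega> (insert v T) \<noteq> 0"
      by blast
    then show ?thesis
      using uchainD(3)[OF \<omega>, of "insert v T"] T \<open>finite T\<close> by auto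
  qed
  ultimately show ?thesis
    by (auto simp: uchain_def)
qed

lemma kd_chain:
  assumes L: "is_ideal n L" and \<omega>: "\<omega> \<in> chain n L i j"
  shows "kd n \<omega> \<in> chain n L (i - 1) j"
proof -
  have "homogeneous (j - (i - 1)) (kd n \<omega> T)" for T
    using chainD(4)[OF \<omega>]
    by (auto simp: kd_def intro!: homogeneous_sum homogeneous_sg homogeneous_mult'[OF homogeneous_var])
  then show ?thesis
    using kd_uchain[OF L] \<omega> by (auto simp: chain_def)
qed

lemma kh_uchain:
  assumes L: "is_ideal n L" "divar_closed v L" and v: "v \<in> vars n" and \<omega>: "\<omega> \<in> uchain n L i"
  shows "kh v \<omega> \<in> uchain n L (i + 1)"
proof -
  have "kh v \<omega> S \<in> L" for S
    using uchainD(1)[OF \<omega>] L(2)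
    by (auto simp: kh_def divar_closed_def intro: ideal_mult[OF L(1)] ideal_0[OF L(1)])
  moreover have "S \<subseteq> vars n \<and> int (card S) = i + 1" if "kh v \<omega> S \<noteq> 0" for S
  proof -
    have S: "v \<in> S" "\<omega> (S - {v}) \<noteq> 0"
      using that by (auto simp: kh_def split: if_splits)
    have sub: "S - {v} \<subseteq> vars n" and card: "int (card (S - {v})) = i"
      using uchainD(2,3)[OF \<omega> S(2)] .
    have SV: "S \<subseteq> vars n"
      using sub v by blast
    then have "finite S"
      by (rule finite_subset) simp
    then have "card S = Suc (card (S - {v}))"
      using S(1) by (rule card.remove)
    with card have "int (card S) = i + 1"
      by linarith
    with SV show ?thesis ..
  qed
  ultimately show ?thesis
    by (auto simp: uchain_def)
qed

lemma kh_chain: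
  assumes L: "is_ideal n L" "divar_closed v L" and v: "v \<in> vars n" and \<omega>: "\<omega> \<in> chain n L i j"
  shows "kh v \<omega> \<in> chain n L (i + 1) j"
proof -
  have "homogeneous (j - (i + 1)) (kh v \<omega> S)" for S
    using homogeneous_divar[OF chainD(4)[OF \<omega>]]
    by (auto simp: kh_def algebra_simps intro!: homogeneous_sg)
  then show ?thesis
    using kh_uchain[OF L v] \<omega> by (auto simp: chain_def)
qed

lemma kpi_uchain:
  assumes L: "is_ideal n L" "divar_closed v L" and v: "v \<in> vars n" and \<omega>: "\<omega> \<in> uchain n L i"
  shows "kpi v \<omega> \<in> uchain n L i"
proof -
  have "kpi v \<omega> S \<in> L" for S
  proof -
    have "divar v (\<omega> S) \<in> L"
      using uchainD(1)[OF \<omega>] L(2) by (simp add: divar_closed_def)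
    then show ?thesis
      unfolding kpi_def
      using ideal_diff[OF L(1) uchainD(1)[OF \<omega>] ideal_mult[OF L(1) polyring_var[OF v]]] ideal_0[OF L(1)]
      by simp
  qed
  moreover have "\<omega> S \<noteq> 0" if "kpi v \<omega> S \<noteq> 0" for S
    using that by (auto simp: kpi_def split: if_splits)
  ultimately show ?thesis
    using uchainD[OF \<omega>] by (auto simp: uchain_def)
qed

lemma kpi_chain:
  assumes L: "is_ideal n L" "divar_closed v L" and v: "v \<in> vars n" and \<omega>: "\<omega> \<in> chain n L i j"
  shows "kpi v \<omega> \<in> chain n L i j"
proof -
  have "homogeneous (j - i) (kpi v \<omega> S)" for S
    using homogeneous_diff[OF chainD(4)[OF \<omega>]
        homogeneous_mult'[OF homogeneous_var homogeneous_divar[OF chainD(4)[OF \<omega>]]]]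
    by (simp add: kpi_def)
  then show ?thesis
    using kpi_uchain[OF L v] \<omega> by (auto simp: chain_def)
qed

lemma kH_uchain:
  assumes "is_ideal n L" "\<And>v. v \<in> set vs \<Longrightarrow> divar_closed v L" "set vs \<subseteq> vars n" "\<omega> \<in> uchain n L i"
  shows "kH vs \<omega> \<in> uchain n L (i + 1)"
  using assms
  by (induction vs arbitrary: \<omega>) (auto simp: uchain_0 ideal_0 intro!: uchain_add kh_uchain kpi_uchain)

lemma kH_chain:
  assumes "is_ideal n L" "\<And>v. v \<in> set vs \<Longrightarrow> divar_closed v L" "set vs \<subseteq> vars n" "\<omega> \<in> chain n L i j"
  shows "kH vs \<omega> \<in> chain n L (i + 1) j"
  using assms
  by (induction vs arbitrary: \<omega>) (auto simp: chain_0 ideal_0 intro!: chain_add kh_chain kpi_chain)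

section \<open>Regularity\<close>

text \<open>For ideals \<open>A \<subseteq> B\<close> this says that the map from Tor_i(k,A)_j to
  Tor_i(k,B)_j is zero, and for \<open>A = B\<close> that Tor_i(k,A)_j is zero, both computed with
  the Koszul complex.\<close>

definition exact_in :: "nat \<Rightarrow> 'k::field mpoly set \<Rightarrow> 'k mpoly set \<Rightarrow> int \<Rightarrow> int \<Rightarrow> bool" where
  "exact_in n A B i j \<longleftrightarrow>
     (\<forall>\<omega>\<in>chain n A i j. kd n \<omega> = 0 \<longrightarrow> (\<exists>\<eta>\<in>chain n B (i + 1) j. kd n \<eta> = \<omega>))"

text \<open>Castelnuovo-Mumford regularity at most \<open>r\<close>, expressed by the vanishing of
  Koszul homology. The zero ideal satisfies it for every \<open>r\<close>.\<close>

definition reg_le :: "nat \<Rightarrow> 'k::field mpoly set \<Rightarrow> int \<Rightarrow> bool" where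
  "reg_le n I r \<longleftrightarrow> (\<forall>i j. j > i + r \<longrightarrow> exact_in n I I i j)"

lemma exact_inE:
  assumes "exact_in n A B i j" "\<omega> \<in> chain n A i j" "kd n \<omega> = 0"
  obtains \<eta> where "\<eta> \<in> chain n B (i + 1) j" "kd n \<eta> = \<omega>"
  using assms by (auto simp: exact_in_def)

lemma reg_le_ex:
  assumes "reg_le n I r" "\<omega> \<in> chain n I i j" "kd n \<omega> = 0" "j > i + r"
  shows "\<exists>\<eta>\<in>chain n I (i + 1) j. kd n \<eta> = \<omega>"
  using assms unfolding reg_le_def exact_in_def by blast

lemma reg_leI:
  assumes "\<And>i j \<omega>. \<omega> \<in> chain n I i j \<Longrightarrow> kd n \<omega> = 0 \<Longrightarrow> j > i + r \<Longrightarrow>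
    \<exists>\<eta>\<in>chain n I (i + 1) j. kd n \<eta> = \<omega>"
  shows "reg_le n I r"
  using assms by (simp add: reg_le_def exact_in_def)

lemma reg_le_mono: "reg_le n I r \<Longrightarrow> r \<le> r' \<Longrightarrow> reg_le n I r'"
  by (auto simp: reg_le_def)

lemma exact_in_mono: "exact_in n A B i j \<Longrightarrow> A' \<subseteq> A \<Longrightarrow> exact_in n A' B i j"
  using chain_mono[of A' A n i j] by (auto simp: exact_in_def)

text \<open>Every term of a coefficient of \<open>\<omega>\<close> contains an indeterminate of
  \<open>vs\<close>, so the final projection is 0 and the contraction bounds
  \<open>\<omega>\<close>. The bounding chain is given explicitly because
  \<open>kH_edge_form\<close> examines its coefficients.\<close>

lemma exact_in_divar_closed:
  assumes A: "A \<subseteq> B" and B: "is_ideal n B" "\<And>v. v \<in> set vs \<Longrightarrow> divar_closed v B" "set vs \<subseteq> vars n"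
    and vs: "\<And>p m. p \<in> A \<Longrightarrow> m \<in> keys p \<Longrightarrow> keys m \<inter> set vs \<noteq> {}"
    and \<omega>: "\<omega> \<in> chain n A i j" "kd n \<omega> = 0"
  shows "kH vs \<omega> \<in> chain n B (i + 1) j" "kd n (kH vs \<omega>) = \<omega>"
proof -
  show "kH vs \<omega> \<in> chain n B (i + 1) j"
    using B chain_mono[OF A, of n i j] \<omega>(1) by (intro kH_chain) auto
  have "kP vs \<omega> = 0"
  proof
    fix S
    show "kP vs \<omega> S = 0 S"
    proof (rule poly_mapping_eqI)
      fix m
      show "lookup (kP vs \<omega> S) m = lookup (0 S) m"
        using vs[OF chainD(1)[OF \<omega>(1)], of m S] by (auto simp: lookup_kP in_keys_iff)
    qed
  qed
  then show "kd n (kH vs \<omega>) = \<omega>"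
    using kd_kH[OF B(3) _ \<omega>(2)] chainD(2)[OF \<omega>(1)] by (metis diff_zero)
qed

text \<open>Contraction along all indeterminates leaves only the constant term of the coefficient at
  the empty set; a coefficient of degree \<open>j - i > 0\<close> has none.\<close>

lemma reg_polyring: "reg_le n (polyring n) 0"
proof (rule reg_leI)
  fix i j :: int and \<omega> :: "indet set \<Rightarrow> 'k::field mpoly"
  assume \<omega>: "\<omega> \<in> chain n (polyring n) i j" "kd n \<omega> = 0" and ij: "j > i + 0"
  obtain vs where vs: "set vs = vars n"
    using finite_list[OF finite_vars] by blast
  have "kP vs \<omega> = 0"
  proof
    fix S
    show "kP vs \<omega> S = 0 S"
    proof (rule poly_mapping_eqI)
      fix m
      have "keys m \<subseteq> vars n \<and> int (mdeg m) = j - i" if "lookup (\<omega> S) m \<noteq> 0"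
        using chainD(4)[OF \<omega>(1), of S] polyring_keys[OF chainD(1)[OF \<omega>(1), of S], of m] that
        by (simp add: homogeneous_iff in_keys_iff)
      then have "keys m \<inter> vars n \<noteq> {}" if "lookup (\<omega> S) m \<noteq> 0"
        using ij that by (cases "keys m = {}") (simp add: mdeg_def, blast)
      then show "lookup (kP vs \<omega> S) m = lookup (0 S) m"
        by (auto simp: lookup_kP vs)
    qed
  qed
  then have "kd n (kH vs \<omega>) = \<omega>"
    using kd_kH[OF _ _ \<omega>(2), of vs] vs chainD(2)[OF \<omega>(1)] by (metis diff_zero order_refl)
  moreover have "kH vs \<omega> \<in> chain n (polyring n) (i + 1) j"
    using \<omega>(1) vs by (intro kH_chain) (auto simp: is_ideal_polyring divar_closed_polyring)
  ultimately show "\<exists>\<eta>\<in>chain n (polyring n) (i + 1) j. kd n \<eta> = \<omega>"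
    by blast
qed

text \<open>The splitting is chosen separately for each coefficient and then projected to the right
  degree. Where \<open>\<omega>\<close> vanishes both parts are set to 0, which keeps their supports
  inside that of \<open>\<omega>\<close>.\<close>

lemma chain_split:
  assumes A: "graded_ideal n A" and B: "graded_ideal n B" and g: "homogeneous e g"
    and split: "\<And>p. p \<in> C \<Longrightarrow> \<exists>a\<in>A. \<exists>b\<in>B. p = a + g * b"
    and \<omega>: "\<omega> \<in> chain n C i j"
  obtains \<alpha> \<beta> where "\<alpha> \<in> chain n A i j" "\<beta> \<in> chain n B i (j - e)" "\<omega> = \<alpha> + (\<lambda>S. g * \<beta> S)"
proof -
  obtain a b where ab: "a p \<in> A" "b p \<in> B" "p = a p + g * b p" if "p \<in> C" for p
    using split by metis
  define \<alpha> where "\<alpha> S = (if \<omega> S = 0 then 0 else hom_comp (j - i) (a (\<omega> S)))" for S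
  define \<beta> where "\<beta> S = (if \<omega> S = 0 then 0 else hom_comp (j - e - i) (b (\<omega> S)))" for S
  have C: "\<omega> S \<in> C" for S
    by (rule chainD(1)[OF \<omega>])
  have "\<alpha> \<in> chain n A i j"
    using ab(1)[OF C] chainD(2,3)[OF \<omega>]
    by (auto simp: chain_def uchain_def \<alpha>_def graded_ideal_comp[OF A]
        ideal_0[OF graded_ideal_ideal[OF A]] split: if_splits)
  moreover have "\<beta> \<in> chain n B i (j - e)"
    using ab(2)[OF C] chainD(2,3)[OF \<omega>]
    by (auto simp: chain_def uchain_def \<beta>_def graded_ideal_comp[OF B]
        ideal_0[OF graded_ideal_ideal[OF B]] split: if_splits)
  moreover have "\<omega> S = \<alpha> S + g * \<beta> S" for S
  proof (cases "\<omega> S = 0")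
    case False
    have "\<omega> S = hom_comp (j - i) (\<omega> S)"
      using hom_comp_homogeneous[OF chainD(4)[OF \<omega>]] by simp
    also have "\<dots> = hom_comp (j - i) (a (\<omega> S) + g * b (\<omega> S))"
      using ab(3)[OF C[of S]] by simp
    also have "\<dots> = \<alpha> S + g * \<beta> S"
      using False by (simp add: hom_comp_add hom_comp_mult[OF g] \<alpha>_def \<beta>_def algebra_simps)
    finally show ?thesis .
  qed (simp add: \<alpha>_def \<beta>_def)
  ultimately show ?thesis
    using that by (metis (no_types, lifting) ext plus_fun_apply)
qed

lemma reg_le_zero: "reg_le n {0} r"
proof (rule reg_leI)
  fix i j :: int and \<omega> :: "indet set \<Rightarrow> 'k::field mpoly"
  assume "\<omega> \<in> chain n {0} i j"
  then have "\<omega> = 0"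
    by (auto simp: chain_def uchain_def)
  then show "\<exists>\<eta>\<in>chain n {0} (i + 1) j. kd n \<eta> = \<omega>"
    using chain_0[of "{0}" n "i + 1" j] kd_0 by (metis singletonI)
qed

text \<open>A predicate instead of the set \<open>I : f\<close>, so that the colon ideal can be
  named by explicit generators, such as the ideal of linear forms in
  \<open>reg_minors\<close>.\<close>

definition is_colon :: "nat \<Rightarrow> 'k::field mpoly set \<Rightarrow> 'k mpoly \<Rightarrow> 'k mpoly set \<Rightarrow> bool" where
  "is_colon n I f Q \<longleftrightarrow> graded_ideal n Q \<and> (\<forall>q\<in>polyring n. f * q \<in> I \<longleftrightarrow> q \<in> Q)"

lemma is_colonD:
  assumes "is_colon n I f Q"
  shows is_colon_graded: "graded_ideal n Q" and is_colon_mem: "q \<in> Q \<Longrightarrow> f * q \<in> I"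
    and is_colon_colon: "q \<in> polyring n \<Longrightarrow> f * q \<in> I \<Longrightarrow> q \<in> Q"
  using assms ideal_sub[OF graded_ideal_ideal, of n Q q] by (auto simp: is_colon_def)

lemma colon_chain:
  assumes Q: "is_colon n I f Q" and \<beta>: "\<beta> \<in> chain n (polyring n) i j" and I: "\<And>S. f * \<beta> S \<in> I"
  shows "\<beta> \<in> chain n Q i j"
  using \<beta> is_colon_colon[OF Q _ I] by (auto simp: chain_def uchain_def)

definition hgens :: "nat \<Rightarrow> 'k::field mpoly set \<Rightarrow> bool" where
  "hgens n S \<longleftrightarrow> S \<subseteq> polyring n \<and> (\<forall>f\<in>S. \<exists>d. homogeneous d f)"

lemma hgens_graded: "hgens n S \<Longrightarrow> graded_ideal n (ideal_gen n S)"
  by (simp add: hgens_def graded_ideal_gen)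

lemma hgens_ideal: "hgens n S \<Longrightarrow> is_ideal n (ideal_gen n S)"
  by (simp add: hgens_def is_ideal_gen)

section \<open>Regularity when one generator is adjoined or removed\<close>

lemma insert_chain_split:
  assumes S: "hgens n (insert f S)" and f: "homogeneous e f"
    and \<omega>: "\<omega> \<in> chain n (ideal_gen n (insert f S)) i j"
  obtains \<alpha> \<beta> where "\<alpha> \<in> chain n (ideal_gen n S) i j" "\<beta> \<in> chain n (polyring n) i (j - e)"
    "\<omega> = \<alpha> + (\<lambda>S. f * \<beta> S)"
proof (rule chain_split[OF _ graded_ideal_polyring f _ \<omega>])
  show "graded_ideal n (ideal_gen n S)"
    using S by (intro hgens_graded) (simp add: hgens_def)
  show "\<exists>a\<in>ideal_gen n S. \<exists>b\<in>polyring n. p = a + f * b" if "p \<in> ideal_gen n (insert f S)" for p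
    using S ideal_gen_insertE[OF _ _ that] unfolding hgens_def by (metis insert_subset)
qed (use that in blast)

lemma kd_add_mult: "kd n (\<alpha> + (\<lambda>S. f * \<beta> S)) = kd n \<alpha> + (\<lambda>S. f * kd n \<beta> S)"
  by (rule ext) (simp only: kd_add plus_fun_apply kd_mult)

text \<open>The long exact sequence of 0 \<rightarrow> Q(-e) \<rightarrow> I \<oplus> R(-e)
  \<rightarrow> I + (f) \<rightarrow> 0, carried out on chains. \<open>Q\<close> enters one
  homological degree lower, which allows it the regularity \<open>r + 1 - e\<close>; the condition
  \<open>e \<le> r\<close> bounds the regularity of R(-e).\<close>

theorem reg_le_insert:
  assumes S: "hgens n (insert f S)" and f: "homogeneous e f"
    and Q: "is_colon n (ideal_gen n S) f Q"
    and regS: "reg_le n (ideal_gen n S) r" and regQ: "reg_le n Q (r + 1 - e)" and er: "e \<le> r"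
  shows "reg_le n (ideal_gen n (insert f S)) r"
proof (rule reg_leI)
  let ?I = "ideal_gen n S" and ?J = "ideal_gen n (insert f S)"
  fix i j :: int and \<omega> :: "indet set \<Rightarrow> 'a mpoly"
  assume \<omega>: "\<omega> \<in> chain n ?J i j" "kd n \<omega> = 0" and ij: "j > i + r"
  have I: "is_ideal n ?I" "is_ideal n ?J" "is_ideal n Q" "is_ideal n (polyring n)"
    using S hgens_ideal[of n S] hgens_ideal[OF S] graded_ideal_ideal[OF is_colon_graded[OF Q]]
    by (simp_all add: hgens_def is_ideal_polyring)
  have IJ: "?I \<subseteq> ?J"
    by (rule ideal_gen_mono) auto
  obtain \<alpha> \<beta> where ab: "\<alpha> \<in> chain n ?I i j" "\<beta> \<in> chain n (polyring n) i (j - e)"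
    "\<omega> = \<alpha> + (\<lambda>S. f * \<beta> S)"
    using insert_chain_split[OF S f \<omega>(1)] .
  have d\<beta>: "kd n \<beta> \<in> chain n (polyring n) (i - 1) (j - e)"
    by (rule kd_chain[OF I(4) ab(2)])
  have "kd n \<alpha> T + f * kd n \<beta> T = 0" for T
    using fun_cong[OF \<omega>(2), of T] unfolding ab(3) kd_add_mult by simp
  then have fd\<beta>: "f * kd n \<beta> T = - kd n \<alpha> T" for T
    by (simp add: add_eq_0_iff)
  \<comment> \<open>\<open>kd n \<beta>\<close> represents the image of \<open>\<omega>\<close>
    under the connecting map. Filling it over \<open>Q\<close> by \<open>\<gamma>\<close> allows
    both \<open>\<alpha>\<close> and \<open>\<beta>\<close> to be corrected to cycles.\<close>
  have Qd\<beta>: "kd n \<beta> \<in> chain n Q (i - 1) (j - e)"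
    by (rule colon_chain[OF Q d\<beta>])
      (auto simp: fd\<beta> intro: ideal_uminus[OF I(1)] chainD(1)[OF kd_chain[OF I(1) ab(1)]])
  have "\<exists>\<eta>\<in>chain n Q (i - 1 + 1) (j - e). kd n \<eta> = kd n \<beta>"
    using ij by (intro reg_le_ex[OF regQ Qd\<beta> kd_kd]) linarith
  then obtain \<gamma> where \<gamma>: "\<gamma> \<in> chain n Q i (j - e)" "kd n \<gamma> = kd n \<beta>"
    by auto
  define \<alpha>' where "\<alpha>' = \<alpha> + (\<lambda>S. f * \<gamma> S)"
  have "(\<lambda>S. f * \<gamma> S) \<in> chain n ?I i (j - e + e)"
    by (rule chain_mult[OF f is_colon_mem[OF Q] \<gamma>(1)])
  then have "\<alpha>' \<in> chain n ?I i j"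
    unfolding \<alpha>'_def using ab(1) by (intro chain_add[OF I(1)]) auto
  moreover have "kd n \<alpha>' = 0"
    using \<omega>(2) unfolding \<alpha>'_def ab(3) kd_add_mult \<gamma>(2) .
  ultimately obtain \<eta>1 where \<eta>1: "\<eta>1 \<in> chain n ?I (i + 1) j" "kd n \<eta>1 = \<alpha>'"
    using reg_le_ex[OF regS _ _ ij] by blast
  have "Q \<subseteq> polyring n"
    using ideal_sub[OF I(3)] by blast
  then have "\<beta> - \<gamma> \<in> chain n (polyring n) i (j - e)"
    using \<gamma>(1) chain_mono[of Q "polyring n"] by (intro chain_diff[OF I(4) ab(2)]) blast
  moreover have "kd n (\<beta> - \<gamma>) = 0"
    by (simp only: kd_diff \<gamma>(2) diff_self)
  ultimately obtain \<eta>2 where \<eta>2: "\<eta>2 \<in> chain n (polyring n) (i + 1) (j - e)" "kd n \<eta>2 = \<beta> - \<gamma>"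
    using reg_le_ex[OF reg_polyring, of "\<beta> - \<gamma>" n i "j - e"] ij er by force
  have "(\<lambda>S. f * \<eta>2 S) \<in> chain n ?J (i + 1) (j - e + e)"
    using ideal_mult_right[OF I(2) _ ideal_gen_base[of f "insert f S"]]
    by (intro chain_mult[OF f _ \<eta>2(1)]) auto
  then have "\<eta>1 + (\<lambda>S. f * \<eta>2 S) \<in> chain n ?J (i + 1) j"
    using \<eta>1(1) chain_mono[OF IJ] by (intro chain_add[OF I(2)]) auto
  moreover have "kd n (\<eta>1 + (\<lambda>S. f * \<eta>2 S)) = \<omega>"
    unfolding kd_add_mult \<eta>1(2) \<eta>2(2) by (simp add: \<alpha>'_def ab(3) fun_eq_iff algebra_simps)
  ultimately show "\<exists>\<eta>\<in>chain n ?J (i + 1) j. kd n \<eta> = \<omega>"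
    by blast
qed

text \<open>A cycle over the smaller ideal is filled over the larger one. Splitting the filling
  leaves the remainder \<open>f * \<beta>\<close>, which the two following theorems fill by
  different means.\<close>

lemma reg_le_insertD_aux:
  assumes S: "hgens n (insert f S)" and f: "homogeneous e f"
    and reg: "reg_le n (ideal_gen n (insert f S)) r"
    and \<omega>: "\<omega> \<in> chain n (ideal_gen n S) i j" "kd n \<omega> = 0" and ij: "j > i + r"
  obtains \<alpha> \<beta> where "\<alpha> \<in> chain n (ideal_gen n S) (i + 1) j"
    "\<beta> \<in> chain n (polyring n) i (j - e)" "kd n \<beta> = 0" "\<omega> = kd n \<alpha> + (\<lambda>S. f * \<beta> S)"
    "\<And>T. f * \<beta> T \<in> ideal_gen n S"
proof -
  let ?I = "ideal_gen n S" and ?J = "ideal_gen n (insert f S)"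
  have I: "is_ideal n ?I" "is_ideal n (polyring n)"
    using S hgens_ideal[of n S] by (auto simp: hgens_def is_ideal_polyring)
  have "?I \<subseteq> ?J"
    by (rule ideal_gen_mono) auto
  then have "\<omega> \<in> chain n ?J i j"
    using \<omega>(1) chain_mono by blast
  then obtain \<eta> where \<eta>: "\<eta> \<in> chain n ?J (i + 1) j" "kd n \<eta> = \<omega>"
    using reg_le_ex[OF reg _ \<omega>(2) ij] by blast
  obtain \<alpha> \<beta> where ab: "\<alpha> \<in> chain n ?I (i + 1) j" "\<beta> \<in> chain n (polyring n) (i + 1) (j - e)"
    "\<eta> = \<alpha> + (\<lambda>S. f * \<beta> S)"
    using insert_chain_split[OF S f \<eta>(1)] .
  have eq: "\<omega> = kd n \<alpha> + (\<lambda>S. f * kd n \<beta> S)"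
    unfolding \<eta>(2)[symmetric] ab(3) kd_add_mult ..
  show ?thesis
  proof (rule that[OF ab(1) _ kd_kd eq])
    show "kd n \<beta> \<in> chain n (polyring n) i (j - e)"
      using kd_chain[OF I(2) ab(2)] by simp
    fix T
    have "f * kd n \<beta> T = \<omega> T - kd n \<alpha> T"
      by (simp add: eq)
    also have "\<dots> \<in> ?I"
      by (rule ideal_diff[OF I(1) chainD(1)[OF \<omega>(1)] chainD(1)[OF kd_chain[OF I(1) ab(1)]]])
    finally show "f * kd n \<beta> T \<in> ?I" .
  qed
qed

text \<open>The sequence of \<open>reg_le_insert\<close> read in the other direction: now
  \<open>Q\<close> enters in the same homological degree as the ideal, so its regularity has to be
  at most \<open>r - e\<close>.\<close>

theorem reg_le_insertD:
  assumes S: "hgens n (insert f S)" and f: "homogeneous e f"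
    and Q: "is_colon n (ideal_gen n S) f Q"
    and reg: "reg_le n (ideal_gen n (insert f S)) r" and regQ: "reg_le n Q (r - e)"
  shows "reg_le n (ideal_gen n S) r"
proof (rule reg_leI)
  let ?I = "ideal_gen n S"
  fix i j :: int and \<omega> :: "indet set \<Rightarrow> 'a mpoly"
  assume \<omega>: "\<omega> \<in> chain n ?I i j" "kd n \<omega> = 0" and ij: "j > i + r"
  have I: "is_ideal n ?I"
    using S hgens_ideal[of n S] by (auto simp: hgens_def)
  obtain \<alpha> \<beta> where ab: "\<alpha> \<in> chain n ?I (i + 1) j"
    "\<beta> \<in> chain n (polyring n) i (j - e)" "kd n \<beta> = 0" "\<omega> = kd n \<alpha> + (\<lambda>S. f * \<beta> S)"
    "\<And>T. f * \<beta> T \<in> ?I"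
    using reg_le_insertD_aux[OF S f reg \<omega> ij] by metis
  have \<beta>: "\<beta> \<in> chain n Q i (j - e)"
    by (rule colon_chain[OF Q ab(2,5)])
  obtain \<gamma> where \<gamma>: "\<gamma> \<in> chain n Q (i + 1) (j - e)" "kd n \<gamma> = \<beta>"
    using reg_le_ex[OF regQ \<beta> ab(3)] ij by auto
  have "(\<lambda>S. f * \<gamma> S) \<in> chain n ?I (i + 1) (j - e + e)"
    by (rule chain_mult[OF f is_colon_mem[OF Q] \<gamma>(1)])
  then have "\<alpha> + (\<lambda>S. f * \<gamma> S) \<in> chain n ?I (i + 1) j"
    using ab(1) by (intro chain_add[OF I]) auto
  moreover have "kd n (\<alpha> + (\<lambda>S. f * \<gamma> S)) = \<omega>"
    unfolding kd_add_mult \<gamma>(2) ab(4) ..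
  ultimately show "\<exists>\<eta>\<in>chain n ?I (i + 1) j. kd n \<eta> = \<omega>"
    by blast
qed

text \<open>The colon ideal is the ideal itself, so \<open>reg_le_insertD\<close> would presuppose a
  better bound than it yields. The remainder is filled by another reason: multiplication by
  \<open>v\<close> is null-homotopic on the Koszul complex.\<close>

theorem reg_le_nonzerodivisor:
  assumes S: "hgens n S" and v: "v \<in> vars n"
    and Q: "is_colon n (ideal_gen n S) (var v) (ideal_gen n S)"
    and reg: "reg_le n (ideal_gen n (insert (var v) S)) r"
  shows "reg_le n (ideal_gen n S) r"
proof (rule reg_leI)
  let ?I = "ideal_gen n S"
  fix i j :: int and \<omega> :: "indet set \<Rightarrow> 'a mpoly"
  assume \<omega>: "\<omega> \<in> chain n ?I i j" "kd n \<omega> = 0" and ij: "j > i + r"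
  have I: "is_ideal n ?I"
    by (rule hgens_ideal[OF S])
  have "hgens n (insert (var v) S)"
    using S v by (auto simp: hgens_def polyring_var intro: exI[where x = 1])
  then obtain \<alpha> \<beta> where ab: "\<alpha> \<in> chain n ?I (i + 1) j"
    "\<beta> \<in> chain n (polyring n) i (j - 1)" "kd n \<beta> = 0" "\<omega> = kd n \<alpha> + (\<lambda>S. var v * \<beta> S)"
    "\<And>T. var v * \<beta> T \<in> ?I"
    using reg_le_insertD_aux[OF _ homogeneous_var reg \<omega> ij] by metis
  have \<beta>: "\<beta> \<in> chain n ?I i (j - 1)"
    by (rule colon_chain[OF Q ab(2,5)])
  define \<gamma> where "\<gamma> = (\<lambda>S. var v * \<beta> S)"
  have \<gamma>: "\<gamma> \<in> chain n ?I i (j - 1 + 1)"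
    unfolding \<gamma>_def by (rule chain_mult[OF homogeneous_var is_colon_mem[OF Q] \<beta>])
  have d\<gamma>: "kd n \<gamma> = 0"
    by (rule ext) (simp add: \<gamma>_def kd_mult ab(3))
  have kpi0: "kpi v \<gamma> = 0"
    by (rule ext) (simp add: kpi_def \<gamma>_def)
  have kh0: "kh v 0 = 0"
    by (rule ext) (simp add: kh_def)
  have "kd n (kh v \<gamma>) + kh v (kd n \<gamma>) = \<gamma> - kpi v \<gamma>"
    by (rule koszul_homotopy[OF v chainD(2)[OF \<gamma>]])
  then have "kd n (kh v \<gamma>) = \<gamma>"
    by (simp only: d\<gamma> kh0 kpi0 add_0_right diff_zero)
  moreover have "kh v \<gamma> \<in> chain n ?I (i + 1) j"
  proof -
    have "kh v \<gamma> S \<in> ?I" for S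
      using chainD(1)[OF \<beta>] by (auto simp: kh_def \<gamma>_def intro: ideal_mult[OF I] ideal_0[OF I])
    moreover have "kh v \<gamma> \<in> chain n (polyring n) (i + 1) j"
      using \<gamma> chain_mono[of ?I "polyring n" n i j] ideal_sub[OF I]
      by (intro kh_chain[OF is_ideal_polyring divar_closed_polyring v]) auto
    ultimately show ?thesis
      by (simp add: chain_def uchain_def)
  qed
  then have "\<alpha> + kh v \<gamma> \<in> chain n ?I (i + 1) j"
    using ab(1) by (intro chain_add[OF I])
  ultimately show "\<exists>\<eta>\<in>chain n ?I (i + 1) j. kd n \<eta> = \<omega>"
    unfolding ab(4) \<gamma>_def by (metis kd_add)
qed

text \<open>From 0 \<rightarrow> A \<inter> B \<rightarrow> A \<oplus> B \<rightarrow> A + B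
  \<rightarrow> 0: the sum enters one homological degree higher, so its bound has to be better by
  one.\<close>

theorem reg_le_Int:
  assumes A: "graded_ideal n A" and B: "graded_ideal n B"
    and reg: "reg_le n A r" "reg_le n B r" "reg_le n (ideal_sum A B) (r - 1)"
  shows "reg_le n (A \<inter> B) r"
proof (rule reg_leI)
  fix i j :: int and \<omega> :: "indet set \<Rightarrow> 'a mpoly"
  assume \<omega>: "\<omega> \<in> chain n (A \<inter> B) i j" "kd n \<omega> = 0" and ij: "j > i + r"
  let ?C = "ideal_sum A B"
  have I: "is_ideal n A" "is_ideal n B" "is_ideal n ?C"
    using A B by (auto simp: graded_ideal_def is_ideal_sum)
  have sub: "A \<subseteq> ?C" "B \<subseteq> ?C"
    using ideal_sum_left[OF I(2)] ideal_sum_right[OF I(1)] by auto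
  have "\<omega> \<in> chain n A i j" "\<omega> \<in> chain n B i j"
    using \<omega>(1) chain_mono[of "A \<inter> B"] by blast+
  then obtain \<alpha> \<beta> where ab: "\<alpha> \<in> chain n A (i + 1) j" "kd n \<alpha> = \<omega>"
      "\<beta> \<in> chain n B (i + 1) j" "kd n \<beta> = \<omega>"
    using reg_le_ex[OF reg(1) _ \<omega>(2) ij] reg_le_ex[OF reg(2) _ \<omega>(2) ij] by blast
  have "\<alpha> - \<beta> \<in> chain n ?C (i + 1) j"
    using ab(1,3) chain_mono[OF sub(1)] chain_mono[OF sub(2)] by (intro chain_diff[OF I(3)]) blast+
  moreover have "kd n (\<alpha> - \<beta>) = 0"
    by (simp only: kd_diff ab diff_self)
  ultimately obtain \<eta> where \<eta>: "\<eta> \<in> chain n ?C (i + 1 + 1) j" "kd n \<eta> = \<alpha> - \<beta>"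
    using reg_le_ex[OF reg(3), of "\<alpha> - \<beta>" "i + 1" j] ij by auto
  obtain \<eta>1 \<eta>2 where \<eta>12: "\<eta>1 \<in> chain n A (i + 1 + 1) j" "\<eta>2 \<in> chain n B (i + 1 + 1) (j - 0)"
    "\<eta> = \<eta>1 + (\<lambda>S. 1 * \<eta>2 S)"
  proof (rule chain_split[OF A B homogeneous_1 _ \<eta>(1)])
    show "\<exists>a\<in>A. \<exists>b\<in>B. p = a + 1 * b" if "p \<in> ?C" for p
      using that by (auto simp: ideal_sum_def)
  qed
  have d\<eta>1: "kd n \<eta>1 \<in> chain n A (i + 1) j" and d\<eta>2: "kd n \<eta>2 \<in> chain n B (i + 1) j"
    using kd_chain[OF I(1) \<eta>12(1)] kd_chain[OF I(2) \<eta>12(2)]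
    by (simp_all only: add_diff_cancel_right' diff_0_right)
  \<comment> \<open>Subtracting the boundary of \<open>\<eta>1\<close> does not change
    \<open>kd n \<alpha>\<close>, and the result equals \<open>\<beta> + kd n \<eta>2\<close>; so it
    has coefficients in both ideals.\<close>
  define \<gamma> where "\<gamma> = \<alpha> - kd n \<eta>1"
  have "kd n \<eta> = kd n \<eta>1 + kd n \<eta>2"
    unfolding \<eta>12(3) by (simp only: kd_add_mult) simp
  then have "\<gamma> = \<beta> + kd n \<eta>2"
    using \<eta>(2) unfolding \<gamma>_def by (simp add: fun_eq_iff algebra_simps)
  then have "\<gamma> \<in> chain n B (i + 1) j"
    using chain_add[OF I(2) ab(3) d\<eta>2] by simp
  moreover have "\<gamma> \<in> chain n A (i + 1) j"
    unfolding \<gamma>_def by (rule chain_diff[OF I(1) ab(1) d\<eta>1])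
  ultimately have "\<gamma> \<in> chain n (A \<inter> B) (i + 1) j"
    by (simp add: chain_def uchain_def)
  moreover have "kd n \<gamma> = \<omega>"
    unfolding \<gamma>_def kd_diff kd_kd ab(2) by simp
  ultimately show "\<exists>\<eta>\<in>chain n (A \<inter> B) (i + 1) j. kd n \<eta> = \<omega>"
    by blast
qed

section \<open>The ideal of minors of a generic matrix with two rows\<close>

definition minor :: "nat \<Rightarrow> nat \<Rightarrow> 'k::field mpoly" where
  "minor a b = var (Xvar a) * var (Yvar b) - var (Xvar b) * var (Yvar a)"

text \<open>Both orders of each pair and the zero minors with \<open>a = b\<close> are included; the
  symmetry spares a choice of orientation.\<close>

definition minors :: "nat set \<Rightarrow> 'k::field mpoly set" where
  "minors T = {minor a b |a b. a \<in> T \<and> b \<in> T}"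

lemma minor_self [simp]: "minor a a = 0"
  by (simp add: minor_def)

lemma minor_swap: "minor b a = - minor a b"
  by (simp add: minor_def)

lemma vars_XY: "a \<in> {1..n} \<Longrightarrow> Xvar a \<in> vars n" "a \<in> {1..n} \<Longrightarrow> Yvar a \<in> vars n"
  by (auto simp: vars_def)

lemma minor_polyring: "a \<in> {1..n} \<Longrightarrow> b \<in> {1..n} \<Longrightarrow> minor a b \<in> polyring n"
  unfolding minor_def by (intro polyring_diff polyring_mult polyring_var vars_XY)

lemma homogeneous_minor: "homogeneous 2 (minor a b)"
  unfolding minor_def
  by (intro homogeneous_diff homogeneous_mult'[OF homogeneous_var homogeneous_var]) simp_all

lemma hgens_minors: "T \<subseteq> {1..n} \<Longrightarrow> hgens n (minors T)"
  using homogeneous_minor by (auto simp: hgens_def minors_def intro!: minor_polyring)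

lemma hgens_insert: "hgens n (insert f S) \<longleftrightarrow> f \<in> polyring n \<and> (\<exists>d. homogeneous d f) \<and> hgens n S"
  by (auto simp: hgens_def)

lemma hgens_var: "v \<in> vars n \<Longrightarrow> hgens n S \<Longrightarrow> hgens n (insert (var v) S)"
  by (auto simp: hgens_insert polyring_var intro: exI[where x = 1])

lemma hgens_empty: "hgens n {}"
  by (simp add: hgens_def)

lemma hgens_Un: "hgens n S \<Longrightarrow> hgens n T \<Longrightarrow> hgens n (S \<union> T)"
  by (auto simp: hgens_def)

subsection \<open>Straightening\<close>

text \<open>Two monomials are congruent modulo the minors iff they agree outside the columns in \<open>T\<close>,
  have the same degree in each column of \<open>T\<close> and the same degree in the first row.\<close>

definition same_class :: "nat set \<Rightarrow> (indet \<Rightarrow>\<^sub>0 nat) \<Rightarrow> (indet \<Rightarrow>\<^sub>0 nat) \<Rightarrow> bool" where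
  "same_class T m m' \<longleftrightarrow>
     (\<forall>v\<in>T. lookup m (Xvar v) + lookup m (Yvar v) = lookup m' (Xvar v) + lookup m' (Yvar v)) \<and>
     (\<Sum>v\<in>T. lookup m (Xvar v)) = (\<Sum>v\<in>T. lookup m' (Xvar v)) \<and>
     (\<forall>u. u \<notin> Xvar ` T \<union> Yvar ` T \<longrightarrow> lookup m u = lookup m' u)"

lemma same_class_refl [simp]: "same_class T m m"
  by (simp add: same_class_def)

lemma same_class_sym: "same_class T m m' \<Longrightarrow> same_class T m' m"
  by (simp add: same_class_def)

lemma same_class_trans: "same_class T a b \<Longrightarrow> same_class T b c \<Longrightarrow> same_class T a c"
  by (auto simp: same_class_def)

lemma same_class_add: "same_class T (a + m) (a + m') \<longleftrightarrow> same_class T m m'"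
  by (auto simp: same_class_def lookup_add sum.distrib)

text \<open>If some column has a larger x-exponent in \<open>m\<close> than in \<open>m'\<close>,
  the equal totals give another column with a smaller one, and replacing x_i y_j by x_j y_i changes
  the term by a multiple of a minor. The measure is the total excess, with truncated subtraction; if
  no column has an excess, then \<open>m = m'\<close>.\<close>

lemma straighten:
  assumes T: "T \<subseteq> {1..n}" and I: "is_ideal n I" "minors T \<subseteq> I"
    and "keys m \<subseteq> vars n" "keys m' \<subseteq> vars n" "same_class T m m'"
  shows "single m c - single m' c \<in> (I :: 'k::field mpoly set)"
  using assms(4-)
proof (induction "\<Sum>v\<in>T. lookup m (Xvar v) - lookup m' (Xvar v)" arbitrary: m rule: less_induct)
  case less
  have fin: "finite T"
    using T finite_subset by blast
  have sums: "(\<Sum>v\<in>T. lookup m (Xvar v)) = (\<Sum>v\<in>T. lookup m' (Xvar v))"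
    and cols: "\<And>v. v \<in> T \<Longrightarrow> lookup m (Xvar v) + lookup m (Yvar v) = lookup m' (Xvar v) + lookup m' (Yvar v)"
    and rest: "\<And>u. u \<notin> Xvar ` T \<union> Yvar ` T \<Longrightarrow> lookup m u = lookup m' u"
    using less.prems(3) by (auto simp: same_class_def)
  show ?case
  proof (cases "\<forall>v\<in>T. lookup m (Xvar v) \<le> lookup m' (Xvar v)")
    case True
    have X: "lookup m (Xvar v) = lookup m' (Xvar v)" if "v \<in> T" for v
      using sum_mono_inv[OF sums _ that fin] True by auto
    have "m = m'"
    proof (rule poly_mapping_eqI)
      fix u
      show "lookup m u = lookup m' u"
        using rest[of u] X cols by (cases "u \<in> Xvar ` T \<union> Yvar ` T") fastforce+
    qed
    then show ?thesis
      using ideal_0[OF I(1)] by simp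
  next
    case False
    then obtain i where i: "i \<in> T" "lookup m (Xvar i) > lookup m' (Xvar i)"
      by (auto simp: not_le)
    have "\<exists>j\<in>T. lookup m (Xvar j) < lookup m' (Xvar j)"
    proof (rule ccontr)
      assume "\<not> ?thesis"
      then have "(\<Sum>v\<in>T. lookup m' (Xvar v)) < (\<Sum>v\<in>T. lookup m (Xvar v))"
        using i fin by (intro sum_strict_mono_ex1) (auto simp: not_less)
      with sums show False by simp
    qed
    then obtain j where j: "j \<in> T" "lookup m (Xvar j) < lookup m' (Xvar j)"
      by blast
    then have Yj: "lookup m (Yvar j) > 0"
      using cols[OF j(1)] by simp
    have ij: "i \<noteq> j"
      using i j by auto
    define e where "e v = (single v 1 :: indet \<Rightarrow>\<^sub>0 nat)" for v
    define r where "r = m - (e (Xvar i) + e (Yvar j))"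
    define m2 where "m2 = e (Xvar j) + e (Yvar i) + r"
    have m: "m = e (Xvar i) + e (Yvar j) + r"
      by (rule poly_mapping_eqI)
        (use i Yj in \<open>auto simp: r_def e_def lookup_add lookup_minus lookup_single when_def\<close>)
    have r: "keys r \<subseteq> vars n"
      using less.prems(1) by (auto simp: r_def in_keys_iff lookup_minus subset_iff)
    have m2: "keys m2 \<subseteq> vars n"
      using r T i j by (auto simp: m2_def keys_add_nat e_def vars_XY subset_iff)
    have sc2: "same_class T m m2"
    proof -
      have "(\<Sum>v\<in>T. lookup (e (Xvar i)) (Xvar v)) = 1" "(\<Sum>v\<in>T. lookup (e (Xvar j)) (Xvar v)) = 1"
        using i(1) j(1) fin by (simp_all add: e_def lookup_single when_def)
      then show ?thesis
        using i(1) j(1) unfolding m m2_def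
        by (auto simp: same_class_def lookup_add sum.distrib e_def lookup_single when_def)
    qed
    have "single m2 c - single m' c \<in> I"
    proof (rule less.hyps[OF _ m2 less.prems(2)])
      show "same_class T m2 m'"
        using same_class_trans[OF same_class_sym[OF sc2] less.prems(3)] .
      show "(\<Sum>v\<in>T. lookup m2 (Xvar v) - lookup m' (Xvar v)) < (\<Sum>v\<in>T. lookup m (Xvar v) - lookup m' (Xvar v))"
      proof (rule sum_strict_mono_ex1[OF fin])
        show "\<forall>v\<in>T. lookup m2 (Xvar v) - lookup m' (Xvar v) \<le> lookup m (Xvar v) - lookup m' (Xvar v)"
          using j ij by (auto simp: m m2_def lookup_add e_def lookup_single when_def)
        show "\<exists>v\<in>T. lookup m2 (Xvar v) - lookup m' (Xvar v) < lookup m (Xvar v) - lookup m' (Xvar v)"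
          using i ij by (intro bexI[of _ i]) (auto simp: m m2_def lookup_add e_def lookup_single when_def)
      qed
    qed
    moreover have "single m c - single m2 c = single r c * minor i j"
      by (simp add: m m2_def minor_def var_def e_def mult_single algebra_simps)
    moreover have "minor i j \<in> I"
      using I(2) i(1) j(1) by (auto simp: minors_def)
    then have "single r c * minor i j \<in> I"
      by (rule ideal_mult[OF I(1) polyring_single[OF r]])
    ultimately have "(single m c - single m2 c) + (single m2 c - single m' c) \<in> I"
      using ideal_add[OF I(1)] by metis
    then show ?thesis by simp
  qed
qed

text \<open>Under x_v \<mapsto> a z_v and y_v \<mapsto> b z_v for \<open>v\<close> in
  \<open>T\<close>, all other indeterminates being fixed, exactly the monomials of one class have
  the same image. So this is a coefficient of the image of \<open>p\<close>, and the next lemmas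
  show that the ideal of minors is the kernel.\<close>

definition class_sum :: "nat set \<Rightarrow> (indet \<Rightarrow>\<^sub>0 nat) \<Rightarrow> 'k::field mpoly \<Rightarrow> 'k" where
  "class_sum T \<mu> p = (\<Sum>m\<in>keys p. if same_class T \<mu> m then lookup p m else 0)"

lemma class_sum_superset:
  "finite M \<Longrightarrow> keys p \<subseteq> M \<Longrightarrow> class_sum T \<mu> p = (\<Sum>m\<in>M. if same_class T \<mu> m then lookup p m else 0)"
  unfolding class_sum_def by (rule sum.mono_neutral_left) (auto simp: in_keys_iff)

lemma class_sum_add: "class_sum T \<mu> (p + q) = class_sum T \<mu> p + class_sum T \<mu> q"
proof -
  let ?M = "keys p \<union> keys q"
  have "class_sum T \<mu> (p + q) = (\<Sum>m\<in>?M. if same_class T \<mu> m then lookup (p + q) m else 0)"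
    by (intro class_sum_superset keys_add) auto
  also have "\<dots> = (\<Sum>m\<in>?M. (if same_class T \<mu> m then lookup p m else 0) +
      (if same_class T \<mu> m then lookup q m else 0))"
    by (intro sum.cong) (auto simp: lookup_add)
  also have "\<dots> = class_sum T \<mu> p + class_sum T \<mu> q"
    using class_sum_superset[of ?M p T \<mu>] class_sum_superset[of ?M q T \<mu>] by (simp add: sum.distrib)
  finally show ?thesis .
qed

lemma class_sum_single_mult:
  "class_sum T (a + \<mu>) (single a c * p) = c * class_sum T \<mu> p"
proof -
  have "keys (single a c * p) \<subseteq> (+) a ` keys p"
    using keys_mult[of "single a c" p] by (auto split: if_splits)
  then have "class_sum T (a + \<mu>) (single a c * p) =
      (\<Sum>m\<in>(+) a ` keys p. if same_class T (a + \<mu>) m then lookup (single a c * p) m else 0)"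
    by (intro class_sum_superset) auto
  also have "\<dots> = (\<Sum>m\<in>keys p. if same_class T \<mu> m then c * lookup p m else 0)"
    by (subst sum.reindex) (auto simp: inj_on_def same_class_add lookup_single_mult_add cong: if_cong)
  also have "\<dots> = c * class_sum T \<mu> p"
    by (auto simp: class_sum_def sum_distrib_left intro!: sum.cong)
  finally show ?thesis .
qed

lemma class_sum_cong: "same_class T \<mu> \<mu>' \<Longrightarrow> class_sum T \<mu> p = class_sum T \<mu>' p"
  unfolding class_sum_def by (intro sum.cong) (auto dest: same_class_trans same_class_sym)

lemma class_sum_minors:
  assumes T: "T \<subseteq> {1..n}" and p: "p \<in> ideal_gen n (minors T)"
  shows "class_sum T \<mu> p = 0"
proof -
  let ?J = "{p \<in> polyring n. \<forall>\<mu>. class_sum T \<mu> p = 0}"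
  have "single a c * p \<in> ?J" if a: "keys a \<subseteq> vars n" and p: "p \<in> ?J" for a c p
  proof -
    have "class_sum T \<mu> (single a c * p) = 0" for \<mu>
    proof (cases "\<exists>m\<in>keys p. same_class T \<mu> (a + m)")
      case True
      then obtain m where "same_class T \<mu> (a + m)" by blast
      then have "class_sum T \<mu> (single a c * p) = c * class_sum T m p"
        by (simp add: class_sum_cong class_sum_single_mult)
      then show ?thesis using p by simp
    next
      case False
      have "\<not> same_class T \<mu> m" if "m \<in> keys (single a c * p)" for m
        using that keys_mult[of "single a c" p] False by (auto split: if_splits)
      then show ?thesis
        by (simp add: class_sum_def)
    qed
    then show ?thesis
      using p polyring_single[OF a] by auto
  qed
  then have "is_ideal n ?J"
    by (intro is_idealI) (auto simp: class_sum_add class_sum_def[of _ _ 0])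
  moreover have "minor a b \<in> ?J" if ab: "a \<in> T" "b \<in> T" for a b
  proof -
    define e where "e v = (single v 1 :: indet \<Rightarrow>\<^sub>0 nat)" for v
    let ?m = "e (Xvar a) + e (Yvar b)" and ?m' = "e (Xvar b) + e (Yvar a)"
    have fin: "finite T" using T finite_subset by blast
    have "(\<Sum>v\<in>T. lookup (e (Xvar a)) (Xvar v)) = 1" "(\<Sum>v\<in>T. lookup (e (Xvar b)) (Xvar v)) = 1"
      using ab fin by (simp_all add: e_def lookup_single when_def)
    then have same: "same_class T ?m ?m'"
      using ab by (auto simp: same_class_def lookup_add sum.distrib e_def lookup_single when_def)
    have "class_sum T \<mu> (minor a b) = 0" for \<mu>
    proof (cases "a = b")
      case False
      have minor: "minor a b = single ?m 1 + single ?m' (- 1)"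
        by (simp add: minor_def var_def e_def mult_single single_uminus)
      have "class_sum T \<mu> (minor a b) =
          (if same_class T \<mu> ?m then 1 else 0) + (if same_class T \<mu> ?m' then - 1 else 0)"
        unfolding minor class_sum_add by (simp add: class_sum_def)
      then show ?thesis
        using same same_class_trans same_class_sym by (smt (verit) add.right_inverse add_0)
    qed (simp add: class_sum_def)
    moreover have "minor a b \<in> polyring n"
      using ab T by (intro minor_polyring) auto
    ultimately show ?thesis
      by blast
  qed
  ultimately have "ideal_gen n (minors T) \<subseteq> ?J"
    by (intro ideal_gen_least) (auto simp: minors_def)
  with p show ?thesis by blast
qed

lemma single_sum: "(\<Sum>x\<in>A. single k (f x)) = single k (\<Sum>x\<in>A. f x)"
  by (induction A rule: infinite_finite_induct) (simp_all add: single_add)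

text \<open>Each monomial of \<open>p\<close> is replaced by a representative of its class. The
  error lies in the ideal by \<open>straighten\<close>, and what remains is 0 because its
  coefficients are class sums.\<close>

lemma in_minors_class_sum:
  assumes T: "T \<subseteq> {1..n}" and p: "p \<in> polyring n" and cs: "\<And>\<mu>. class_sum T \<mu> p = 0"
  shows "p \<in> ideal_gen n (minors T)"
proof -
  let ?I = "ideal_gen n (minors T) :: 'a mpoly set"
  have I: "is_ideal n ?I" "minors T \<subseteq> ?I"
    using hgens_ideal[OF hgens_minors[OF T]] by (auto intro: ideal_gen_base)
  \<comment> \<open>The choice depends only on the predicate \<open>same_class T m\<close>, hence
    only on the class of \<open>m\<close>.\<close>
  define rep where "rep m = (SOME m'. m' \<in> keys p \<and> same_class T m m')" for m
  have rep: "rep m \<in> keys p" "same_class T m (rep m)" if "m \<in> keys p" for m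
    using someI[of "\<lambda>m'. m' \<in> keys p \<and> same_class T m m'" m] that by (auto simp: rep_def)
  have rep_eq: "rep m = rep m' \<longleftrightarrow> same_class T m m'" if "m \<in> keys p" "m' \<in> keys p" for m m'
  proof
    assume "rep m = rep m'"
    then show "same_class T m m'"
      using rep(2)[OF that(1)] rep(2)[OF that(2)] same_class_trans same_class_sym by metis
  next
    assume "same_class T m m'"
    then have "same_class T m = same_class T m'"
      using same_class_trans same_class_sym by blast
    then show "rep m = rep m'" by (simp add: rep_def)
  qed
  have "(\<Sum>m\<in>keys p. single (rep m) (lookup p m)) =
      (\<Sum>\<kappa>\<in>rep ` keys p. \<Sum>m\<in>{m \<in> keys p. rep m = \<kappa>}. single (rep m) (lookup p m))"
    by (rule sum.image_gen) simp
  also have "\<dots> = (\<Sum>\<kappa>\<in>rep ` keys p. 0)"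
  proof (rule sum.cong)
    fix \<kappa> assume "\<kappa> \<in> rep ` keys p"
    then obtain \<mu> where \<mu>: "\<mu> \<in> keys p" "\<kappa> = rep \<mu>" by blast
    have "(\<Sum>m\<in>{m \<in> keys p. rep m = \<kappa>}. single (rep m) (lookup p m)) =
        single \<kappa> (\<Sum>m\<in>{m \<in> keys p. rep m = \<kappa>}. lookup p m)"
      by (simp add: single_sum[symmetric])
    also have "(\<Sum>m\<in>{m \<in> keys p. rep m = \<kappa>}. lookup p m) = class_sum T \<mu> p"
      unfolding class_sum_def sum.inter_filter[OF finite_keys] \<mu>(2)
      using rep_eq[OF _ \<mu>(1)] same_class_sym by (intro sum.cong) auto
    finally show "(\<Sum>m\<in>{m \<in> keys p. rep m = \<kappa>}. single (rep m) (lookup p m)) = 0"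
      by (simp add: cs)
  qed simp
  finally have "p = (\<Sum>m\<in>keys p. single m (lookup p m) - single (rep m) (lookup p m))"
    using poly_decomp[of p] by (simp add: sum_subtractf)
  also have "\<dots> \<in> ?I"
    using rep polyring_keys[OF p]
    by (intro ideal_sum_mem[OF I(1)] straighten[OF T I]) auto
  finally show ?thesis .
qed

text \<open>Multiplication by \<open>v\<close> translates classes injectively, so the class sums of
  \<open>p\<close> occur among those of \<open>var v * p\<close>.\<close>

lemma minors_nonzerodivisor:
  assumes T: "T \<subseteq> {1..n}" and p: "p \<in> polyring n" "var v * p \<in> ideal_gen n (minors T)"
  shows "p \<in> ideal_gen n (minors T)"
proof (rule in_minors_class_sum[OF T p(1)])
  fix \<mu>
  show "class_sum T \<mu> p = 0"
    using class_sum_minors[OF T p(2), of "single v 1 + \<mu>"] class_sum_single_mult[of T "single v 1" \<mu> 1 p]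
    by (simp add: var_def)
qed

subsection \<open>Regularity of the ideals of minors and of stars\<close>

lemma divar_var:
  assumes "w \<noteq> v"
  shows "divar v (var w) = 0"
proof (rule poly_mapping_eqI)
  fix m
  have "lookup (single w 1) v \<noteq> lookup (single v (Suc 0) + m) v"
    using assms by (simp add: lookup_add lookup_single)
  then have "single w 1 \<noteq> single v (Suc 0) + m"
    by metis
  then show "lookup (divar v (var w)) m = lookup 0 m"
    by (simp add: lookup_divar var_def lookup_single)
qed

lemma divar_minor: "v \<notin> {Xvar a, Yvar a, Xvar b, Yvar b} \<Longrightarrow> divar v (minor a b) = 0"
proof -
  assume "v \<notin> {Xvar a, Yvar a, Xvar b, Yvar b}"
  then have "Xvar a \<noteq> v" "Yvar a \<noteq> v" "Xvar b \<noteq> v" "Yvar b \<noteq> v"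
    by auto
  then show ?thesis
    by (simp add: minor_def divar_diff divar_var_mult_free divar_var)
qed

lemma divar_closed_free:
  assumes "hgens n S" "\<And>f. f \<in> S \<Longrightarrow> divar v f = 0"
  shows "divar_closed v (ideal_gen n S)"
  using assms ideal_0[OF hgens_ideal[OF assms(1)]]
  by (intro divar_closed_ideal_gen) (auto simp: hgens_def)

lemma is_colon_free:
  assumes "hgens n S" "\<And>f. f \<in> S \<Longrightarrow> divar v f = 0" "v \<in> vars n"
  shows "is_colon n (ideal_gen n S) (var v) (ideal_gen n S)"
  using divar_closed_colon[OF divar_closed_free[OF assms(1,2)]] hgens_graded[OF assms(1)]
    ideal_mult[OF hgens_ideal[OF assms(1)] polyring_var[OF assms(3)]]
  unfolding is_colon_def by blast

text \<open>\<open>v\<close> is a nonzerodivisor modulo the ideal, so the colon ideal is the ideal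
  itself and the bound \<open>r + 1 - 1\<close> demanded of it is the given one.\<close>

lemma reg_le_insert_free:
  assumes "hgens n S" "\<And>f. f \<in> S \<Longrightarrow> divar v f = 0" "v \<in> vars n"
    and "reg_le n (ideal_gen n S) r" "1 \<le> r"
  shows "reg_le n (ideal_gen n (insert (var v) S)) r"
  using assms hgens_var[OF assms(3,1)]
  by (intro reg_le_insert[OF _ homogeneous_var is_colon_free]) auto

lemma ideal_gen_empty: "ideal_gen n {} = {0}"
  using ideal_gen_least[of n "{0}" "{}"] ideal_0[OF hgens_ideal[OF hgens_empty]]
  by (auto simp: is_ideal_def)

lemma hgens_vars: "U \<subseteq> vars n \<Longrightarrow> hgens n (var ` U)"
  by (auto simp: hgens_def polyring_var intro: exI[where x = 1])

lemma reg_vars: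
  assumes "U \<subseteq> vars n"
  shows "reg_le n (ideal_gen n (var ` U)) 1"
proof -
  have "finite U" using assms finite_subset finite_vars by blast
  from this assms show ?thesis
  proof (induction U)
    case empty
    then show ?case by (simp add: ideal_gen_empty reg_le_zero)
  next
    case (insert v U)
    then show ?case
      unfolding image_insert
      by (intro reg_le_insert_free hgens_vars) (auto intro!: divar_var)
  qed
qed

lemma ideal_gen_eqI:
  assumes "hgens n S" "hgens n T" "S \<subseteq> ideal_gen n T" "T \<subseteq> ideal_gen n S"
  shows "ideal_gen n S = ideal_gen n T"
  using assms ideal_gen_least[OF hgens_ideal] by blast

lemma minor_in_ideal:
  assumes I: "is_ideal n I" and ab: "a \<in> {1..n}" "b \<in> {1..n}"
    and "var (Xvar a) \<in> I" "var (Xvar b) \<in> I \<or> var (Yvar a) \<in> I"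
  shows "minor a b \<in> I" "minor b a \<in> I"
proof -
  have *: "var (Xvar a) * var (Yvar b) \<in> I"
    using ideal_mult_right[OF I polyring_var[OF vars_XY(2)[OF ab(2)]]] assms(4) .
  have "var (Xvar b) * var (Yvar a) \<in> I"
    using ideal_mult_right[OF I polyring_var[OF vars_XY(2)[OF ab(1)]]]
      ideal_mult[OF I polyring_var[OF vars_XY(1)[OF ab(2)]]] assms(5) by blast
  with * show "minor a b \<in> I" "minor b a \<in> I"
    unfolding minor_def by (auto intro: ideal_diff[OF I])
qed

lemma is_ideal_colon: "is_ideal n I \<Longrightarrow> f \<in> polyring n \<Longrightarrow> is_ideal n {q \<in> polyring n. f * q \<in> I}"
  by (auto simp: is_ideal_def distrib_left mult.left_commute)

lemma reg_minors_cone: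
  assumes T: "T \<subseteq> {1..n}" "m \<in> {1..n}" "m \<notin> T" and reg: "reg_le n (ideal_gen n (minors T) :: 'k::field mpoly set) 2"
  shows "reg_le n (ideal_gen n (insert (var (Yvar m)) (insert (var (Xvar m)) (minors T))) :: 'k mpoly set) 2"
proof -
  have free: "divar (Xvar m) f = 0" "divar (Yvar m) f = 0" if "f \<in> minors T" for f :: "'k mpoly"
    using that T(3) by (auto simp: minors_def intro!: divar_minor)
  show ?thesis
    using T(2) free reg
    by (intro reg_le_insert_free hgens_var hgens_minors T(1) vars_XY) (auto simp: divar_var)
qed

text \<open>A minor that meets column \<open>m\<close> lies in the ideal of the two entries of this
  column, so only the minors on \<open>T\<close> survive.\<close>

lemma ideal_gen_cone:
  assumes T: "T \<subseteq> {1..n}" "m \<in> {1..n}"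
  shows "ideal_gen n (insert (var (Yvar m)) (insert (var (Xvar m)) (minors (insert m T)))) =
    ideal_gen n (insert (var (Yvar m)) (insert (var (Xvar m)) (minors T)))"
    (is "ideal_gen n ?S = ideal_gen n ?S'")
proof (rule ideal_gen_eqI)
  show gens: "hgens n ?S" "hgens n ?S'"
    using T by (intro hgens_var hgens_minors vars_XY; simp)+
  have mem: "minor a b \<in> ideal_gen n ?S'" if "a \<in> insert m T" "b \<in> insert m T" for a b
  proof (cases "a = m \<or> b = m")
    case True
    have "var (Xvar m) \<in> ideal_gen n ?S'" "var (Yvar m) \<in> ideal_gen n ?S'"
      by (simp_all add: ideal_gen_base)
    then show ?thesis
      using True that T minor_in_ideal[OF hgens_ideal[OF gens(2)]] by blast
  next
    case False
    with that show ?thesis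
      by (intro ideal_gen_base) (auto simp: minors_def)
  qed
  then show "?S \<subseteq> ideal_gen n ?S'"
    by (auto simp: minors_def intro: ideal_gen_base)
  show "?S' \<subseteq> ideal_gen n ?S"
    by (auto simp: minors_def intro!: ideal_gen_base)
qed

text \<open>Induction on the columns. With x_m and y_m adjoined, the minors on
  \<open>insert m T\<close> reduce to those on \<open>T\<close>. Then y_m is removed by
  \<open>reg_le_insertD\<close>: its colon ideal modulo the minors and x_m is generated by all x_t
  and has regularity 1. Finally x_m is removed as a nonzerodivisor modulo the minors.\<close>

theorem reg_minors:
  assumes "T \<subseteq> {1..n}"
  shows "reg_le n (ideal_gen n (minors T) :: 'k::field mpoly set) 2"
proof -
  have "finite T" using assms finite_subset by blast
  from this assms show ?thesis
  proof (induction T)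
    case empty
    have "minors {} = ({} :: 'k mpoly set)" by (simp add: minors_def)
    then show ?case by (simp add: ideal_gen_empty reg_le_zero)
  next
    case (insert m T)
    let ?M = "minors (insert m T) :: 'k mpoly set"
    let ?N = "insert (var (Xvar m)) ?M"
    let ?Q = "ideal_gen n (var ` Xvar ` insert m T) :: 'k mpoly set"
    have M: "hgens n ?M"
      using insert.prems by (rule hgens_minors)
    have m: "Xvar m \<in> vars n" "Yvar m \<in> vars n"
      using insert.prems by (auto intro!: vars_XY)
    have N: "hgens n ?N"
      by (rule hgens_var[OF m(1) M])
    have XT: "Xvar ` insert m T \<subseteq> vars n"
      using insert.prems by (auto intro!: vars_XY)
    have Q: "is_ideal n ?Q" "graded_ideal n ?Q"
      using hgens_vars[OF XT] by (auto intro: hgens_ideal hgens_graded)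
    have XQ: "var (Xvar t) \<in> ?Q" if "t \<in> insert m T" for t
      using that by (intro ideal_gen_base) auto
    have "?N \<subseteq> ?Q"
      using XQ insert.prems minor_in_ideal[OF Q(1)] by (auto simp: minors_def subset_iff)
    then have NQ: "ideal_gen n ?N \<subseteq> ?Q"
      by (rule ideal_gen_least[OF Q(1)])
    have "var (Yvar m) * q \<in> ideal_gen n ?N" if "q \<in> ?Q" for q
    proof -
      let ?C = "{q \<in> polyring n. var (Yvar m) * q \<in> ideal_gen n ?N}"
      \<comment> \<open>The product x_t y_m is the minor on \<open>t, m\<close> plus x_m
        y_t.\<close>
      have "var (Xvar t) \<in> ?C" if t: "t \<in> insert m T" for t
      proof -
        have "minor t m \<in> ideal_gen n ?N" "var (Xvar m) \<in> ideal_gen n ?N"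
          using t by (auto simp: minors_def intro!: ideal_gen_base)
        moreover have "var (Yvar t) \<in> polyring n"
          using t insert.prems by (intro polyring_var vars_XY) auto
        ultimately have "minor t m + var (Xvar m) * var (Yvar t) \<in> ideal_gen n ?N"
          using ideal_add[OF hgens_ideal[OF N]] ideal_mult_right[OF hgens_ideal[OF N]] by metis
        then have "var (Yvar m) * var (Xvar t) \<in> ideal_gen n ?N"
          by (simp add: minor_def mult.commute)
        moreover have "var (Xvar t) \<in> polyring n"
          using t XT by (intro polyring_var) auto
        ultimately show ?thesis by blast
      qed
      then have "?Q \<subseteq> ?C"
        by (intro ideal_gen_least is_ideal_colon hgens_ideal[OF N] polyring_var m) auto
      with that show ?thesis by blast
    qed
    \<comment> \<open>All generators of \<open>ideal_gen n ?N\<close> lie in the ideal of the x_t,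
      modulo which y_m is a nonzerodivisor.\<close>
    moreover have "q \<in> ?Q" if "var (Yvar m) * q \<in> ideal_gen n ?N" for q
    proof -
      have "divar_closed (Yvar m) ?Q"
        using hgens_vars[OF XT] by (rule divar_closed_free) (auto intro!: divar_var)
      then show ?thesis
        using that NQ divar_closed_colon by blast
    qed
    ultimately have colon: "is_colon n (ideal_gen n ?N) (var (Yvar m)) ?Q"
      using Q(2) unfolding is_colon_def by blast
    have "reg_le n (ideal_gen n (insert (var (Yvar m)) ?N)) 2"
      using insert reg_minors_cone[of T n m, where 'k = 'k] ideal_gen_cone[of T n m, where 'a = 'k] by simp
    moreover have "reg_le n ?Q (2 - 1)"
      using reg_vars[OF XT, where 'a = 'k] by simp
    ultimately have "reg_le n (ideal_gen n ?N) 2"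
      by (rule reg_le_insertD[OF hgens_var[OF m(2) N] homogeneous_var colon])
    moreover have "is_colon n (ideal_gen n ?M) (var (Xvar m)) (ideal_gen n ?M)"
      using hgens_graded[OF M] minors_nonzerodivisor[OF insert.prems]
        ideal_mult[OF hgens_ideal[OF M] polyring_var[OF m(1)]]
      unfolding is_colon_def by blast
    ultimately show ?case
      by (intro reg_le_nonzerodivisor[OF M m(1)])
  qed
qed

section \<open>The ideal of a star and its regularity\<close>

definition star_minors :: "nat \<Rightarrow> nat set \<Rightarrow> 'k::field mpoly set" where
  "star_minors s N = {minor s t |t. t \<in> N}"

lemma hgens_star_minors: "s \<in> {1..n} \<Longrightarrow> N \<subseteq> {1..n} \<Longrightarrow> hgens n (star_minors s N)"
  using homogeneous_minor by (auto simp: hgens_def star_minors_def intro!: minor_polyring)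

lemma keys_in_vars_ideal:
  assumes U: "U \<subseteq> vars n" and p: "p \<in> ideal_gen n (var ` U)" and m: "m \<in> keys p"
  shows "keys m \<inter> U \<noteq> {}"
proof -
  let ?J = "{p \<in> polyring n. \<forall>m\<in>keys p. keys m \<inter> U \<noteq> {}}"
  have "single a c * p \<in> ?J" if a: "keys a \<subseteq> vars n" and p: "p \<in> ?J" for a c p
    using keys_mult[of "single a c" p] p polyring_single[OF a]
    by (fastforce simp: keys_add_nat split: if_splits)
  moreover have "p + q \<in> ?J" if "p \<in> ?J" "q \<in> ?J" for p q
    using that keys_add[of p q] polyring_add[of p n q] by blast
  moreover have "?J \<subseteq> polyring n" "0 \<in> ?J"
    by auto
  ultimately have "is_ideal n ?J"
    by (intro is_idealI)
  moreover have "var ` U \<subseteq> ?J"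
    using U polyring_var by (auto simp: var_def)
  ultimately have "ideal_gen n (var ` U) \<subseteq> ?J"
    by (rule ideal_gen_least)
  with p m show ?thesis by blast
qed

text \<open>The terms containing \<open>u\<close> are divided by \<open>u\<close>, the remaining
  ones by \<open>v\<close>; closedness under both divisions keeps the quotients in
  \<open>B\<close>.\<close>

lemma decompose_two_vars:
  assumes B: "is_ideal n B" "divar_closed u B" "divar_closed v B" "u \<in> vars n" and p: "p \<in> B"
    and "\<And>m. m \<in> keys p \<Longrightarrow> keys m \<inter> {u, v} \<noteq> {}"
  obtains a b where "a \<in> B" "b \<in> B" "p = var u * a + var v * b"
proof (rule that)
  define q where "q = p - var u * divar u p"
  show "divar u p \<in> B"
    using B p by (simp add: divar_closed_def)
  then have "q \<in> B"
    unfolding q_def using p by (intro ideal_diff[OF B(1)] ideal_mult[OF B(1)] polyring_var B)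
  then show "divar v q \<in> B"
    using B by (simp add: divar_closed_def)
  have "q = var v * divar v q"
  proof (rule poly_mapping_eqI)
    fix m
    have "lookup p m = 0 \<or> lookup m u \<noteq> 0 \<or> lookup m v \<noteq> 0"
      using assms(6)[of m] by (cases "lookup p m = 0") (auto simp: in_keys_iff)
    moreover have "lookup q m = (if lookup m u = 0 then lookup p m else 0)"
      by (simp add: q_def lookup_minus lookup_mult_divar)
    ultimately show "lookup q m = lookup (var v * divar v q) m"
      by (auto simp: lookup_mult_divar)
  qed
  then show "p = var u * divar u p + var v * divar v q"
    by (simp add: q_def)
qed

text \<open>Expanding a 3 by 3 determinant with a repeated row gives x_s [t,u] = x_t [s,u] - x_u
  [s,t], and likewise y_s [t,u] = y_t [s,u] - y_u [s,t].\<close>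

lemma var_minor_in_star:
  assumes I: "is_ideal n I" "star_minors s N \<subseteq> I" and tu: "t \<in> N" "u \<in> N" "N \<subseteq> {1..n}"
  shows "var (Xvar s) * minor t u \<in> I" "var (Yvar s) * minor t u \<in> I"
proof -
  have st: "minor s t \<in> I" "minor s u \<in> I"
    using I(2) tu by (auto simp: star_minors_def)
  have v: "var (Xvar t) \<in> polyring n" "var (Xvar u) \<in> polyring n"
    "var (Yvar t) \<in> polyring n" "var (Yvar u) \<in> polyring n"
    using tu by (auto intro!: polyring_var vars_XY)
  have "var (Xvar t) * minor s u - var (Xvar u) * minor s t \<in> I"
    "var (Yvar t) * minor s u - var (Yvar u) * minor s t \<in> I"
    using st v by (auto intro!: ideal_diff[OF I(1)] ideal_mult[OF I(1)])
  then show "var (Xvar s) * minor t u \<in> I" "var (Yvar s) * minor t u \<in> I"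
    by (simp_all add: minor_def algebra_simps)
qed

lemma star_minors_sub_vars:
  assumes "s \<in> {1..n}" "N \<subseteq> {1..n}"
  shows "ideal_gen n (star_minors s N) \<subseteq> ideal_gen n (var ` {Xvar s, Yvar s})"
proof (rule ideal_gen_least)
  have U: "{Xvar s, Yvar s} \<subseteq> vars n"
    using assms by (auto simp: vars_def)
  show I: "is_ideal n (ideal_gen n (var ` {Xvar s, Yvar s}))"
    by (rule hgens_ideal[OF hgens_vars[OF U]])
  show "star_minors s N \<subseteq> ideal_gen n (var ` {Xvar s, Yvar s})"
    using assms minor_in_ideal(1)[OF I assms(1)] by (auto simp: star_minors_def ideal_gen_base subset_iff)
qed

text \<open>For the inclusion from right to left: modulo the star ideal, an element of the
  intersection is represented by some \<open>b\<close> in the ideal of the minors on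
  \<open>N\<close>, and \<open>b\<close> also lies in (x_s, y_s). These minors avoid column
  \<open>s\<close>, so \<open>b\<close> is x_s c + y_s d with \<open>c\<close> and \<open>d\<close>
  in their ideal, and such products lie in the star ideal by
  \<open>var_minor_in_star\<close>.\<close>

theorem star_minors_eq:
  assumes s: "s \<in> {1..n}" "s \<notin> N" and N: "N \<subseteq> {1..n}"
  shows "ideal_gen n (star_minors s N) =
    ideal_gen n (var ` {Xvar s, Yvar s}) \<inter> (ideal_gen n (minors (insert s N)) :: 'k::field mpoly set)"
    (is "?L = ?A \<inter> ?B")
proof
  have sN: "insert s N \<subseteq> {1..n}" using s N by auto
  have U: "{Xvar s, Yvar s} \<subseteq> vars n"
    using s by (auto simp: vars_def)
  have gL: "hgens n (star_minors s N)" and gB: "hgens n (minors (insert s N))" and gN: "hgens n (minors N)"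
    by (rule hgens_star_minors[OF s(1) N], rule hgens_minors[OF sN], rule hgens_minors[OF N])
  have L: "is_ideal n ?L" "is_ideal n ?A" "is_ideal n ?B"
    using hgens_vars[OF U] gL gB by (auto intro: hgens_ideal)
  have LA: "?L \<subseteq> ?A"
    by (rule star_minors_sub_vars[OF s(1) N])
  moreover have "?L \<subseteq> ?B"
    by (rule ideal_gen_mono) (auto simp: star_minors_def minors_def)
  ultimately show "?L \<subseteq> ?A \<inter> ?B" by blast
  have "minors (insert s N) \<subseteq> ideal_gen n (star_minors s N \<union> minors N)"
  proof -
    have I: "is_ideal n (ideal_gen n (star_minors s N \<union> minors N))"
      by (rule hgens_ideal[OF hgens_Un[OF gL gN]])
    have 1: "minor s t \<in> ideal_gen n (star_minors s N \<union> minors N)" if "t \<in> N" for t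
      using that by (intro ideal_gen_base) (auto simp: star_minors_def)
    have 2: "minor t u \<in> ideal_gen n (star_minors s N \<union> minors N)" if "t \<in> N" "u \<in> N" for t u
      using that by (intro ideal_gen_base) (auto simp: minors_def)
    have 3: "minor t s \<in> ideal_gen n (star_minors s N \<union> minors N)" if "t \<in> N" for t
      unfolding minor_swap[of t s] by (rule ideal_uminus[OF I 1[OF that]])
    show ?thesis
      using 1 2 3 ideal_0[OF I] by (auto simp: minors_def)
  qed
  then have BL: "?B \<subseteq> ideal_gen n (star_minors s N \<union> minors N)"
    by (rule ideal_gen_least[OF hgens_ideal[OF hgens_Un[OF gL gN]]])
  show "?A \<inter> ?B \<subseteq> ?L"
  proof
    fix p assume p: "p \<in> ?A \<inter> ?B"
    then have "p \<in> ideal_sum ?L (ideal_gen n (minors N))"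
      using BL gL gN ideal_gen_Un unfolding hgens_def by blast
    then obtain a b where ab: "p = a + b" "a \<in> ?L" "b \<in> ideal_gen n (minors N)"
      by (auto simp: ideal_sum_def)
    have "b = p - a" using ab by simp
    then have bA: "b \<in> ?A"
      using p ab LA ideal_diff[OF L(2)] by blast
    have free: "divar v f = 0" if "v \<in> {Xvar s, Yvar s}" "f \<in> minors N" for v and f :: "'k mpoly"
      using that s by (auto simp: minors_def intro!: divar_minor)
    obtain c d where cd: "c \<in> ideal_gen n (minors N)" "d \<in> ideal_gen n (minors N)"
      "b = var (Xvar s) * c + var (Yvar s) * d"
    proof (rule decompose_two_vars[OF hgens_ideal[OF gN] _ _ _ ab(3)])
      show "keys m \<inter> {Xvar s, Yvar s} \<noteq> {}" if "m \<in> keys b" for m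
        using keys_in_vars_ideal[OF U bA that] .
      show "divar_closed (Xvar s) (ideal_gen n (minors N :: 'k mpoly set))"
        "divar_closed (Yvar s) (ideal_gen n (minors N :: 'k mpoly set))"
        using free by (auto intro!: divar_closed_free[OF gN])
    qed (use U in auto)
    have "var v * q \<in> ?L" if v: "v \<in> {Xvar s, Yvar s}" and q: "q \<in> ideal_gen n (minors N)" for v q
    proof -
      have sub: "star_minors s N \<subseteq> ?L"
        by (auto intro: ideal_gen_base)
      have "var v * minor t u \<in> ?L" if "t \<in> N" "u \<in> N" for t u
        using v var_minor_in_star[OF L(1) sub that N] by auto
      moreover have "minor t u \<in> polyring n" if "t \<in> N" "u \<in> N" for t u
        using that N by (intro minor_polyring) auto
      ultimately have "minors N \<subseteq> {q \<in> polyring n. var v * q \<in> ?L}"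
        unfolding minors_def by blast
      then have "ideal_gen n (minors N) \<subseteq> {q \<in> polyring n. var v * q \<in> ?L}"
        using U v by (intro ideal_gen_least is_ideal_colon L polyring_var) auto
      with q show ?thesis by blast
    qed
    then have "b \<in> ?L"
      using cd by (auto intro: ideal_add[OF L(1)])
    then show "p \<in> ?L"
      using ab ideal_add[OF L(1)] by blast
  qed
qed

text \<open>The sum of the two intersected ideals decides the bound: adjoining x_s and y_s removes
  all minors that meet column \<open>s\<close>, and what is left has regularity at most
  \<open>2 = 3 - 1\<close>.\<close>

theorem reg_star_minors:
  assumes s: "s \<in> {1..n}" "s \<notin> N" and N: "N \<subseteq> {1..n}"
  shows "reg_le n (ideal_gen n (star_minors s N) :: 'k::field mpoly set) 3"
  unfolding star_minors_eq[OF assms]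
proof (rule reg_le_Int)
  have U: "{Xvar s, Yvar s} \<subseteq> vars n" and sN: "insert s N \<subseteq> {1..n}"
    using s N by (auto simp: vars_def)
  let ?V = "var ` {Xvar s, Yvar s} :: 'k mpoly set"
  show "graded_ideal n (ideal_gen n ?V)" "graded_ideal n (ideal_gen n (minors (insert s N)))"
    using hgens_vars[OF U] hgens_minors[OF sN] by (auto intro: hgens_graded)
  show "reg_le n (ideal_gen n ?V) 3"
    by (rule reg_le_mono[OF reg_vars[OF U]]) simp
  show "reg_le n (ideal_gen n (minors (insert s N))) 3"
    by (rule reg_le_mono[OF reg_minors[OF sN]]) simp
  have "ideal_sum (ideal_gen n ?V) (ideal_gen n (minors (insert s N))) =
      ideal_gen n (insert (var (Yvar s)) (insert (var (Xvar s)) (minors (insert s N))))"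
  proof -
    have "?V \<union> minors (insert s N) = insert (var (Yvar s)) (insert (var (Xvar s)) (minors (insert s N)))"
      by auto
    then show ?thesis
      using hgens_vars[OF U, where 'a = 'k] hgens_minors[OF sN, where 'a = 'k] ideal_gen_Un
      unfolding hgens_def by metis
  qed
  also have "\<dots> = ideal_gen n (insert (var (Yvar s)) (insert (var (Xvar s)) (minors N)))"
    by (rule ideal_gen_cone[OF N s(1)])
  finally have "ideal_sum (ideal_gen n ?V) (ideal_gen n (minors (insert s N))) =
      ideal_gen n (insert (var (Yvar s)) (insert (var (Xvar s)) (minors N)))" .
  then show "reg_le n (ideal_sum (ideal_gen n ?V) (ideal_gen n (minors (insert s N)))) (3 - 1)"
    using reg_minors_cone[OF N s reg_minors[OF N]] by simp
qed

section \<open>The linear strand and cliques\<close>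

abbreviation mon :: "indet \<Rightarrow> (indet \<Rightarrow>\<^sub>0 nat)" where
  "mon v \<equiv> single v (Suc 0)"

definition edge_minors :: "nat set set \<Rightarrow> 'k::field mpoly set" where
  "edge_minors E = {minor i j |i j. {i, j} \<in> E}"

text \<open>If a term of \<open>single a c * p\<close> divides \<open>\<mu>\<close>, then so does
  the term of \<open>p\<close> from which it arises.\<close>

lemma is_ideal_avoid:
  "is_ideal n {p :: 'k::field mpoly. p \<in> polyring n \<and> (\<forall>m r. \<mu> = m + r \<longrightarrow> lookup p m = 0)}"
proof (rule is_idealI)
  fix a :: "indet \<Rightarrow>\<^sub>0 nat" and c :: 'k and p :: "'k mpoly"
  assume a: "keys a \<subseteq> vars n" and p: "p \<in> {p \<in> polyring n. \<forall>m r. \<mu> = m + r \<longrightarrow> lookup p m = 0}"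
  have "lookup (single a c * p) m = 0" if "\<mu> = m + r" for m r
  proof (cases "\<exists>b. m = a + b")
    case True
    then obtain b where b: "m = a + b" ..
    then have "\<mu> = b + (a + r)"
      using that by (simp add: ac_simps)
    then show ?thesis
      using p by (simp add: b lookup_single_mult_add)
  qed (simp add: lookup_single_mult_not)
  then show "single a c * p \<in> {p \<in> polyring n. \<forall>m r. \<mu> = m + r \<longrightarrow> lookup p m = 0}"
    using p polyring_single[OF a] by auto
qed (auto simp: lookup_add)

text \<open>A coefficient at \<open>\<mu>\<close> can only come from a generator with a term that
  divides \<open>\<mu>\<close>.\<close>

lemma ideal_gen_avoid:
  fixes p :: "'k::field mpoly"
  assumes S: "S \<subseteq> polyring n" and avoid: "\<And>f m r. f \<in> S \<Longrightarrow> lookup f m \<noteq> 0 \<Longrightarrow> \<mu> \<noteq> m + r"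
    and p: "p \<in> ideal_gen n S"
  shows "lookup p \<mu> = 0"
proof -
  have "ideal_gen n S \<subseteq> {p \<in> polyring n. \<forall>m r. \<mu> = m + r \<longrightarrow> lookup p m = 0}"
    using S avoid by (intro ideal_gen_least is_ideal_avoid) blast
  then show ?thesis
    using p by (metis (mono_tags, lifting) add.right_neutral mem_Collect_eq subsetD)
qed

lemma mon_eq: "mon u + mon v = mon u' + mon v' \<longleftrightarrow> (u = u' \<and> v = v') \<or> (u = v' \<and> v = u')"
proof
  assume eq: "mon u + mon v = mon u' + mon v'"
  have "lookup (mon u + mon v) w = lookup (mon u' + mon v') w" for w
    by (simp only: eq)
  from this[of u] this[of v] this[of u'] this[of v'] show "(u = u' \<and> v = v') \<or> (u = v' \<and> v = u')"
    by (auto simp: lookup_add lookup_single when_def split: if_splits)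
qed (auto simp: add.commute)

lemma lookup_minor:
  "lookup (minor i j) m = (1 when m = mon (Xvar i) + mon (Yvar j)) - (1 when m = mon (Xvar j) + mon (Yvar i))"
  by (auto simp: minor_def var_def mult_single lookup_minus lookup_single when_def)

lemma lookup_minorD:
  "lookup (minor i j) m \<noteq> 0 \<Longrightarrow> m = mon (Xvar i) + mon (Yvar j) \<or> m = mon (Xvar j) + mon (Yvar i)"
  by (auto simp: lookup_minor when_def split: if_splits)

lemma mon_dvd: "\<mu> = mon u + mon v + r \<Longrightarrow> lookup \<mu> u \<noteq> 0 \<and> lookup \<mu> v \<noteq> 0"
  by (simp add: lookup_add)

lemma mdeg_mon2: "mdeg (mon u + mon v) = 2"
  by (simp add: mdeg_add)

lemma mdeg_2E:
  assumes "mdeg m = 2"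
  obtains u v where "m = mon u + mon v"
proof -
  have "m \<noteq> 0" using assms by auto
  then obtain u where u: "lookup m u \<noteq> 0"
    using mdeg_eq_0 by (metis poly_mapping_eqI lookup_zero)
  then have m: "m = mon u + (m - mon u)"
    by (rule add_single_minus[symmetric])
  then have "mdeg (m - mon u) = 1"
    using assms by (metis Suc_1 mdeg_add mdeg_single One_nat_def add_left_imp_eq plus_1_eq_Suc)
  then have "m - mon u \<noteq> 0" by auto
  then obtain v where v: "lookup (m - mon u) v \<noteq> 0"
    by (metis poly_mapping_eqI lookup_zero)
  then have m': "m - mon u = mon v + (m - mon u - mon v)"
    by (rule add_single_minus[symmetric])
  then have "mdeg (m - mon u - mon v) = 0"
    using \<open>mdeg (m - mon u) = 1\<close> by (metis One_nat_def add_right_imp_eq mdeg_add mdeg_single add_0_right add_left_imp_eq)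
  then have "m - mon u = mon v"
    using m' by (simp add: mdeg_eq_0)
  then show ?thesis
    using m that by metis
qed

text \<open>The shape of the quadratic part of an element of a binomial edge ideal: a combination of
  minors, so that the coefficient of \<open>x\<^sub>a y\<^sub>b\<close> is the coefficient of the minor on the edge \<open>ab\<close>.\<close>

definition edge_form :: "(nat \<Rightarrow> nat \<Rightarrow> bool) \<Rightarrow> 'k::field mpoly \<Rightarrow> bool" where
  "edge_form E p \<longleftrightarrow>
     (\<forall>a b. lookup p (mon (Xvar a) + mon (Xvar b)) = 0 \<and> lookup p (mon (Yvar a) + mon (Yvar b)) = 0 \<and>
        lookup p (mon (Xvar a) + mon (Yvar b)) = - lookup p (mon (Xvar b) + mon (Yvar a)) \<and>
        (lookup p (mon (Xvar a) + mon (Yvar b)) \<noteq> 0 \<longrightarrow> E a b))"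

lemma low_degree_edge_ideal:
  assumes S: "(edge_minors E :: 'k::field mpoly set) \<subseteq> polyring n" and p: "(p :: 'k mpoly) \<in> ideal_gen n (edge_minors E)" and m: "mdeg m < 2"
  shows "lookup p m = 0"
proof (rule ideal_gen_avoid[OF S _ p])
  fix f :: "'k mpoly" and m' r assume "f \<in> edge_minors E" "lookup f m' \<noteq> 0"
  then have "mdeg m' = 2"
    using lookup_minorD by (fastforce simp: edge_minors_def mdeg_mon2)
  then show "m \<noteq> m' + r"
    using m by (auto simp: mdeg_add)
qed

lemma antisym_edge_ideal:
  assumes S: "(edge_minors E :: 'k::field mpoly set) \<subseteq> polyring n" and p: "(p :: 'k mpoly) \<in> ideal_gen n (edge_minors E)"
  shows "lookup p (mon (Xvar a) + mon (Yvar b)) = - lookup p (mon (Xvar b) + mon (Yvar a))"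
proof -
  let ?u = "mon (Xvar a) + mon (Yvar b)" and ?v = "mon (Xvar b) + mon (Yvar a)"
  \<comment> \<open>The vanishing below degree 2 makes this set an ideal: multiplication by a term
    of positive degree then produces no quadratic terms.\<close>
  let ?J = "{p :: 'k mpoly. p \<in> polyring n \<and> (\<forall>m. mdeg m < 2 \<longrightarrow> lookup p m = 0) \<and> lookup p ?u + lookup p ?v = 0}"
  have "is_ideal n ?J"
  proof (rule is_idealI)
    show "p + q \<in> ?J" if "p \<in> ?J" "q \<in> ?J" for p q
      using that by (auto simp: lookup_add algebra_simps add_eq_0_iff)
    show "single e c * p \<in> ?J" if e: "keys e \<subseteq> vars n" and p: "p \<in> ?J" for e c p
    proof -
      have low: "lookup (single e c * p) m = 0" if "mdeg m < 2" for m
        using that p lookup_single_mult_add[of e c p] lookup_single_mult_not[of m e c p] mdeg_add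
        by (cases "\<exists>b. m = e + b") auto
      have two: "lookup (single e c * p) m = (if e = 0 then c * lookup p m else 0)" if "mdeg m = 2" for m
      proof (cases "e = 0")
        case True
        then show ?thesis using lookup_single_mult_add[of 0 c p m] by simp
      next
        case False
        then have "mdeg e > 0" by (simp add: mdeg_eq_0 neq0_conv[symmetric])
        then show ?thesis
          using that False p lookup_single_mult_add[of e c p] lookup_single_mult_not[of m e c p]
          by (cases "\<exists>b. m = e + b") (auto simp: mdeg_add)
      qed
      have "lookup (single e c * p) ?u + lookup (single e c * p) ?v = 0"
        using p two[OF mdeg_mon2] by (auto simp: distrib_left[symmetric])
      then show ?thesis
        using low p polyring_single[OF e] by auto
    qed
  qed auto
  moreover have "edge_minors E \<subseteq> ?J"
  proof
    fix f :: "'k mpoly" assume f: "f \<in> edge_minors E"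
    then obtain i j where ij: "f = minor i j" by (auto simp: edge_minors_def)
    have "lookup f m = 0" if "mdeg m < 2" for m
      using low_degree_edge_ideal[OF S ideal_gen_base[OF f] that] .
    moreover have "lookup f ?u + lookup f ?v = 0"
    proof -
      have "lookup f ?u + lookup f ?v =
          ((1 when a = i \<and> b = j) - (1 when a = j \<and> b = i)) + ((1 when b = i \<and> a = j) - (1 when b = j \<and> a = i))"
        unfolding ij lookup_minor mon_eq by simp
      then show ?thesis
        by (simp add: conj_commute)
    qed
    ultimately show "f \<in> ?J"
      using S f by auto
  qed
  ultimately have "ideal_gen n (edge_minors E) \<subseteq> ?J"
    by (rule ideal_gen_least)
  then show ?thesis
    using p by (auto simp: add_eq_0_iff2)
qed

lemma edge_form_edge_ideal:
  assumes S: "(edge_minors E :: 'k::field mpoly set) \<subseteq> polyring n" and p: "(p :: 'k mpoly) \<in> ideal_gen n (edge_minors E)"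
  shows "edge_form (\<lambda>a b. {a, b} \<in> E) p"
  unfolding edge_form_def
proof (intro allI conjI impI)
  fix a b
  show "lookup p (mon (Xvar a) + mon (Xvar b)) = 0"
  proof (rule ideal_gen_avoid[OF S _ p])
    fix f :: "'k mpoly" and m r assume "f \<in> edge_minors E" "lookup f m \<noteq> 0"
    then obtain i j where "m = mon (Xvar i) + mon (Yvar j)"
      using lookup_minorD by (fastforce simp: edge_minors_def)
    moreover have "lookup (mon (Xvar a) + mon (Xvar b)) (Yvar j) = 0"
      by (simp add: lookup_add lookup_single)
    ultimately show "mon (Xvar a) + mon (Xvar b) \<noteq> m + r"
      using mon_dvd by metis
  qed
  show "lookup p (mon (Yvar a) + mon (Yvar b)) = 0"
  proof (rule ideal_gen_avoid[OF S _ p])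
    fix f :: "'k mpoly" and m r assume "f \<in> edge_minors E" "lookup f m \<noteq> 0"
    then obtain i j where "m = mon (Xvar i) + mon (Yvar j)"
      using lookup_minorD by (fastforce simp: edge_minors_def)
    moreover have "lookup (mon (Yvar a) + mon (Yvar b)) (Xvar i) = 0"
      by (simp add: lookup_add lookup_single)
    ultimately show "mon (Yvar a) + mon (Yvar b) \<noteq> m + r"
      using mon_dvd by metis
  qed
  show "lookup p (mon (Xvar a) + mon (Yvar b)) = - lookup p (mon (Xvar b) + mon (Yvar a))"
    by (rule antisym_edge_ideal[OF S p])
  show "{a, b} \<in> E" if nz: "lookup p (mon (Xvar a) + mon (Yvar b)) \<noteq> 0"
  proof (rule ccontr)
    assume ab: "{a, b} \<notin> E"
    have "lookup p (mon (Xvar a) + mon (Yvar b)) = 0"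
    proof (rule ideal_gen_avoid[OF S _ p])
      fix f :: "'k mpoly" and m r assume f: "f \<in> edge_minors E" "lookup f m \<noteq> 0"
      then obtain i j where ij: "{i, j} \<in> E" "m = mon (Xvar i) + mon (Yvar j)"
        using lookup_minorD by (fastforce simp: edge_minors_def insert_commute)
      then have "lookup (mon (Xvar a) + mon (Yvar b)) (Xvar i) = 0 \<or>
          lookup (mon (Xvar a) + mon (Yvar b)) (Yvar j) = 0"
        using ab by (auto simp: lookup_add lookup_single when_def)
      then show "mon (Xvar a) + mon (Yvar b) \<noteq> m + r"
        using ij(2) mon_dvd by metis
    qed
    with nz show False ..
  qed
qed

text \<open>The only term of a generator that can divide x_s x_t y_u is x_s y_u, and for y_s x_t y_u
  it is x_t y_s. Thus the divisions by x_s and by y_s each control one endpoint of the pair.\<close>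

lemma lookup_star_ideal:
  assumes S: "(star_minors s N :: 'k::field mpoly set) \<subseteq> polyring n" and p: "(p :: 'k mpoly) \<in> ideal_gen n (star_minors s N)"
    and ts: "t \<noteq> s" "u \<noteq> s"
  shows "u \<notin> N \<Longrightarrow> lookup p (mon (Xvar s) + (mon (Xvar t) + mon (Yvar u))) = 0"
    and "t \<notin> N \<Longrightarrow> lookup p (mon (Yvar s) + (mon (Xvar t) + mon (Yvar u))) = 0"
proof -
  have *: "\<exists>w\<in>N. m = mon (Xvar s) + mon (Yvar w) \<or> m = mon (Xvar w) + mon (Yvar s)"
    if "f \<in> star_minors s N" "lookup f m \<noteq> 0" for f :: "'k mpoly" and m
    using that lookup_minorD by (fastforce simp: star_minors_def)
  show "lookup p (mon (Xvar s) + (mon (Xvar t) + mon (Yvar u))) = 0" if u: "u \<notin> N"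
  proof (rule ideal_gen_avoid[OF S _ p])
    fix f :: "'k mpoly" and m r assume "f \<in> star_minors s N" "lookup f m \<noteq> 0"
    from *[OF this] obtain w where w: "w \<in> N" "m = mon (Xvar s) + mon (Yvar w) \<or> m = mon (Xvar w) + mon (Yvar s)"
      by blast
    let ?\<mu> = "mon (Xvar s) + (mon (Xvar t) + mon (Yvar u))"
    have "lookup ?\<mu> (Yvar w) = 0" "lookup ?\<mu> (Yvar s) = 0"
      using w u ts by (auto simp: lookup_add lookup_single when_def)
    then show "?\<mu> \<noteq> m + r"
      using w(2) mon_dvd[of ?\<mu>] by metis
  qed
  show "lookup p (mon (Yvar s) + (mon (Xvar t) + mon (Yvar u))) = 0" if t: "t \<notin> N"
  proof (rule ideal_gen_avoid[OF S _ p])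
    fix f :: "'k mpoly" and m r assume "f \<in> star_minors s N" "lookup f m \<noteq> 0"
    from *[OF this] obtain w where w: "w \<in> N" "m = mon (Xvar s) + mon (Yvar w) \<or> m = mon (Xvar w) + mon (Yvar s)"
      by blast
    let ?\<mu> = "mon (Yvar s) + (mon (Xvar t) + mon (Yvar u))"
    have "lookup ?\<mu> (Xvar w) = 0" "lookup ?\<mu> (Xvar s) = 0"
      using w t ts by (auto simp: lookup_add lookup_single when_def)
    then show "?\<mu> \<noteq> m + r"
      using w(2) mon_dvd[of ?\<mu>] by metis
  qed
qed

section \<open>Coefficients of the Koszul differential\<close>

definition eps :: "indet \<Rightarrow> indet set \<Rightarrow> 'k::field" where
  "eps v T = (- 1) ^ card {u \<in> T. idx u < idx v}"

lemma eps_nonzero [simp]: "eps v T \<noteq> 0"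
  by (simp add: eps_def)

lemma lookup_sg_mult: "lookup (sg v T * p) m = eps v T * (lookup p m :: 'k::field)"
  unfolding sg_def eps_def by (cases "even (card {u \<in> T. idx u < idx v})") simp_all

text \<open>The contribution of the indeterminate \<open>v\<close> to the boundary at
  \<open>T\<close> and the monomial \<open>v r\<close>. It is 0 for \<open>v\<close> in
  \<open>T\<close> or outside \<open>vars n\<close>, so that sums may run over all indeterminates of
  a monomial.\<close>

definition kterm :: "nat \<Rightarrow> (indet set \<Rightarrow> 'k::field mpoly) \<Rightarrow> indet set \<Rightarrow> indet \<Rightarrow> (indet \<Rightarrow>\<^sub>0 nat) \<Rightarrow> 'k" where
  "kterm n w T v r = (if v \<in> vars n - T then eps v T * lookup (w (insert v T)) r else 0)"

lemma lookup_kd: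
  assumes T: "T \<subseteq> vars n"
  shows "lookup (kd n w T) m = (\<Sum>v\<in>keys m. kterm n w T v (m - mon v))"
proof -
  have "lookup (kd n w T) m = (\<Sum>v\<in>vars n - T. if v \<in> keys m then kterm n w T v (m - mon v) else 0)"
    using T by (simp add: kd_def lookup_sum lookup_sg_mult lookup_var_mult kterm_def in_keys_iff cong: if_cong)
      (auto intro!: sum.cong simp: in_keys_iff)
  also have "\<dots> = (\<Sum>v\<in>(vars n - T) \<inter> keys m. kterm n w T v (m - mon v))"
    by (simp add: sum.inter_restrict)
  also have "\<dots> = (\<Sum>v\<in>keys m. kterm n w T v (m - mon v))"
    by (rule sum.mono_neutral_left) (auto simp: kterm_def)
  finally show ?thesis .
qed

lemma lookup_kd_distinct:
  assumes T: "T \<subseteq> vars n" and d: "u \<noteq> v" "u \<noteq> x" "v \<noteq> x"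
  shows "lookup (kd n w T) (mon u + mon v + mon x) =
    kterm n w T u (mon v + mon x) + kterm n w T v (mon u + mon x) + kterm n w T x (mon u + mon v)"
proof -
  have "keys (mon u + mon v + mon x) = {u, v, x}"
    by (auto simp: keys_add_nat)
  moreover have "mon u + mon v + mon x - mon u = mon v + mon x"
    "mon u + mon v + mon x - mon x = mon u + mon v"
    by (simp_all only: add.assoc add_diff_cancel_left' add_diff_cancel_right'[of "mon u + mon v", unfolded add.assoc])
  moreover have "mon u + mon v + mon x - mon v = mon u + mon x"
    by (simp only: add.commute[of "mon u" "mon v"] add.assoc add_diff_cancel_left')
  ultimately show ?thesis
    using d by (simp add: lookup_kd[OF T] add.assoc)
qed

lemma lookup_kd_square:
  assumes T: "T \<subseteq> vars n" and d: "u \<noteq> x"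
  shows "lookup (kd n w T) (mon u + mon u + mon x) =
    kterm n w T u (mon u + mon x) + kterm n w T x (mon u + mon u)"
proof -
  have "keys (mon u + mon u + mon x) = {u, x}"
    by (auto simp: keys_add_nat)
  moreover have "mon u + mon u + mon x - mon u = mon u + mon x" "mon u + mon u + mon x - mon x = mon u + mon u"
    by (simp_all only: add.assoc add_diff_cancel_left' add_diff_cancel_right'[of "mon u + mon u", unfolded add.assoc])
  ultimately show ?thesis
    using d by (simp add: lookup_kd[OF T] add.assoc)
qed

text \<open>The condition \<open>cycle\<close> concerns only monomials in the columns
  \<open>V\<close>, in the application all columns but \<open>s\<close>; the other coefficients of
  the boundary of \<open>w\<close> are left free.\<close>

locale linear_strand_cycle =
  fixes n :: nat and w :: "indet set \<Rightarrow> 'k::field mpoly" and E :: "nat \<Rightarrow> nat \<Rightarrow> bool" and V :: "nat set"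
  assumes supp: "\<And>S. w S \<noteq> 0 \<Longrightarrow> S \<subseteq> vars n"
    and form: "\<And>S. edge_form E (w S)"
    and EV: "\<And>a b. E a b \<Longrightarrow> a \<in> V \<and> b \<in> V"
    and cycle: "\<And>T m. keys m \<subseteq> Xvar ` V \<union> Yvar ` V \<Longrightarrow> lookup (kd n w T) m = 0"
begin

definition nz :: "indet set \<Rightarrow> nat \<Rightarrow> nat \<Rightarrow> bool" where
  "nz S t u \<longleftrightarrow> lookup (w S) (mon (Xvar t) + mon (Yvar u)) \<noteq> 0"

lemma nz_swap: "nz S t u \<Longrightarrow> nz S u t"
  using form[of S] unfolding nz_def edge_form_def by (metis neg_equal_0_iff_equal)

lemma nz_edge: "nz S t u \<Longrightarrow> E t u"
  using form[of S] unfolding nz_def edge_form_def by blast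

lemma nz_V: "nz S t u \<Longrightarrow> t \<in> V \<and> u \<in> V"
  using nz_edge EV by blast

lemma nz_sub: "nz S t u \<Longrightarrow> S \<subseteq> vars n"
  using supp[of S] unfolding nz_def by (metis lookup_zero)

lemma kterm_XX: "kterm n w T v (mon (Xvar a) + mon (Xvar b)) = 0"
  and kterm_YY: "kterm n w T v (mon (Yvar a) + mon (Yvar b)) = 0"
  using form by (auto simp: kterm_def edge_form_def)

lemma kterm_delete:
  assumes "v \<in> S" "S \<subseteq> vars n"
  shows "kterm n w (S - {v}) v r = eps v (S - {v}) * lookup (w S) r"
  using assms by (auto simp: kterm_def insert_absorb)

text \<open>At \<open>S - {Xvar t}\<close> the coefficient of x_t x_t y_u in the boundary has two
  contributions. The one of y_u carries the coefficient of x_t x_t, which is 0 by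
  \<open>form\<close>; so the one of x_t has to vanish as well. The second claim uses x_t y_u y_u in
  the same way.\<close>

lemma nz_notin: assumes nz: "nz S t u" shows "Xvar t \<notin> S" "Yvar u \<notin> S"
proof -
  note S = nz_sub[OF nz] and V = nz_V[OF nz]
  show "Xvar t \<notin> S"
  proof
    assume t: "Xvar t \<in> S"
    have "lookup (kd n w (S - {Xvar t})) (mon (Xvar t) + mon (Xvar t) + mon (Yvar u)) = 0"
      using V by (intro cycle) (auto simp: keys_add_nat)
    then have "kterm n w (S - {Xvar t}) (Xvar t) (mon (Xvar t) + mon (Yvar u)) = 0"
      using S by (subst (asm) lookup_kd_square) (auto simp: kterm_XX)
    then show False
      using nz unfolding kterm_delete[OF t S] nz_def by simp
  qed
  show "Yvar u \<notin> S"
  proof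
    assume u: "Yvar u \<in> S"
    have "lookup (kd n w (S - {Yvar u})) (mon (Yvar u) + mon (Yvar u) + mon (Xvar t)) = 0"
      using V by (intro cycle) (auto simp: keys_add_nat)
    then have "kterm n w (S - {Yvar u}) (Yvar u) (mon (Xvar t) + mon (Yvar u)) = 0"
      using S by (subst (asm) lookup_kd_square) (auto simp: kterm_YY add.commute)
    then show False
      using nz unfolding kterm_delete[OF u S] nz_def by simp
  qed
qed

text \<open>The coefficient of \<open>x\<^sub>p x\<^sub>t y\<^sub>u\<close> (or \<open>y\<^sub>p y\<^sub>t x\<^sub>u\<close>) in the cycle condition has only two terms
  that can be nonzero.\<close>

lemma nz_exchange:
  assumes nz: "nz S t u" and Z: "Z = Xvar \<or> Z = Yvar" and p: "Z p \<in> S" "p \<in> V"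
  shows "nz (insert (Z t) (S - {Z p})) p u"
proof -
  note S = nz_sub[OF nz] and V = nz_V[OF nz]
  note nz' = nz_swap[OF nz]
  let ?T = "S - {Z p}"
  have ptu: "p \<noteq> t" "p \<noteq> u"
    using p Z nz_notin[OF nz] nz_notin[OF nz'] by auto
  have T: "?T \<subseteq> vars n" using S by auto
  from Z show ?thesis
  proof
    assume X: "Z = Xvar"
    have "lookup (kd n w ?T) (mon (Xvar p) + mon (Xvar t) + mon (Yvar u)) = 0"
      using V p by (intro cycle) (auto simp: keys_add_nat)
    then have "eps (Xvar p) ?T * lookup (w S) (mon (Xvar t) + mon (Yvar u)) +
        kterm n w ?T (Xvar t) (mon (Xvar p) + mon (Yvar u)) = 0"
      using T ptu kterm_delete[OF p(1) S] by (subst (asm) lookup_kd_distinct) (auto simp: kterm_XX X)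
    then have "kterm n w ?T (Xvar t) (mon (Xvar p) + mon (Yvar u)) \<noteq> 0"
      using nz by (auto simp: nz_def)
    then show ?thesis
      by (auto simp: nz_def kterm_def X split: if_splits)
  next
    assume Y: "Z = Yvar"
    have "lookup (kd n w ?T) (mon (Yvar p) + mon (Yvar t) + mon (Xvar u)) = 0"
      using V p by (intro cycle) (auto simp: keys_add_nat)
    then have "eps (Yvar p) ?T * lookup (w S) (mon (Yvar t) + mon (Xvar u)) +
        kterm n w ?T (Yvar t) (mon (Yvar p) + mon (Xvar u)) = 0"
      using T ptu kterm_delete[OF p(1) S] by (subst (asm) lookup_kd_distinct) (auto simp: kterm_YY Y)
    then have "kterm n w ?T (Yvar t) (mon (Yvar p) + mon (Xvar u)) \<noteq> 0"
      using nz' by (auto simp: nz_def add.commute)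
    then have "nz (insert (Z t) ?T) u p"
      by (auto simp: nz_def kterm_def Y add.commute split: if_splits)
    then show ?thesis
      by (rule nz_swap)
  qed
qed

lemma nz_adjacent:
  assumes nz: "nz S t u" and Z: "Z = Xvar \<or> Z = Yvar" and p: "Z p \<in> S" "p \<in> V"
  shows "E p t" "E p u"
  using nz_exchange[OF nz Z p] nz_exchange[OF nz_swap[OF nz] Z p] nz_edge by blast+

text \<open>Exchanging an element of \<open>P\<close> into the minor shows that it is adjacent to
  both endpoints. The exchanged minor occurs again with a nonzero coefficient, so the argument can
  be repeated with a second element of \<open>P\<close>.\<close>

lemma nz_clique:
  assumes nz: "nz S t u"
  defines "P \<equiv> {p \<in> V. Xvar p \<in> S \<or> Yvar p \<in> S}"
  shows "t \<notin> P" "u \<notin> P" "E t u" "E u t"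
    and "\<And>p. p \<in> P \<Longrightarrow> E p t \<and> E t p \<and> E p u \<and> E u p"
    and "\<And>p q. p \<in> P \<Longrightarrow> q \<in> P \<Longrightarrow> p \<noteq> q \<Longrightarrow> E p q"
    and "card P = card (S \<inter> (Xvar ` V \<union> Yvar ` V))"
proof -
  show "t \<notin> P" "u \<notin> P"
    using nz_notin[OF nz] nz_notin[OF nz_swap[OF nz]] by (auto simp: P_def)
  show "E t u" "E u t"
    using nz nz_swap nz_edge by blast+
  have P: "\<exists>Z. (Z = Xvar \<or> Z = Yvar) \<and> Z p \<in> S \<and> p \<in> V" if "p \<in> P" for p
    using that by (auto simp: P_def)
  have Esym: "E b a" if "nz S' a b" for S' a b
    using nz_edge[OF nz_swap[OF that]] .
  show "E p t \<and> E t p \<and> E p u \<and> E u p" if "p \<in> P" for p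
  proof -
    obtain Z where Z: "Z = Xvar \<or> Z = Yvar" "Z p \<in> S" "p \<in> V"
      using P[OF \<open>p \<in> P\<close>] by blast
    show ?thesis
      using nz_exchange[OF nz Z] nz_exchange[OF nz_swap[OF nz] Z] nz_edge nz_swap by blast
  qed
  show "E p q" if pq: "p \<in> P" "q \<in> P" "p \<noteq> q" for p q
  proof -
    obtain Z where Z: "Z = Xvar \<or> Z = Yvar" "Z p \<in> S" "p \<in> V"
      using P[OF pq(1)] by blast
    obtain Z' where Z': "Z' = Xvar \<or> Z' = Yvar" "Z' q \<in> S" "q \<in> V"
      using P[OF pq(2)] by blast
    have "Z' q \<in> insert (Z t) (S - {Z p})"
      using Z Z' pq(3) by auto
    from nz_exchange[OF nz_exchange[OF nz Z] Z'(1) this Z'(3)]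
      nz_adjacent[OF nz_exchange[OF nz Z] Z'(1) this Z'(3)]
    have "E q p" by blast
    \<comment> \<open>When \<open>q\<close> has been moved into the minor, \<open>p\<close> is still
      in the index set and hence adjacent to the new endpoint \<open>q\<close>.\<close>
    have "Z p \<in> insert (Z' t) (S - {Z' q})"
      using Z Z' pq(3) by auto
    from nz_adjacent[OF nz_exchange[OF nz Z'] Z(1) this Z(3)] show ?thesis
      by blast
  qed
  \<comment> \<open>Exchanging x_p would give a nonzero minor on \<open>p\<close> while y_p is still
    in the index set, contrary to \<open>nz_notin\<close>. Hence each vertex of \<open>P\<close>
    accounts for exactly one element of \<open>S\<close>.\<close>
  have "\<not> (Xvar p \<in> S \<and> Yvar p \<in> S)" if p: "p \<in> V" for p
  proof
    assume pp: "Xvar p \<in> S \<and> Yvar p \<in> S"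
    then have "nz (insert (Xvar t) (S - {Xvar p})) p u"
      using p by (intro nz_exchange[OF nz]) auto
    from nz_notin[OF nz_swap[OF this]] pp show False
      by auto
  qed
  then have "bij_betw (\<lambda>p. if Xvar p \<in> S then Xvar p else Yvar p) P (S \<inter> (Xvar ` V \<union> Yvar ` V))"
    by (intro bij_betw_imageI) (auto simp: inj_on_def P_def image_iff split: if_splits)
  then show "card P = card (S \<inter> (Xvar ` V \<union> Yvar ` V))"
    by (rule bij_betw_same_card)
qed

end

section \<open>The two parts of the partition\<close>

lemma binomial_edge_ideal_alt: "binomial_edge_ideal n H = ideal_gen n (edge_minors (edges H))"
  by (simp add: binomial_edge_ideal_def edge_minors_def minor_def)

lemma simple_graph_edge:
  assumes "simple_graph G" "{a, b} \<in> edges G"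
  shows "a \<noteq> b" "a \<in> verts G" "b \<in> verts G"
  using assms by (auto simp: simple_graph_def card_insert_if split: if_splits)

lemma hgens_edge_minors:
  assumes "\<And>e. e \<in> E \<Longrightarrow> e \<subseteq> {1..n}"
  shows "hgens n (edge_minors E)"
  using assms homogeneous_minor by (fastforce simp: hgens_def edge_minors_def intro!: minor_polyring)

locale vertex_partition =
  fixes G :: graph and n s :: nat and J1 J2 :: "'k::field mpoly set"
  assumes graph: "simple_graph G" "verts G = {1..n}" and s: "s \<in> {1..n}"
    and J1: "J1 = binomial_edge_ideal n (star_at G s)"
    and J2: "J2 = binomial_edge_ideal n (delete_vertex G s)"
begin

abbreviation "N \<equiv> neighbours G s"

lemma N: "N \<subseteq> {1..n}" "s \<notin> N"
proof -
  have "t \<in> {1..n} \<and> t \<noteq> s" if "t \<in> N" for t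
  proof -
    have "{s, t} \<in> edges G"
      using that by (simp add: neighbours_def)
    from simple_graph_edge[OF graph(1) this] show ?thesis
      using graph(2) by simp
  qed
  then show "N \<subseteq> {1..n}" "s \<notin> N"
    by blast+
qed

lemma edges_sub: "e \<in> edges G \<Longrightarrow> e \<subseteq> {1..n}"
  using graph by (auto simp: simple_graph_def)

lemma gens2: "hgens n (edge_minors (edges (delete_vertex G s)) :: 'k mpoly set)"
  using edges_sub by (intro hgens_edge_minors) (auto simp: delete_vertex_def)

lemma gens1: "hgens n (star_minors s N :: 'k mpoly set)"
  by (rule hgens_star_minors[OF s N(1)])

lemma J2_alt: "J2 = ideal_gen n (edge_minors (edges (delete_vertex G s)))"
  by (simp add: J2 binomial_edge_ideal_alt)

lemma J1_alt: "J1 = ideal_gen n (star_minors s N)"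
  unfolding J1 binomial_edge_ideal_alt
proof (rule ideal_gen_eqI)
  show "hgens n (edge_minors (edges (star_at G s)) :: 'k mpoly set)"
    using N s by (intro hgens_edge_minors) (auto simp: star_at_def)
  show "hgens n (star_minors s N :: 'k mpoly set)"
    by (rule gens1)
  show "edge_minors (edges (star_at G s)) \<subseteq> (ideal_gen n (star_minors s N) :: 'k mpoly set)"
  proof
    fix f :: "'k mpoly" assume "f \<in> edge_minors (edges (star_at G s))"
    then obtain t where t: "t \<in> N" "f = minor s t \<or> f = minor t s"
      by (auto simp: edge_minors_def star_at_def doubleton_eq_iff)
    then have "minor s t \<in> ideal_gen n (star_minors s N)"
      by (intro ideal_gen_base) (auto simp: star_minors_def)
    then show "f \<in> ideal_gen n (star_minors s N)"
      using t ideal_uminus[OF hgens_ideal[OF gens1]] by (metis minor_swap)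
  qed
  show "star_minors s N \<subseteq> (ideal_gen n (edge_minors (edges (star_at G s))) :: 'k mpoly set)"
    by (auto simp: star_minors_def edge_minors_def star_at_def intro!: ideal_gen_base)
qed

lemma graded: "graded_ideal n J1" "graded_ideal n J2"
  using gens1 gens2 by (simp_all add: J1_alt J2_alt hgens_graded)

lemma ideals: "is_ideal n J1" "is_ideal n J2"
  using graded by (simp_all add: graded_ideal_def)

lemma svars: "Xvar s \<in> vars n" "Yvar s \<in> vars n"
  using s by (auto intro: vars_XY)

lemma J1_keys: "p \<in> J1 \<Longrightarrow> m \<in> keys p \<Longrightarrow> keys m \<inter> {Xvar s, Yvar s} \<noteq> {}"
  using star_minors_sub_vars[OF s N(1)] svars
  by (intro keys_in_vars_ideal[of "{Xvar s, Yvar s}" n p]) (auto simp: J1_alt)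

lemma J2_divar_closed: "v \<in> {Xvar s, Yvar s} \<Longrightarrow> divar_closed v J2"
  unfolding J2_alt
  by (rule divar_closed_free[OF gens2])
    (auto simp: edge_minors_def delete_vertex_def intro!: divar_minor)

lemma Int_chain_boundary:
  assumes "\<omega> \<in> chain n (J1 \<inter> J2) i j" "kd n \<omega> = 0"
  shows "kH [Xvar s, Yvar s] \<omega> \<in> chain n J2 (i + 1) j" "kd n (kH [Xvar s, Yvar s] \<omega>) = \<omega>"
proof -
  have 1: "set [Xvar s, Yvar s] \<subseteq> vars n"
    using svars by simp
  have 2: "divar_closed v J2" if "v \<in> set [Xvar s, Yvar s]" for v
    using J2_divar_closed that by simp
  have 3: "keys m \<inter> set [Xvar s, Yvar s] \<noteq> {}" if "p \<in> J1 \<inter> J2" "m \<in> keys p" for p m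
    using J1_keys[of p m] that by auto
  show "kH [Xvar s, Yvar s] \<omega> \<in> chain n J2 (i + 1) j"
    by (rule exact_in_divar_closed(1)[OF Int_lower2 ideals(2) 2 1 3 assms])
  show "kd n (kH [Xvar s, Yvar s] \<omega>) = \<omega>"
    by (rule exact_in_divar_closed(2)[OF Int_lower2 ideals(2) 2 1 3 assms])
qed

theorem exact_J2: "exact_in n (J1 \<inter> J2) J2 i j"
  unfolding exact_in_def using Int_chain_boundary by blast

text \<open>Up to sign the coefficients of the contraction are sums of quotients by x_s and by y_s
  of parts of coefficients of \<open>\<omega>\<close>. Membership in \<open>J1\<close> confines one
  endpoint of each pair to \<open>N\<close>; membership in \<open>J2\<close> makes the coefficients
  antisymmetric and so confines the other endpoint too.\<close>

lemma kH_edge_form: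
  assumes \<omega>: "\<omega> \<in> chain n (J1 \<inter> J2) i j" "kd n \<omega> = 0"
  shows "edge_form (\<lambda>a b. {a, b} \<in> edges G \<and> a \<in> N \<and> b \<in> N) (kH [Xvar s, Yvar s] \<omega> S)"
    (is "edge_form ?E (?w S)")
proof -
  let ?E' = "edges (delete_vertex G s)"
  have sub: "edge_minors ?E' \<subseteq> (polyring n :: 'k mpoly set)"
    using gens2 by (simp add: hgens_def)
  have sub1: "star_minors s N \<subseteq> (polyring n :: 'k mpoly set)"
    using gens1 by (simp add: hgens_def)
  have form: "edge_form (\<lambda>a b. {a, b} \<in> ?E') p" if "p \<in> J2" for p
    using that edge_form_edge_ideal[OF sub] by (simp add: J2_alt)
  have wS: "?w S \<in> J2"
    by (rule chainD(1)[OF Int_chain_boundary(1)[OF \<omega>]])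
  define c where "c p a b = lookup p (mon (Xvar a) + mon (Yvar b))" for p :: "'k mpoly" and a b
  have J1c: "lookup p (mon (Xvar s) + (mon (Xvar t) + mon (Yvar u))) = 0" if "p \<in> J1" "u \<notin> N" "t \<noteq> s" "u \<noteq> s" for p t u
    using that lookup_star_ideal(1)[OF sub1] by (simp add: J1_alt)
  have J1c': "lookup p (mon (Yvar s) + (mon (Xvar t) + mon (Yvar u))) = 0" if "p \<in> J1" "t \<notin> N" "t \<noteq> s" "u \<noteq> s" for p t u
    using that lookup_star_ideal(2)[OF sub1] by (simp add: J1_alt)
  have J12: "\<omega> T \<in> J1" "\<omega> T \<in> J2" for T
    using chainD(1)[OF \<omega>(1)] by auto
  have anti: "c p a b = - c p b a" if "p \<in> J2" for p a b
    using form[OF that] unfolding edge_form_def c_def by blast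
  have divX: "c (divar (Xvar s) (\<omega> T)) t u = 0" if "t \<notin> N \<or> u \<notin> N" "t \<noteq> s" "u \<noteq> s" for T t u
  proof -
    have "c (divar (Xvar s) (\<omega> T)) t u = 0" if "u \<notin> N" "t \<noteq> s" "u \<noteq> s" for t u
      using J1c[OF J12(1) that] by (simp add: c_def lookup_divar)
    moreover have "divar (Xvar s) (\<omega> T) \<in> J2"
      using J2_divar_closed J12(2) by (auto simp: divar_closed_def)
    ultimately show ?thesis
      using that anti by (metis neg_equal_0_iff_equal)
  qed
  have divY: "c (divar (Yvar s) (kpi (Xvar s) \<omega> T)) t u = 0" if "t \<notin> N \<or> u \<notin> N" "t \<noteq> s" "u \<noteq> s" for T t u
  proof -
    have "c (divar (Yvar s) (kpi (Xvar s) \<omega> T)) t u = 0" if "t \<notin> N" "t \<noteq> s" "u \<noteq> s" for t u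
      using J1c'[OF J12(1) that] by (simp add: c_def lookup_divar lookup_kpi)
    moreover have "divar (Yvar s) (kpi (Xvar s) \<omega> T) \<in> J2"
    proof -
      have "\<omega> \<in> chain n J2 i j"
        using \<omega>(1) chain_mono[of "J1 \<inter> J2" J2 n i j] by auto
      then have "kpi (Xvar s) \<omega> \<in> chain n J2 i j"
        using ideals(2) J2_divar_closed svars by (intro kpi_chain) auto
      from chainD(1)[OF this] show ?thesis
        using J2_divar_closed by (simp add: divar_closed_def)
    qed
    ultimately show ?thesis
      using that anti by (metis neg_equal_0_iff_equal)
  qed
  have c_sg: "c (sg v T * p) t u = eps v T * c p t u" for v T p t u
    by (simp add: c_def lookup_sg_mult)
  have c_add: "c (p + q) t u = c p t u + c q t u" for p q t u
    by (simp add: c_def lookup_add)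
  have c0: "c 0 t u = 0" for t u
    by (simp add: c_def)
  have zero: "c (?w S) t u = 0" if "t \<notin> N \<or> u \<notin> N" "t \<noteq> s" "u \<noteq> s" for t u
    using divX[OF that] divY[OF that]
    by (simp add: kh_def c_add c0 c_sg)
  have "?E t u" if "c (?w S) t u \<noteq> 0" for t u
  proof -
    have "{t, u} \<in> ?E'"
      using form[OF wS] that unfolding edge_form_def c_def by blast
    then have "{t, u} \<in> edges G" "t \<noteq> s" "u \<noteq> s"
      by (auto simp: delete_vertex_def)
    with zero that show ?thesis by blast
  qed
  then show ?thesis
    using form[OF wS] unfolding edge_form_def c_def by blast
qed

lemma clique_size_ge:
  assumes "clique G C" "s \<in> C"
  shows "card C \<le> clique_size_at G s"
proof -
  have "{card C |C. clique G C \<and> s \<in> C} \<subseteq> {..n}"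
    using graph(2) card_mono[of "{1..n}"] by (fastforce simp: clique_def)
  then have "finite {card C |C. clique G C \<and> s \<in> C}"
    using finite_subset by blast
  then show ?thesis
    using assms unfolding clique_size_at_def by (intro Max_ge) auto
qed

lemma linear_strand_vanishes:
  assumes i: "i \<ge> int (clique_size_at G s) - 1" and j: "j \<le> i + 3"
    and \<omega>: "\<omega> \<in> chain n (J1 \<inter> J2) i j" "kd n \<omega> = 0"
  shows "\<omega> = 0"
proof -
  define w where "w = kH [Xvar s, Yvar s] \<omega>"
  have w: "w \<in> chain n J2 (i + 1) j" "kd n w = \<omega>"
    unfolding w_def by (rule Int_chain_boundary[OF \<omega>])+
  let ?E = "\<lambda>a b. {a, b} \<in> edges G \<and> a \<in> N \<and> b \<in> N"
  let ?V = "{1..n} - {s}"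
  have sub: "edge_minors (edges (delete_vertex G s)) \<subseteq> (polyring n :: 'k mpoly set)"
    using gens2 by (simp add: hgens_def)
  have form: "edge_form ?E (w S)" for S
    unfolding w_def by (rule kH_edge_form[OF \<omega>])
  have supp: "w S \<noteq> 0 \<Longrightarrow> S \<subseteq> vars n" for S
    by (rule chainD(2)[OF w(1)])
  have EV: "?E a b \<Longrightarrow> a \<in> ?V \<and> b \<in> ?V" for a b
    using N by auto
  have cycle: "lookup (kd n w T) m = 0" if m: "keys m \<subseteq> Xvar ` ?V \<union> Yvar ` ?V" for T m
  proof (rule ccontr)
    assume "lookup (kd n w T) m \<noteq> 0"
    then have "m \<in> keys (\<omega> T)"
      by (simp add: w(2) in_keys_iff)
    moreover have "\<omega> T \<in> J1"
      using chainD(1)[OF \<omega>(1)] by blast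
    ultimately have "keys m \<inter> {Xvar s, Yvar s} \<noteq> {}"
      by (rule J1_keys[rotated])
    with m show False by auto
  qed
  have no_nz: "lookup (w S) (mon (Xvar t) + mon (Yvar u)) = 0" for S t u
  proof (rule ccontr)
    assume nz: "\<not> ?thesis"
    then have "w S \<noteq> 0" by auto
    then have S: "S \<subseteq> vars n" "int (card S) = i + 1"
      using chainD(2,3)[OF w(1)] by auto
    define P where "P = {p \<in> ?V. Xvar p \<in> S \<or> Yvar p \<in> S}"
    interpret linear_strand_cycle n w ?E ?V
      by (rule linear_strand_cycle.intro[OF supp form EV cycle])
    have "nz S t u"
      using nz by (simp add: nz_def)
    note cl = nz_clique[OF this, folded P_def]
    let ?C = "insert s (insert t (insert u P))"
    have tuN: "t \<in> N" "u \<in> N" "{t, u} \<in> edges G"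
      using cl(3) by auto
    have PN: "p \<in> N" if "p \<in> P" for p
      using cl(5)[OF that] by auto
    have fin: "finite P" by (simp add: P_def)
    have "clique G ?C"
      unfolding clique_def
    proof (intro conjI ballI impI)
      show "?C \<subseteq> verts G"
        using s tuN N graph(2) by (auto simp: P_def)
      have sN: "{s, p} \<in> edges G" "{p, s} \<in> edges G" if "p \<in> N" for p
        using that by (auto simp: neighbours_def insert_commute)
      fix a b assume ab: "a \<in> ?C" "b \<in> ?C" "a \<noteq> b"
      then consider "a = s" "b \<in> N" | "b = s" "a \<in> N" | "a \<in> {t, u}" "b \<in> {t, u}"
        | "a \<in> {t, u}" "b \<in> P" | "a \<in> P" "b \<in> {t, u}" | "a \<in> P" "b \<in> P"
        using tuN PN by blast
      then show "{a, b} \<in> edges G"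
      proof cases
        case 1
        then show ?thesis using sN(1) by simp
      next
        case 2
        then show ?thesis using sN(2) by simp
      next
        case 3
        then show ?thesis using ab(3) tuN(3) by (auto simp: insert_commute)
      next
        case 4
        then show ?thesis using cl(5)[of b] by auto
      next
        case 5
        then show ?thesis using cl(5)[of a] by auto
      next
        case 6
        then show ?thesis using cl(6)[of a b] ab(3) by auto
      qed
    qed
    then have "card ?C \<le> clique_size_at G s"
      by (rule clique_size_ge) simp
    moreover have "card ?C = card P + 3"
    proof -
      have "t \<noteq> u"
        using simple_graph_edge(1)[OF graph(1) tuN(3)] .
      moreover have "s \<notin> insert t (insert u P)"
        using tuN PN N by auto
      ultimately show ?thesis
        using fin cl(1,2) by simp
    qed
    \<comment> \<open>\<open>S\<close> has \<open>i + 1\<close> elements, and only x_s and y_s do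
      not belong to vertices of \<open>P\<close>. So \<open>card P \<ge> i - 1\<close>, and the
      clique has at least \<open>i + 2\<close> vertices, more than
      \<open>clique_size_at G s\<close>.\<close>
    moreover have "card S \<le> card P + 2"
    proof -
      have "S \<subseteq> (S \<inter> (Xvar ` ?V \<union> Yvar ` ?V)) \<union> {Xvar s, Yvar s}"
        using S(1) by (auto simp: vars_def)
      then have "card S \<le> card ((S \<inter> (Xvar ` ?V \<union> Yvar ` ?V)) \<union> {Xvar s, Yvar s})"
        by (intro card_mono) auto
      also have "\<dots> \<le> card (S \<inter> (Xvar ` ?V \<union> Yvar ` ?V)) + card {Xvar s, Yvar s}"
        by (rule card_Un_le)
      also have "\<dots> \<le> card P + 2"
        using cl(7) by (simp add: card_insert_if)
      finally show ?thesis .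
    qed
    ultimately show False
      using S(2) i by linarith
  qed
  have "w S = 0" for S
  proof (rule poly_mapping_eqI)
    fix m
    have "lookup (w S) m = 0"
    proof (rule ccontr)
      assume nz: "lookup (w S) m \<noteq> 0"
      \<comment> \<open>Here \<open>j \<le> i + 3\<close> enters: the coefficients of
        \<open>w\<close> have degree at most 2, and as elements of \<open>J2\<close> they have no
        terms of degree below 2.\<close>
      then have "int (mdeg m) = j - (i + 1)"
        using chainD(4)[OF w(1), of S] by (simp add: homogeneous_iff)
      moreover have "\<not> mdeg m < 2"
        using low_degree_edge_ideal[OF sub, of "w S" m] chainD(1)[OF w(1), of S] nz by (auto simp: J2_alt)
      ultimately have "mdeg m = 2"
        using j by linarith
      then obtain u v where uv: "m = mon u + mon v"
        by (rule mdeg_2E)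
      have XX: "lookup (w S) (mon (Xvar a) + mon (Xvar b)) = 0" "lookup (w S) (mon (Yvar a) + mon (Yvar b)) = 0" for a b
        using form[of S] by (simp_all add: edge_form_def)
      show False
        using nz XX no_nz no_nz[unfolded add.commute[of "mon (Xvar _)" "mon (Yvar _)"]] unfolding uv
        by (cases u; cases v) auto
    qed
    then show "lookup (w S) m = lookup 0 m" by simp
  qed
  then have "w = 0" by (intro ext) simp
  then show ?thesis
    using w(2) kd_0[of n] by simp
qed

text \<open>The bound is one less than the clique size because the statement is applied in the
  homological degrees \<open>i\<close> and \<open>i - 1\<close>. For \<open>j \<ge> i + 4\<close>
  the regularity of \<open>J1\<close> gives the claim; below, the only cycle is 0.\<close>

theorem exact_J1:
  assumes "i \<ge> int (clique_size_at G s) - 1 \<or> j \<ge> i + 4"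
  shows "exact_in n (J1 \<inter> J2) J1 i j"
proof (cases "j \<ge> i + 4")
  case True
  then have "exact_in n J1 J1 i j"
    using reg_star_minors[OF s N(2,1), where 'k = 'k] by (simp add: reg_le_def J1_alt)
  then show ?thesis
    by (rule exact_in_mono) simp
next
  case False
  have "\<exists>\<eta>\<in>chain n J1 (i + 1) j. kd n \<eta> = \<omega>" if "\<omega> \<in> chain n (J1 \<inter> J2) i j" "kd n \<omega> = 0" for \<omega>
  proof -
    have ij: "int (clique_size_at G s) - 1 \<le> i" "j \<le> i + 3"
      using assms False by linarith+
    have "\<omega> = 0"
      by (rule linear_strand_vanishes[OF ij that])
    then have "kd n 0 = \<omega>"
      by (simp only: kd_0)
    then show ?thesis
      using chain_0[OF ideal_0[OF ideals(1)]] by blast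
  qed
  then show ?thesis
    by (simp add: exact_in_def)
qed

end

section \<open>Comparison of resolutions\<close>

text \<open>A homomorphism of free modules, given by the images \<open>r a\<close> of the first
  \<open>m\<close> basis elements. The same formula describes its action on vectors with entries in
  an ideal, that is, after tensoring.\<close>

definition lapp :: "nat \<Rightarrow> (nat \<Rightarrow> nat \<Rightarrow> 'k::field mpoly) \<Rightarrow> (nat \<Rightarrow> 'k mpoly) \<Rightarrow> nat \<Rightarrow> 'k mpoly" where
  "lapp m r v b = (\<Sum>a<m. v a * r a b)"

definition unit_vec :: "nat \<Rightarrow> nat \<Rightarrow> 'k::field mpoly" where
  "unit_vec a b = (if b = a then 1 else 0)"

text \<open>The entries of \<open>mat\<close> beyond the rank of the target are arbitrary; cutting
  them off makes the rows vectors of the target module.\<close>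

definition bd_row :: "'k::field free_complex \<Rightarrow> nat \<Rightarrow> nat \<Rightarrow> nat \<Rightarrow> 'k mpoly" where
  "bd_row F i a b = (if b < rk F i then mat F i a b else 0)"

lemma bd_lapp: "bd F i v = lapp (rk F (Suc i)) (bd_row F i) v"
  by (rule ext) (simp add: bd_def lapp_def bd_row_def)

lemma lapp_lapp: "lapp m r (lapp m' q v) = lapp m' (\<lambda>a. lapp m r (q a)) v"
  by (rule ext) (simp add: lapp_def sum_distrib_left sum_distrib_right mult.assoc sum.swap[of _ "{..<m}"])

lemma lapp_cong: "(\<And>a. a < m \<Longrightarrow> r a = r' a) \<Longrightarrow> lapp m r v = lapp m r' v"
  by (rule ext) (simp add: lapp_def)

lemma lapp_0 [simp]: "lapp m r 0 = 0"
  by (rule ext) (simp add: lapp_def)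

lemma lapp_diff: "lapp m r (u - v) = lapp m r u - lapp m r v"
  by (rule ext) (simp add: lapp_def algebra_simps sum_subtractf)

lemma lapp_add: "lapp m r (u + v) = lapp m r u + lapp m r v"
  by (rule ext) (simp add: lapp_def algebra_simps sum.distrib)

lemma lapp_diff_rows: "lapp m (\<lambda>a. r a - q a) v = lapp m r v - lapp m q v"
  by (rule ext) (simp add: lapp_def algebra_simps sum_subtractf)

lemma bd_diff: "bd F i (u - v) = bd F i u - bd F i v"
  by (simp only: bd_lapp lapp_diff)

lemma bd_add: "bd F i (u + v) = bd F i u + bd F i v"
  by (simp only: bd_lapp lapp_add)

lemma lapp_unit: "a < m \<Longrightarrow> lapp m r (unit_vec a) = r a"
  by (rule ext) (simp add: lapp_def unit_vec_def if_distrib[of "\<lambda>x. x * _"] cong: if_cong)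

lemma lapp_unit_rows: "(\<And>a. a \<ge> m \<Longrightarrow> v a = 0) \<Longrightarrow> lapp m unit_vec v = v"
  by (rule ext) (auto simp: lapp_def unit_vec_def if_distrib cong: if_cong)

lemma bd_unit: "a < rk F (Suc i) \<Longrightarrow> bd F i (unit_vec a) = bd_row F i a"
  by (simp only: bd_lapp lapp_unit)

lemma lookup_mult_0: "lookup (p * q) 0 = lookup p 0 * lookup q 0"
  for p q :: "'k::field mpoly"
proof -
  have single: "lookup (single a c * q) 0 = (if a = 0 then c * lookup q 0 else 0)" for a c
  proof (cases "a = 0")
    case True
    then show ?thesis using lookup_single_mult_add[of 0 c q 0] by simp
  next
    case False
    then have "0 \<noteq> a + b" for b
      by (metis add_is_0 mdeg_0 mdeg_add mdeg_eq_0)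
    with False show ?thesis
      by (simp add: lookup_single_mult_not)
  qed
  have "lookup (p * q) 0 = (\<Sum>m\<in>keys p. lookup (single m (lookup p m) * q) 0)"
    by (subst poly_decomp[of p]) (simp add: sum_distrib_right lookup_sum)
  also have "\<dots> = lookup p 0 * lookup q 0"
    by (simp add: single in_keys_iff)
  finally show ?thesis .
qed

lemma augmentation_lapp:
  "augmentation F (lapp m r v) = (\<Sum>a<m. lookup (v a) 0 * augmentation F (r a))"
  by (simp add: augmentation_def lapp_def lookup_sum lookup_mult_0 sum_distrib_left sum_distrib_right
      mult.assoc sum.swap[of _ "{..<m}"])

lemma augmentation_diff: "augmentation F (u - v) = augmentation F u - augmentation F v"
  by (simp add: augmentation_def lookup_minus algebra_simps sum_subtractf)

lemma augmentation_unit: "a < rk F 0 \<Longrightarrow> augmentation F (unit_vec a) = aug F a"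
  by (simp add: augmentation_def unit_vec_def if_distrib[of "\<lambda>x. lookup x 0 * _"] cong: if_cong)

lemma tensorD:
  assumes "v \<in> tensor F L i"
  shows "a < rk F i \<Longrightarrow> v a \<in> L" "a \<ge> rk F i \<Longrightarrow> v a = 0"
  using assms by (auto simp: tensor_def)

lemma graded_tensorD:
  assumes "v \<in> graded_tensor F L i j"
  shows "v \<in> tensor F L i" "a < rk F i \<Longrightarrow> homogeneous (j - shift F i a) (v a)"
  using assms by (auto simp: graded_tensor_def)

lemma graded_tensor_mono: "A \<subseteq> B \<Longrightarrow> graded_tensor F A i j \<subseteq> graded_tensor F B i j"
  by (auto simp: graded_tensor_def tensor_def)

lemma graded_tensor_0: "0 \<in> L \<Longrightarrow> 0 \<in> graded_tensor F L i j"
  by (simp add: graded_tensor_def tensor_def)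

lemma graded_tensor_diff:
  "is_ideal n L \<Longrightarrow> u \<in> graded_tensor F L i j \<Longrightarrow> v \<in> graded_tensor F L i j \<Longrightarrow> u - v \<in> graded_tensor F L i j"
  by (simp add: graded_tensor_def tensor_def ideal_diff homogeneous_diff)

lemma graded_tensor_add:
  "is_ideal n L \<Longrightarrow> u \<in> graded_tensor F L i j \<Longrightarrow> v \<in> graded_tensor F L i j \<Longrightarrow> u + v \<in> graded_tensor F L i j"
  by (simp add: graded_tensor_def tensor_def ideal_add homogeneous_add)

text \<open>The image of a basis element has the degree of that element, so the map has degree 0.
  The two homological degrees are independent, which covers chain maps as well as differentials and
  homotopies.\<close>

definition graded_map :: "nat \<Rightarrow> 'k::field free_complex \<Rightarrow> nat \<Rightarrow> 'k free_complex \<Rightarrow> nat \<Rightarrow> (nat \<Rightarrow> nat \<Rightarrow> 'k mpoly) \<Rightarrow> bool" where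
  "graded_map n F i G k r \<longleftrightarrow> (\<forall>a<rk F i. r a \<in> graded_tensor G (polyring n) k (shift F i a))"

lemma lapp_tensor:
  assumes r: "graded_map n F i G k r" and L: "is_ideal n L" and v: "v \<in> tensor F L i"
  shows "lapp (rk F i) r v \<in> tensor G L k"
proof -
  have r': "r a \<in> tensor G (polyring n) k" if "a < rk F i" for a
    using r that by (auto simp: graded_map_def graded_tensor_def)
  have "lapp (rk F i) r v b \<in> L" if "b < rk G k" for b
    unfolding lapp_def
    using tensorD(1)[OF v] tensorD(1)[OF r' that] by (auto intro!: ideal_sum_mem[OF L] ideal_mult_right[OF L])
  moreover have "lapp (rk F i) r v b = 0" if "b \<ge> rk G k" for b
    unfolding lapp_def using tensorD(2)[OF r' that] by simp
  ultimately show ?thesis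
    by (simp add: tensor_def)
qed

lemma lapp_graded:
  assumes r: "graded_map n F i G k r" and L: "is_ideal n L" and v: "v \<in> graded_tensor F L i j"
  shows "lapp (rk F i) r v \<in> graded_tensor G L k j"
proof -
  have "homogeneous (j - shift G k b) (lapp (rk F i) r v b)" if b: "b < rk G k" for b
    unfolding lapp_def
  proof (rule homogeneous_sum)
    fix a assume "a \<in> {..<rk F i}"
    then have a: "a < rk F i" by simp
    then have "homogeneous (shift F i a - shift G k b) (r a b)"
      using r b unfolding graded_map_def graded_tensor_def by blast
    with graded_tensorD(2)[OF v a] show "homogeneous (j - shift G k b) (v a * r a b)"
      by (rule homogeneous_mult') simp
  qed
  then show ?thesis
    using lapp_tensor[OF r L graded_tensorD(1)[OF v]] by (simp add: graded_tensor_def)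
qed

lemma graded_map_bd: "graded_free_complex n F \<Longrightarrow> graded_map n F (Suc i) F i (bd_row F i)"
  by (simp add: graded_map_def graded_tensor_def tensor_def bd_row_def graded_free_complex_def)

lemma graded_map_unit: "graded_map n F i F i unit_vec"
  by (auto simp: graded_map_def graded_tensor_def tensor_def unit_vec_def)

definition vec_comp :: "'k::field free_complex \<Rightarrow> nat \<Rightarrow> int \<Rightarrow> (nat \<Rightarrow> 'k mpoly) \<Rightarrow> nat \<Rightarrow> 'k mpoly" where
  "vec_comp F i d v b = (if b < rk F i then hom_comp (d - shift F i b) (v b) else 0)"

lemma vec_comp_graded: "v \<in> tensor F (polyring n) i \<Longrightarrow> vec_comp F i d v \<in> graded_tensor F (polyring n) i d"
  by (simp add: graded_tensor_def tensor_def vec_comp_def hom_comp_polyring)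

lemma vec_comp_id: "v \<in> graded_tensor F L i d \<Longrightarrow> vec_comp F i d v = v"
  by (rule ext) (auto simp: vec_comp_def graded_tensor_def tensor_def hom_comp_homogeneous)

lemma bd_vec_comp:
  assumes "graded_free_complex n F"
  shows "bd F i (vec_comp F (Suc i) d v) = vec_comp F i d (bd F i v)"
proof
  fix b
  show "bd F i (vec_comp F (Suc i) d v) b = vec_comp F i d (bd F i v) b"
  proof (cases "b < rk F i")
    case True
    have "hom_comp (d - shift F i b) (v a * mat F i a b) =
        hom_comp (d - shift F (Suc i) a) (v a) * mat F i a b" if "a < rk F (Suc i)" for a
      using assms True that hom_comp_mult[of "shift F (Suc i) a - shift F i b" "mat F i a b" "d - shift F i b" "v a"]
      by (simp add: graded_free_complex_def mult.commute)
    then show ?thesis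
      using True by (simp add: bd_def vec_comp_def hom_comp_sum)
  qed (simp add: bd_def vec_comp_def)
qed

text \<open>Cycles of the complex augmented by \<open>k\<close>, hence in degree 0 the kernel of the
  augmentation. The complex for Tor has no augmentation, which is why conditions on its cycles carry
  the alternative \<open>i = 0\<close>.\<close>

definition cycle :: "'k::field free_complex \<Rightarrow> nat \<Rightarrow> (nat \<Rightarrow> 'k mpoly) \<Rightarrow> bool" where
  "cycle F i v \<longleftrightarrow> (case i of 0 \<Rightarrow> augmentation F v = 0 | Suc k \<Rightarrow> bd F k v = 0)"

lemma cycle_simps [simp]:
  "cycle F 0 v \<longleftrightarrow> augmentation F v = 0" "cycle F (Suc k) v \<longleftrightarrow> bd F k v = 0"
  by (simp_all add: cycle_def)

section \<open>Lifting maps between graded resolutions\<close>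

lemma resolution_exact:
  assumes "residue_field_resolution n F"
  shows "{v \<in> tensor F (polyring n) i. cycle F i v} = bd F i ` tensor F (polyring n) (Suc i)"
  using assms by (cases i) (simp_all add: residue_field_resolution_def)

lemma resolution_graded: "residue_field_resolution n F \<Longrightarrow> graded_free_complex n F"
  by (simp add: residue_field_resolution_def)

text \<open>Exactness gives some preimage; its component of degree \<open>d\<close> is a preimage as
  well, since the differential preserves degrees.\<close>

lemma graded_lift:
  assumes F: "residue_field_resolution n F" and u: "u \<in> graded_tensor F (polyring n) i d" "cycle F i u"
  shows "\<exists>w\<in>graded_tensor F (polyring n) (Suc i) d. bd F i w = u"
proof -
  have "u \<in> {v \<in> tensor F (polyring n) i. cycle F i v}"
    using u(2) graded_tensorD(1)[OF u(1)] by simp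
  then obtain w where w: "w \<in> tensor F (polyring n) (Suc i)" "bd F i w = u"
    unfolding resolution_exact[OF F] by (elim imageE) simp
  have "bd F i (vec_comp F (Suc i) d w) = u"
    using bd_vec_comp[OF resolution_graded[OF F]] w(2) vec_comp_id[OF u(1)] by simp
  then show ?thesis
    using vec_comp_graded[OF w(1)] by blast
qed

lemma cycle_bd_row:
  assumes F: "residue_field_resolution n F" and a: "a < rk F (Suc i)"
  shows "cycle F i (bd_row F i a)" "bd_row F i a \<in> graded_tensor F (polyring n) i (shift F (Suc i) a)"
proof -
  have "unit_vec a \<in> tensor F (polyring n) (Suc i)"
    using a by (auto simp: tensor_def unit_vec_def)
  then have "bd F i (unit_vec a) \<in> {v \<in> tensor F (polyring n) i. cycle F i v}"
    unfolding resolution_exact[OF F] by blast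
  then show "cycle F i (bd_row F i a)"
    by (simp add: bd_unit[OF a])
  show "bd_row F i a \<in> graded_tensor F (polyring n) i (shift F (Suc i) a)"
    using graded_map_bd[OF resolution_graded[OF F]] a by (simp add: graded_map_def)
qed

lemma lift_augmentation:
  assumes F: "residue_field_resolution n F" and G: "residue_field_resolution n G"
  shows "\<exists>\<phi>. graded_map n F 0 G 0 \<phi> \<and> (\<forall>v. augmentation G (lapp (rk F 0) \<phi> v) = augmentation F v)"
proof -
  have "\<exists>u\<in>graded_tensor G (polyring n) 0 (shift F 0 a). augmentation G u = aug F a" if a: "a < rk F 0" for a
  proof (cases "aug F a = 0")
    case True
    then show ?thesis
      using graded_tensor_0[OF polyring_0] by (intro bexI[of _ 0]) (auto simp: augmentation_def)
  next
    case False
    then have sh: "shift F 0 a = 0"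
      using resolution_graded[OF F] a by (simp add: graded_free_complex_def)
    have "augmentation G ` tensor G (polyring n) 0 = UNIV"
      using G by (simp add: residue_field_resolution_def)
    then obtain u where u: "u \<in> tensor G (polyring n) 0" "augmentation G u = aug F a"
      by (metis UNIV_I image_iff)
    \<comment> \<open>Only basis elements of degree 0 have a nonzero augmentation, so passing to the
      degree 0 component keeps the value.\<close>
    have "augmentation G (vec_comp G 0 0 u) = augmentation G u"
      unfolding augmentation_def
    proof (rule sum.cong)
      fix b assume "b \<in> {..<rk G 0}"
      then show "lookup (vec_comp G 0 0 u b) 0 * aug G b = lookup (u b) 0 * aug G b"
        using resolution_graded[OF G]
        by (cases "aug G b = 0") (simp_all add: vec_comp_def lookup_hom_comp graded_free_complex_def)
    qed simp
    then show ?thesis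
      using vec_comp_graded[OF u(1), of 0] u(2) sh by auto
  qed
  then obtain \<phi> where \<phi>: "\<And>a. a < rk F 0 \<Longrightarrow> \<phi> a \<in> graded_tensor G (polyring n) 0 (shift F 0 a)"
    "\<And>a. a < rk F 0 \<Longrightarrow> augmentation G (\<phi> a) = aug F a"
    by metis
  then show ?thesis
    by (intro exI[of _ \<phi>]) (simp add: graded_map_def augmentation_lapp augmentation_def[of F])
qed

text \<open>One step of the comparison theorem: the images of the rows of the differential are
  cycles and are lifted basis element by basis element.\<close>

lemma lift_step:
  assumes F: "residue_field_resolution n F" and G: "residue_field_resolution n G"
    and \<phi>: "graded_map n F i G i \<phi>"
    and cyc: "\<And>v. v \<in> tensor F (polyring n) i \<Longrightarrow> cycle F i v \<Longrightarrow> cycle G i (lapp (rk F i) \<phi> v)"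
  shows "\<exists>\<phi>'. graded_map n F (Suc i) G (Suc i) \<phi>' \<and>
    (\<forall>v. bd G i (lapp (rk F (Suc i)) \<phi>' v) = lapp (rk F i) \<phi> (bd F i v))"
proof -
  have "\<exists>w\<in>graded_tensor G (polyring n) (Suc i) (shift F (Suc i) a).
      bd G i w = lapp (rk F i) \<phi> (bd_row F i a)" if a: "a < rk F (Suc i)" for a
    using cycle_bd_row[OF F a]
    by (intro graded_lift[OF G] lapp_graded[OF \<phi> is_ideal_polyring] cyc) (auto simp: graded_tensor_def)
  then obtain \<phi>' where \<phi>': "\<And>a. a < rk F (Suc i) \<Longrightarrow> \<phi>' a \<in> graded_tensor G (polyring n) (Suc i) (shift F (Suc i) a)"
    "\<And>a. a < rk F (Suc i) \<Longrightarrow> bd G i (\<phi>' a) = lapp (rk F i) \<phi> (bd_row F i a)"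
    by metis
  have "bd G i (lapp (rk F (Suc i)) \<phi>' v) = lapp (rk F i) \<phi> (bd F i v)" for v
    unfolding bd_lapp lapp_lapp by (intro lapp_cong) (simp add: \<phi>'(2) bd_lapp[symmetric])
  then show ?thesis
    using \<phi>'(1) by (intro exI[of _ \<phi>']) (simp add: graded_map_def)
qed

text \<open>The data of a single homological degree. The identity is required on cycles only, where
  the contribution of the homotopy one degree lower vanishes, so that homotopy does not appear here.
  In degree 0 it is required on all vectors, since each of them is a cycle for Tor_0.\<close>

definition homotopy_data where
  "homotopy_data n F G i \<phi> \<psi> h \<longleftrightarrow>
     graded_map n F i G i \<phi> \<and> graded_map n G i F i \<psi> \<and> graded_map n F i F (Suc i) h \<and>
     (\<forall>v\<in>tensor F (polyring n) i. cycle F i v \<longrightarrow> cycle G i (lapp (rk F i) \<phi> v)) \<and>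
     (\<forall>v\<in>tensor G (polyring n) i. cycle G i v \<longrightarrow> cycle F i (lapp (rk G i) \<psi> v)) \<and>
     (\<forall>v\<in>tensor F (polyring n) i. i = 0 \<or> cycle F i v \<longrightarrow>
        bd F i (lapp (rk F i) h v) = lapp (rk G i) \<psi> (lapp (rk F i) \<phi> v) - v)"

lemma homotopy_lift:
  assumes F: "residue_field_resolution n F"
    and t: "\<And>a. a < rk F i \<Longrightarrow> t a \<in> graded_tensor F (polyring n) i (shift F i a)"
      "\<And>a. a < rk F i \<Longrightarrow> cycle F i (t a)"
  shows "\<exists>h. graded_map n F i F (Suc i) h \<and> (\<forall>v. bd F i (lapp (rk F i) h v) = lapp (rk F i) t v)"
proof -
  obtain h where h: "\<And>a. a < rk F i \<Longrightarrow> h a \<in> graded_tensor F (polyring n) (Suc i) (shift F i a)"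
    "\<And>a. a < rk F i \<Longrightarrow> bd F i (h a) = t a"
    using graded_lift[OF F t] by metis
  have "bd F i (lapp (rk F i) h v) = lapp (rk F i) t v" for v
    unfolding bd_lapp lapp_lapp by (intro lapp_cong) (simp add: h(2) bd_lapp[symmetric])
  then show ?thesis
    using h(1) by (intro exI[of _ h]) (simp add: graded_map_def)
qed

lemma homotopy_exists:
  assumes F: "residue_field_resolution n F" and G: "residue_field_resolution n G"
  shows "\<exists>\<phi> \<psi> h. homotopy_data n F G i \<phi> \<psi> h"
proof (induction i)
  case 0
  obtain \<phi> where \<phi>: "graded_map n F 0 G 0 \<phi>" "\<And>v. augmentation G (lapp (rk F 0) \<phi> v) = augmentation F v"
    using lift_augmentation[OF F G] by blast
  obtain \<psi> where \<psi>: "graded_map n G 0 F 0 \<psi>" "\<And>v. augmentation F (lapp (rk G 0) \<psi> v) = augmentation G v"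
    using lift_augmentation[OF G F] by blast
  define t where "t a = lapp (rk G 0) \<psi> (\<phi> a) - unit_vec a" for a
  have "\<phi> a \<in> graded_tensor G (polyring n) 0 (shift F 0 a)" if "a < rk F 0" for a
    using \<phi>(1) that by (simp add: graded_map_def)
  then have t: "t a \<in> graded_tensor F (polyring n) 0 (shift F 0 a)" if "a < rk F 0" for a
    unfolding t_def using graded_map_unit[of n F 0] that
    by (intro graded_tensor_diff[OF is_ideal_polyring] lapp_graded[OF \<psi>(1) is_ideal_polyring])
      (auto simp: graded_map_def)
  have "cycle F 0 (t a)" if a: "a < rk F 0" for a
  proof -
    have "augmentation G (\<phi> a) = aug F a"
      using \<phi>(2)[of "unit_vec a"] a by (simp add: lapp_unit augmentation_unit)
    then show ?thesis
      using a by (simp add: t_def augmentation_diff \<psi>(2) augmentation_unit)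
  qed
  from homotopy_lift[OF F t this] obtain h where
    h: "graded_map n F 0 F (Suc 0) h" "\<And>v. bd F 0 (lapp (rk F 0) h v) = lapp (rk F 0) t v"
    by blast
  have "lapp (rk F 0) t v = lapp (rk G 0) \<psi> (lapp (rk F 0) \<phi> v) - v" if "v \<in> tensor F (polyring n) 0" for v
    unfolding t_def lapp_diff_rows lapp_lapp using tensorD(2)[OF that] by (simp add: lapp_unit_rows)
  then have "homotopy_data n F G 0 \<phi> \<psi> h"
    using \<phi> \<psi> h by (simp add: homotopy_data_def)
  then show ?case by blast
next
  case (Suc i)
  then obtain \<phi> \<psi> h where IH: "homotopy_data n F G i \<phi> \<psi> h" by blast
  note D = IH[unfolded homotopy_data_def]
  obtain \<phi>' where \<phi>': "graded_map n F (Suc i) G (Suc i) \<phi>'"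
    "\<And>v. bd G i (lapp (rk F (Suc i)) \<phi>' v) = lapp (rk F i) \<phi> (bd F i v)"
    using lift_step[OF F G, of i \<phi>] D by blast
  obtain \<psi>' where \<psi>': "graded_map n G (Suc i) F (Suc i) \<psi>'"
    "\<And>v. bd F i (lapp (rk G (Suc i)) \<psi>' v) = lapp (rk G i) \<psi> (bd G i v)"
    using lift_step[OF G F, of i \<psi>] D by blast
  \<comment> \<open>The deviation \<open>\<psi>' \<phi>' - 1 - h d\<close> takes values in cycles by
    the identity one degree lower, and its lift is the new homotopy. On cycles the last term is
    0.\<close>
  define t where "t a = lapp (rk G (Suc i)) \<psi>' (\<phi>' a) - unit_vec a - lapp (rk F i) h (bd_row F i a)" for a
  have \<phi>'a: "\<phi>' a \<in> graded_tensor G (polyring n) (Suc i) (shift F (Suc i) a)" if "a < rk F (Suc i)" for a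
    using \<phi>'(1) that by (simp add: graded_map_def)
  have t: "t a \<in> graded_tensor F (polyring n) (Suc i) (shift F (Suc i) a)" if a: "a < rk F (Suc i)" for a
  proof -
    have "lapp (rk F i) h (bd_row F i a) \<in> graded_tensor F (polyring n) (Suc i) (shift F (Suc i) a)"
      using D by (intro lapp_graded[OF _ is_ideal_polyring cycle_bd_row(2)[OF F a]]) blast
    moreover have "lapp (rk G (Suc i)) \<psi>' (\<phi>' a) \<in> graded_tensor F (polyring n) (Suc i) (shift F (Suc i) a)"
      by (rule lapp_graded[OF \<psi>'(1) is_ideal_polyring \<phi>'a[OF a]])
    moreover have "unit_vec a \<in> graded_tensor F (polyring n) (Suc i) (shift F (Suc i) a)"
      using graded_map_unit[of n F "Suc i"] a by (simp add: graded_map_def)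
    ultimately show ?thesis
      unfolding t_def by (intro graded_tensor_diff[OF is_ideal_polyring])
  qed
  have "cycle F (Suc i) (t a)" if a: "a < rk F (Suc i)" for a
  proof -
    have row: "bd_row F i a \<in> tensor F (polyring n) i" "cycle F i (bd_row F i a)"
      using cycle_bd_row[OF F a] by (auto simp: graded_tensor_def)
    have "bd G i (\<phi>' a) = lapp (rk F i) \<phi> (bd_row F i a)"
      using \<phi>'(2)[of "unit_vec a"] a by (simp only: lapp_unit bd_unit)
    then have "bd F i (t a) = lapp (rk G i) \<psi> (lapp (rk F i) \<phi> (bd_row F i a)) - bd_row F i a
        - bd F i (lapp (rk F i) h (bd_row F i a))"
      unfolding t_def bd_diff \<psi>'(2) bd_unit[OF a] by simp
    also have "bd F i (lapp (rk F i) h (bd_row F i a)) =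
        lapp (rk G i) \<psi> (lapp (rk F i) \<phi> (bd_row F i a)) - bd_row F i a"
      using D row by blast
    finally show ?thesis
      by (simp only: diff_self cycle_simps)
  qed
  from homotopy_lift[OF F t this] obtain h' where
    h': "graded_map n F (Suc i) F (Suc (Suc i)) h'"
    "\<And>v. bd F (Suc i) (lapp (rk F (Suc i)) h' v) = lapp (rk F (Suc i)) t v"
    by blast
  have "lapp (rk F (Suc i)) t v = lapp (rk G (Suc i)) \<psi>' (lapp (rk F (Suc i)) \<phi>' v) - v"
    if v: "v \<in> tensor F (polyring n) (Suc i)" "bd F i v = 0" for v
  proof -
    have "lapp (rk F (Suc i)) t v = lapp (rk G (Suc i)) \<psi>' (lapp (rk F (Suc i)) \<phi>' v)
        - lapp (rk F (Suc i)) unit_vec v - lapp (rk F i) h (bd F i v)"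
      unfolding t_def lapp_diff_rows lapp_lapp bd_lapp ..
    then show ?thesis
      using v tensorD(2)[OF v(1)] by (simp add: lapp_unit_rows del: lapp_0) (simp add: fun_eq_iff lapp_def)
  qed
  moreover have "bd G i (lapp (rk F (Suc i)) \<phi>' v) = 0" if "bd F i v = 0" for v
    unfolding \<phi>'(2) that by (rule lapp_0)
  moreover have "bd F i (lapp (rk G (Suc i)) \<psi>' v) = 0" if "bd G i v = 0" for v
    unfolding \<psi>'(2) that by (rule lapp_0)
  ultimately have "homotopy_data n F G (Suc i) \<phi>' \<psi>' h'"
    using \<phi>'(1) \<psi>'(1) h' unfolding homotopy_data_def cycle_simps by auto
  then show ?case by blast
qed

section \<open>Zero maps on Tor do not depend on the resolution\<close>

definition tor_vanish :: "'k::field free_complex \<Rightarrow> 'k mpoly set \<Rightarrow> 'k mpoly set \<Rightarrow> nat \<Rightarrow> int \<Rightarrow> bool" where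
  "tor_vanish F A B i j \<longleftrightarrow> tor_cycles F A i j \<subseteq> tor_boundaries F B i j"

lemma tor_cycles_iff:
  "z \<in> tor_cycles F A i j \<longleftrightarrow> z \<in> graded_tensor F A i j \<and> (i = 0 \<or> cycle F i z)"
  by (cases i) (auto simp: tor_cycles_def)

text \<open>On cycles \<open>\<psi> \<phi> z = z + d h z\<close>, and \<open>\<phi> z\<close> is a
  boundary \<open>d w\<close> over \<open>B\<close>; hence \<open>z\<close> is the boundary of
  \<open>\<psi>' w - h z\<close>. All maps have polynomial entries and so respect vectors with
  entries in \<open>A\<close> or \<open>B\<close>.\<close>

theorem tor_vanish_transfer:
  assumes F: "residue_field_resolution n F" and G: "residue_field_resolution n G"
    and A: "is_ideal n A" and B: "is_ideal n B" and AB: "A \<subseteq> B" and vanish: "tor_vanish G A B i j"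
  shows "tor_vanish F A B i j"
  unfolding tor_vanish_def
proof
  fix z assume z: "z \<in> tor_cycles F A i j"
  obtain \<phi> \<psi> h where D: "homotopy_data n F G i \<phi> \<psi> h"
    using homotopy_exists[OF F G] by blast
  note D = D[unfolded homotopy_data_def]
  obtain \<psi>' where \<psi>': "graded_map n G (Suc i) F (Suc i) \<psi>'"
    "\<And>v. bd F i (lapp (rk G (Suc i)) \<psi>' v) = lapp (rk G i) \<psi> (bd G i v)"
    using lift_step[OF G F, of i \<psi>] D by blast
  have zA: "z \<in> graded_tensor F A i j" and cyc: "i = 0 \<or> cycle F i z"
    using z by (auto simp: tor_cycles_iff)
  have zP: "z \<in> tensor F (polyring n) i"
    using graded_tensorD(1)[OF zA] ideal_sub[OF A] by (auto simp: tensor_def)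
  have "lapp (rk F i) \<phi> z \<in> graded_tensor G A i j"
    using D by (intro lapp_graded[OF _ A zA]) blast
  moreover have "i = 0 \<or> cycle G i (lapp (rk F i) \<phi> z)"
    using D cyc zP by blast
  ultimately have "lapp (rk F i) \<phi> z \<in> tor_boundaries G B i j"
    using vanish by (auto simp: tor_vanish_def tor_cycles_iff)
  then obtain w where w: "w \<in> graded_tensor G B (Suc i) j" "lapp (rk F i) \<phi> z = bd G i w"
    by (auto simp: tor_boundaries_def)
  let ?y = "lapp (rk G (Suc i)) \<psi>' w - lapp (rk F i) h z"
  have "lapp (rk F i) h z \<in> graded_tensor F A (Suc i) j"
    using D by (intro lapp_graded[OF _ A zA]) blast
  then have "?y \<in> graded_tensor F B (Suc i) j"
    using graded_tensor_mono[OF AB] by (intro graded_tensor_diff[OF B] lapp_graded[OF \<psi>'(1) B w(1)]) blast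
  moreover have "bd F i ?y = z"
  proof -
    have "bd F i (lapp (rk F i) h z) = lapp (rk G i) \<psi> (lapp (rk F i) \<phi> z) - z"
      using D cyc zP by blast
    then show ?thesis
      unfolding bd_diff \<psi>'(2) w(2) by simp
  qed
  ultimately show "z \<in> tor_boundaries F B i j"
    unfolding tor_boundaries_def by (metis image_eqI)
qed

section \<open>The Koszul resolution\<close>

definition ksets :: "nat \<Rightarrow> nat \<Rightarrow> indet set set" where
  "ksets n i = {S. S \<subseteq> vars n \<and> card S = i}"

lemma finite_ksets [simp]: "finite (ksets n i)"
  unfolding ksets_def by (rule finite_subset[of _ "Pow (vars n)"]) auto

text \<open>The bases of a \<open>free_complex\<close> are indexed by numbers; an arbitrary
  enumeration of the \<open>i\<close>-subsets is fixed.\<close>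

definition kenum :: "nat \<Rightarrow> nat \<Rightarrow> nat \<Rightarrow> indet set" where
  "kenum n i = (SOME f. bij_betw f {..<card (ksets n i)} (ksets n i))"

lemma kenum: "bij_betw (kenum n i) {..<card (ksets n i)} (ksets n i)"
proof -
  have "\<exists>f. bij_betw f {..<card (ksets n i)} (ksets n i)"
    using ex_bij_betw_nat_finite[OF finite_ksets] by (simp add: atLeast0LessThan)
  then show ?thesis
    unfolding kenum_def by (rule someI_ex)
qed

text \<open>At most one \<open>v\<close> completes the set with index \<open>b\<close> to the set
  with index \<open>a\<close>, so the sum in \<open>mat\<close> has at most one nonzero term. In
  degree 0 the only basis element belongs to the empty set, and it is sent to 1.\<close>

definition koszul :: "nat \<Rightarrow> 'k::field free_complex" where
  "koszul n = \<lparr>rk = \<lambda>i. card (ksets n i), shift = \<lambda>i a. int i,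
     mat = \<lambda>i a b. \<Sum>v\<in>vars n - kenum n i b.
       if insert v (kenum n i b) = kenum n (Suc i) a then sg v (kenum n i b) * var v else 0,
     aug = \<lambda>a. 1\<rparr>"

lemma koszul_simps [simp]:
  "rk (koszul n) i = card (ksets n i)" "shift (koszul n) i a = int i" "aug (koszul n) a = 1"
  by (simp_all add: koszul_def)

definition to_chain :: "nat \<Rightarrow> nat \<Rightarrow> (nat \<Rightarrow> 'k::field mpoly) \<Rightarrow> indet set \<Rightarrow> 'k mpoly" where
  "to_chain n i v S = (if S \<in> ksets n i then v (inv_into {..<card (ksets n i)} (kenum n i) S) else 0)"

definition of_chain :: "nat \<Rightarrow> nat \<Rightarrow> (indet set \<Rightarrow> 'k::field mpoly) \<Rightarrow> nat \<Rightarrow> 'k mpoly" where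
  "of_chain n i \<omega> a = (if a < card (ksets n i) then \<omega> (kenum n i a) else 0)"

lemma kenum_mem: "a < card (ksets n i) \<Longrightarrow> kenum n i a \<in> ksets n i"
  using kenum bij_betwE by blast

lemma to_chain_kenum: "a < card (ksets n i) \<Longrightarrow> to_chain n i v (kenum n i a) = v a"
  using bij_betw_inv_into_left[OF kenum, of a n i] by (simp add: to_chain_def kenum_mem)

lemma ksetsE:
  assumes "S \<in> ksets n i"
  obtains a where "a < card (ksets n i)" "S = kenum n i a"
  using assms kenum[of n i] unfolding bij_betw_def by blast

lemma to_of_chain:
  assumes "\<And>S. \<omega> S \<noteq> 0 \<Longrightarrow> S \<in> ksets n i"
  shows "to_chain n i (of_chain n i \<omega>) = \<omega>"
proof
  fix S
  show "to_chain n i (of_chain n i \<omega>) S = \<omega> S"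
  proof (cases "S \<in> ksets n i")
    case True
    then obtain a where "a < card (ksets n i)" "S = kenum n i a"
      by (rule ksetsE)
    then show ?thesis
      by (simp add: to_chain_kenum of_chain_def)
  next
    case False
    then show ?thesis
      using assms by (auto simp: to_chain_def)
  qed
qed

lemma to_chain_inj:
  assumes eq: "to_chain n i u = to_chain n i v"
    and "\<And>a. a \<ge> card (ksets n i) \<Longrightarrow> u a = 0" "\<And>a. a \<ge> card (ksets n i) \<Longrightarrow> v a = 0"
  shows "u = v"
proof
  fix a
  show "u a = v a"
  proof (cases "a < card (ksets n i)")
    case True
    then show ?thesis
      using fun_cong[OF eq, of "kenum n i a"] by (simp add: to_chain_kenum)
  next
    case False
    then show ?thesis using assms(2,3) by simp
  qed
qed

lemma to_chain_uchain:
  assumes "v \<in> tensor (koszul n) L i" "0 \<in> L"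
  shows "to_chain n i v \<in> uchain n L (int i)"
proof -
  have "to_chain n i v S \<in> L" for S
  proof (cases "S \<in> ksets n i")
    case True
    then obtain a where "a < card (ksets n i)" "S = kenum n i a"
      by (rule ksetsE)
    then show ?thesis
      using tensorD(1)[OF assms(1), of a] by (simp add: to_chain_kenum)
  qed (simp add: to_chain_def assms(2))
  then show ?thesis
    by (auto simp: uchain_def to_chain_def ksets_def)
qed

lemma to_chain_chain:
  assumes v: "v \<in> graded_tensor (koszul n) L i j" and L: "0 \<in> L"
  shows "to_chain n i v \<in> chain n L (int i) j"
proof -
  have "homogeneous (j - int i) (to_chain n i v S)" for S
  proof (cases "S \<in> ksets n i")
    case True
    then obtain a where "a < card (ksets n i)" "S = kenum n i a"
      by (rule ksetsE)
    then show ?thesis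
      using graded_tensorD(2)[OF v, of a] by (simp add: to_chain_kenum)
  qed (simp add: to_chain_def)
  then show ?thesis
    using to_chain_uchain[OF graded_tensorD(1)[OF v] L] by (simp add: chain_def)
qed

lemma of_chain_tensor: "\<omega> \<in> uchain n L i' \<Longrightarrow> of_chain n i \<omega> \<in> tensor (koszul n) L i"
  by (simp add: tensor_def of_chain_def uchainD(1))

lemma of_chain_graded:
  "\<omega> \<in> chain n L (int i) j \<Longrightarrow> of_chain n i \<omega> \<in> graded_tensor (koszul n) L i j"
  using of_chain_tensor[of \<omega> n L "int i" i] by (auto simp: graded_tensor_def chain_def of_chain_def)

lemma uchain_ksets: "\<omega> \<in> uchain n L (int i) \<Longrightarrow> \<omega> S \<noteq> 0 \<Longrightarrow> S \<in> ksets n i"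
  by (auto simp: uchain_def ksets_def)

lemma to_chain_bd: "to_chain n i (bd (koszul n) i v) = kd n (to_chain n (Suc i) v)"
proof
  fix T
  show "to_chain n i (bd (koszul n) i v) T = kd n (to_chain n (Suc i) v) T"
  proof (cases "T \<in> ksets n i")
    case True
    then obtain b where b: "b < card (ksets n i)" "T = kenum n i b"
      by (rule ksetsE)
    have T: "T \<subseteq> vars n" "card T = i" "finite T"
      using True finite_subset[OF _ finite_vars] by (auto simp: ksets_def)
    have "to_chain n i (bd (koszul n) i v) T =
        (\<Sum>a<card (ksets n (Suc i)). v a * (\<Sum>u\<in>vars n - T. if insert u T = kenum n (Suc i) a then sg u T * var u else 0))"
      unfolding b(2) to_chain_kenum[OF b(1)] using b(1) by (simp add: bd_def koszul_def)
    also have "\<dots> = (\<Sum>u\<in>vars n - T. \<Sum>a<card (ksets n (Suc i)).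
        if insert u T = kenum n (Suc i) a then v a * (sg u T * var u) else 0)"
      unfolding sum_distrib_left by (subst sum.swap) (intro sum.cong, auto)
    also have "\<dots> = (\<Sum>u\<in>vars n - T. sg u T * (var u * to_chain n (Suc i) v (insert u T)))"
    proof (rule sum.cong)
      fix u assume u: "u \<in> vars n - T"
      then have "insert u T \<in> ksets n (Suc i)"
        using T by (simp add: ksets_def)
      then obtain a where a: "a < card (ksets n (Suc i))" "insert u T = kenum n (Suc i) a"
        by (rule ksetsE)
      have "kenum n (Suc i) a = kenum n (Suc i) a' \<longleftrightarrow> a = a'" if "a' < card (ksets n (Suc i))" for a'
        using kenum[of n "Suc i"] a(1) that by (auto simp: bij_betw_def inj_on_def)
      then have "(\<Sum>a'<card (ksets n (Suc i)). if insert u T = kenum n (Suc i) a' then v a' * (sg u T * var u) else 0) =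
          (\<Sum>a'<card (ksets n (Suc i)). if a = a' then v a' * (sg u T * var u) else 0)"
        unfolding a(2) by (intro sum.cong) auto
      also have "\<dots> = v a * (sg u T * var u)"
        using a(1) by simp
      also have "\<dots> = sg u T * (var u * to_chain n (Suc i) v (insert u T))"
        unfolding a(2) to_chain_kenum[OF a(1)] by (simp only: ac_simps)
      finally show "(\<Sum>a'<card (ksets n (Suc i)). if insert u T = kenum n (Suc i) a' then v a' * (sg u T * var u) else 0) =
          sg u T * (var u * to_chain n (Suc i) v (insert u T))" .
    qed simp
    finally show ?thesis
      using T(1) by (simp add: kd_def)
  next
    case False
    have "to_chain n (Suc i) v (insert u T) = 0" if "T \<subseteq> vars n" "u \<in> vars n - T" for u
    proof -
      have "finite T" using that finite_subset[OF _ finite_vars] by blast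
      then have "insert u T \<notin> ksets n (Suc i)"
        using False that by (simp add: ksets_def)
      then show ?thesis by (simp add: to_chain_def)
    qed
    with False show ?thesis
      by (simp add: to_chain_def[of n i] kd_def)
  qed
qed

lemma graded_free_complex_koszul: "graded_free_complex n (koszul n)"
  unfolding graded_free_complex_def
proof (intro conjI allI impI)
  fix i a b
  show "mat (koszul n) i a b \<in> polyring n"
    by (auto simp: koszul_def intro!: ideal_sum_mem[OF is_ideal_polyring] polyring_mult polyring_var)
  show "homogeneous (shift (koszul n) (Suc i) a - shift (koszul n) i b) (mat (koszul n) i a b)"
    by (auto simp: koszul_def intro!: homogeneous_sum homogeneous_sg)
qed simp

lemma tensor_koszul_zero: "v \<in> tensor (koszul n) L i \<Longrightarrow> a \<ge> card (ksets n i) \<Longrightarrow> v a = 0"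
  by (simp add: tensor_def)

lemma bd_koszul_zero: "a \<ge> card (ksets n i) \<Longrightarrow> bd (koszul n) i v a = 0"
  by (simp add: bd_def)

lemma bd_tensor: "graded_free_complex n F \<Longrightarrow> v \<in> tensor F (polyring n) (Suc i) \<Longrightarrow> bd F i v \<in> tensor F (polyring n) i"
  unfolding bd_lapp by (intro lapp_tensor[OF graded_map_bd is_ideal_polyring])

lemma ksets_0: "ksets n 0 = {{}}"
  using finite_subset[OF _ finite_vars] by (auto simp: ksets_def card_eq_0_iff)

lemma augmentation_koszul: "augmentation (koszul n) v = lookup (to_chain n 0 v {}) 0"
  using kenum_mem[of 0 n 0] to_chain_kenum[of 0 n 0 v]
  by (simp add: augmentation_def ksets_0 lessThan_Suc)

text \<open>After contraction along all indeterminates only the constant term at the empty set could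
  remain. For \<open>i > 0\<close> the index sets are nonempty, and for \<open>i = 0\<close> this
  term is excluded by the condition on the augmentation.\<close>

lemma koszul_exact:
  assumes v: "v \<in> tensor (koszul n) (polyring n) i" and d: "kd n (to_chain n i v) = 0"
    and aug: "i = 0 \<Longrightarrow> lookup (to_chain n 0 v {}) 0 = 0"
  shows "v \<in> bd (koszul n) i ` tensor (koszul n) (polyring n) (Suc i)"
proof -
  let ?\<omega> = "to_chain n i v"
  obtain vs where vs: "set vs = vars n"
    using finite_list[OF finite_vars] by blast
  have \<omega>: "?\<omega> \<in> uchain n (polyring n) (int i)"
    by (rule to_chain_uchain[OF v polyring_0])
  have "kP vs ?\<omega> = 0"
  proof
    fix S
    show "kP vs ?\<omega> S = 0 S"
    proof (rule poly_mapping_eqI)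
      fix m
      show "lookup (kP vs ?\<omega> S) m = lookup (0 S) m"
      proof (cases "lookup (?\<omega> S) m = 0")
        case False
        then have "?\<omega> S \<noteq> 0"
          by auto
        then have S: "S \<subseteq> vars n" "card S = i"
          using uchainD(2,3)[OF \<omega>, of S] by simp_all
        have m: "keys m \<subseteq> vars n"
          using polyring_keys[OF uchainD(1)[OF \<omega>, of S], of m] False by (simp add: in_keys_iff)
        have "\<not> (S = {} \<and> m = 0)"
          using False S aug by auto
        moreover have "m = 0" if "keys m = {}"
          using that by (auto intro!: poly_mapping_eqI simp: in_keys_iff)
        ultimately have "S \<inter> vars n \<noteq> {} \<or> keys m \<inter> vars n \<noteq> {}"
          using S m by blast
        then show ?thesis
          by (auto simp: lookup_kP vs)
      qed (simp add: lookup_kP)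
    qed
  qed
  then have kd: "kd n (kH vs ?\<omega>) = ?\<omega>"
    using kd_kH[OF _ _ d, of vs] vs uchainD(2)[OF \<omega>] by (metis diff_zero order_refl)
  have H: "kH vs ?\<omega> \<in> uchain n (polyring n) (int (Suc i))"
    using kH_uchain[OF is_ideal_polyring divar_closed_polyring _ \<omega>, of vs] vs
    by (simp add: add.commute)
  let ?w = "of_chain n (Suc i) (kH vs ?\<omega>)"
  have w: "?w \<in> tensor (koszul n) (polyring n) (Suc i)"
    by (rule of_chain_tensor[OF H])
  have "to_chain n i (bd (koszul n) i ?w) = ?\<omega>"
    using kd to_of_chain[OF uchain_ksets[OF H]] unfolding to_chain_bd by metis
  then have "bd (koszul n) i ?w = v"
    by (rule to_chain_inj) (simp_all add: bd_koszul_zero tensor_koszul_zero[OF v])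
  then show ?thesis
    using imageI[OF w, of "bd (koszul n) i"] by simp
qed

lemma to_chain_0 [simp]: "to_chain n i 0 = 0"
  by (rule ext) (simp add: to_chain_def)

theorem residue_field_resolution_koszul: "residue_field_resolution n (koszul n :: 'k::field free_complex)"
  unfolding residue_field_resolution_def
proof (intro conjI allI)
  let ?K = "koszul n :: 'k free_complex"
  show "graded_free_complex n ?K"
    by (rule graded_free_complex_koszul)
  show "augmentation ?K ` tensor ?K (polyring n) 0 = UNIV"
  proof -
    have "c \<in> augmentation ?K ` tensor ?K (polyring n) 0" for c
    proof
      let ?v = "\<lambda>a. if a = 0 then const c else (0 :: 'k mpoly)"
      show "?v \<in> tensor ?K (polyring n) 0"
        by (simp add: tensor_def ksets_0)
      show "c = augmentation ?K ?v"
        by (simp add: augmentation_def ksets_0 lessThan_Suc const_def)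
    qed
    then show ?thesis by blast
  qed
  show "{v \<in> tensor ?K (polyring n) 0. augmentation ?K v = 0} = bd ?K 0 ` tensor ?K (polyring n) 1"
  proof (intro subset_antisym subsetI)
    fix v assume v: "v \<in> {v \<in> tensor ?K (polyring n) 0. augmentation ?K v = 0}"
    \<comment> \<open>Exterior degree -1 contains only 0.\<close>
    have "kd n (to_chain n 0 v) \<in> uchain n (polyring n) (int 0 - 1)"
      using v by (intro kd_uchain[OF is_ideal_polyring] to_chain_uchain) auto
    then have "kd n (to_chain n 0 v) = 0"
      by (auto simp: uchain_def)
    then show "v \<in> bd ?K 0 ` tensor ?K (polyring n) 1"
      using v koszul_exact[of v n 0] by (simp add: augmentation_koszul)
  next
    fix v assume "v \<in> bd ?K 0 ` tensor ?K (polyring n) 1"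
    then obtain w where w: "w \<in> tensor ?K (polyring n) (Suc 0)" "v = bd ?K 0 w"
      by auto
    have "augmentation ?K v = lookup (kd n (to_chain n (Suc 0) w) {}) 0"
      unfolding augmentation_koszul w(2) to_chain_bd ..
    also have "\<dots> = 0"
      by (simp add: lookup_kd)
    finally show "v \<in> {v \<in> tensor ?K (polyring n) 0. augmentation ?K v = 0}"
      using bd_tensor[OF graded_free_complex_koszul w(1)] w(2) by simp
  qed
  fix i
  show "{v \<in> tensor ?K (polyring n) (Suc i). bd ?K i v = 0} =
      bd ?K (Suc i) ` tensor ?K (polyring n) (Suc (Suc i))"
  proof (intro subset_antisym subsetI)
    fix v assume v: "v \<in> {v \<in> tensor ?K (polyring n) (Suc i). bd ?K i v = 0}"
    then have "kd n (to_chain n (Suc i) v) = to_chain n i 0"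
      unfolding to_chain_bd[symmetric] by simp
    then have "kd n (to_chain n (Suc i) v) = 0"
      by (simp only: to_chain_0)
    then show "v \<in> bd ?K (Suc i) ` tensor ?K (polyring n) (Suc (Suc i))"
      using v koszul_exact[of v n "Suc i"] by simp
  next
    fix v assume "v \<in> bd ?K (Suc i) ` tensor ?K (polyring n) (Suc (Suc i))"
    then obtain w where w: "w \<in> tensor ?K (polyring n) (Suc (Suc i))" "v = bd ?K (Suc i) w"
      by auto
    have "to_chain n i (bd ?K i v) = to_chain n i 0"
      unfolding w(2) to_chain_bd kd_kd to_chain_0 ..
    then have "bd ?K i v = 0"
      by (rule to_chain_inj) (simp_all add: bd_koszul_zero)
    then show "v \<in> {v \<in> tensor ?K (polyring n) (Suc i). bd ?K i v = 0}"
      using bd_tensor[OF graded_free_complex_koszul w(1)] w(2) by simp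
  qed
qed

lemma tor_vanish_koszul:
  assumes exact: "exact_in n A B (int i) j" and A: "is_ideal n A" and B: "is_ideal n B"
  shows "tor_vanish (koszul n) A B i j"
  unfolding tor_vanish_def
proof
  fix z assume z: "z \<in> tor_cycles (koszul n) A i j"
  then have zA: "z \<in> graded_tensor (koszul n) A i j" and d: "i = 0 \<or> bd (koszul n) (i - 1) z = 0"
    by (auto simp: tor_cycles_def)
  let ?\<omega> = "to_chain n i z"
  have \<omega>: "?\<omega> \<in> chain n A (int i) j"
    by (rule to_chain_chain[OF zA ideal_0[OF A]])
  have "kd n ?\<omega> = 0"
  proof (cases i)
    case 0
    have "kd n ?\<omega> \<in> chain n A (int i - 1) j"
      by (rule kd_chain[OF A \<omega>])
    then show ?thesis
      by (auto simp: chain_def uchain_def 0)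
  next
    case (Suc k)
    then have "kd n ?\<omega> = to_chain n k 0"
      using d unfolding Suc to_chain_bd[symmetric] by simp
    then show ?thesis
      by (simp only: to_chain_0)
  qed
  with exact \<omega> obtain \<eta> where \<eta>: "\<eta> \<in> chain n B (int i + 1) j" "kd n \<eta> = ?\<omega>"
    by (rule exact_inE)
  then have \<eta>': "\<eta> \<in> chain n B (int (Suc i)) j"
    by (simp add: add.commute)
  have "\<eta> \<in> uchain n B (int (Suc i))"
    using \<eta>' by (simp add: chain_def)
  then have "to_chain n i (bd (koszul n) i (of_chain n (Suc i) \<eta>)) = ?\<omega>"
    unfolding to_chain_bd by (subst to_of_chain[OF uchain_ksets]) (auto simp: \<eta>(2))
  then have "bd (koszul n) i (of_chain n (Suc i) \<eta>) = z"
    by (rule to_chain_inj) (simp_all add: bd_koszul_zero tensor_koszul_zero[OF graded_tensorD(1)[OF zA]])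
  then show "z \<in> tor_boundaries (koszul n) B i j"
    using of_chain_graded[OF \<eta>'] unfolding tor_boundaries_def by blast
qed

theorem tor_vanishI:
  assumes F: "residue_field_resolution n F" and "is_ideal n A" "is_ideal n B" "A \<subseteq> B"
    and "exact_in n A B (int i) j"
  shows "tor_vanish F A B i j"
  using assms
  by (intro tor_vanish_transfer[OF F residue_field_resolution_koszul] tor_vanish_koszul)

section \<open>Dimension counts\<close>

locale scaled_space = vector_space
begin

text \<open>The ambient spaces are infinite-dimensional, and \<open>dim\<close> of a subspace
  without a finite basis is 0; the counts are therefore made for subspaces inside the span of a
  finite set.\<close>

definition fin_subspace :: "'b set \<Rightarrow> bool" where
  "fin_subspace V \<longleftrightarrow> local.subspace V \<and> (\<exists>W. finite W \<and> V \<subseteq> local.span W)"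

lemma fin_subspace_subset: "fin_subspace V \<Longrightarrow> local.subspace U \<Longrightarrow> U \<subseteq> V \<Longrightarrow> fin_subspace U"
  by (auto simp: fin_subspace_def)

lemma fin_subspace_basis:
  assumes V: "fin_subspace V" and S: "S \<subseteq> V" "local.independent S"
  obtains C where "finite C" "S \<subseteq> C" "C \<subseteq> V" "local.independent C" "local.span C = V" "card C = local.dim V"
proof -
  obtain C where C: "S \<subseteq> C" "C \<subseteq> V" "local.independent C" "V \<subseteq> local.span C"
    by (rule local.maximal_independent_subset_extend[OF S])
  obtain W where "finite W" "V \<subseteq> local.span W" and sub: "local.subspace V"
    using V by (auto simp: fin_subspace_def)
  then have "finite C"
    using local.independent_span_bound[of W C] C by auto
  moreover have "local.span C = V"
    using C local.span_minimal[OF C(2) sub] by auto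
  moreover have "card C = local.dim V"
    by (rule local.basis_card_eq_dim[OF C(2,4,3)])
  ultimately show ?thesis
    using that C by blast
qed

lemma dim_mono_fin:
  assumes V: "fin_subspace V" and U: "U \<subseteq> V"
  shows "local.dim U \<le> local.dim V"
proof -
  obtain B where B: "B \<subseteq> U" "local.independent B" "U \<subseteq> local.span B" "card B = local.dim U"
    by (rule local.basis_exists)
  have "B \<subseteq> V" using B U by auto
  then obtain C where "finite C" "B \<subseteq> C" "card C = local.dim V"
    using fin_subspace_basis[OF V _ B(2)] by metis
  then show ?thesis
    using card_mono[of C B] B by simp
qed

lemma span_disjoint_independent:
  assumes C: "local.independent (B \<union> D)" "B \<inter> D = {}" and x: "x \<in> local.span B" "x \<in> local.span D"
  shows "x = 0"
proof -
  have "local.representation (B \<union> D) x = local.representation B x" "local.representation (B \<union> D) x = local.representation D x"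
    using x by (auto intro: local.representation_extend[OF C(1)])
  then have "local.representation (B \<union> D) x b = 0" for b
    using local.representation_ne_zero[of B x b] local.representation_ne_zero[of D x b] C(2) by fastforce
  then have "{b. local.representation (B \<union> D) x b \<noteq> 0} = {}"
    by auto
  moreover have "x \<in> local.span (B \<union> D)"
    using x local.span_mono[of B "B \<union> D"] by auto
  ultimately show ?thesis
    using local.sum_nonzero_representation_eq[OF C(1), of x] by simp
qed

text \<open>A basis of the kernel is extended to one of \<open>V\<close>; the map is injective on
  the span of the added vectors and carries it onto the image.\<close>

lemma rank_nullity:
  assumes T: "Vector_Spaces.linear scale scale T" and V: "fin_subspace V"
  shows "local.dim V = local.dim {v \<in> V. T v = 0} + local.dim (T ` V)"
proof -
  interpret T: Vector_Spaces.linear scale scale T by fact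
  let ?K = "{v \<in> V. T v = 0}"
  have subV: "local.subspace V" using V by (simp add: fin_subspace_def)
  have "local.subspace ?K"
    using subV by (auto simp: local.subspace_def T.add T.scale T.zero)
  then have K: "fin_subspace ?K"
    by (rule fin_subspace_subset[OF V]) auto
  obtain B where B: "finite B" "{} \<subseteq> B" "B \<subseteq> ?K" "local.independent B" "local.span B = ?K" "card B = local.dim ?K"
    by (rule fin_subspace_basis[OF K empty_subsetI local.independent_empty])
  then have "B \<subseteq> V" by auto
  then obtain C where C: "finite C" "B \<subseteq> C" "C \<subseteq> V" "local.independent C" "local.span C = V" "card C = local.dim V"
    using fin_subspace_basis[OF V _ B(4)] by metis
  define D where "D = C - B"
  have CBD: "C = B \<union> D" "B \<inter> D = {}"
    using C(2) by (auto simp: D_def)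
  have "D \<subseteq> C" by (simp add: D_def)
  have inj: "inj_on T (local.span D)"
    unfolding T.inj_on_iff_eq_0[OF local.subspace_span]
  proof (intro ballI impI)
    fix x assume x: "x \<in> local.span D" "T x = 0"
    have "x \<in> V"
      using x(1) local.span_mono[OF \<open>D \<subseteq> C\<close>] C(5) by auto
    then have "x \<in> local.span B"
      using x(2) B(5) by simp
    then show "x = 0"
      using span_disjoint_independent[of B D x] C(4) CBD x(1) by simp
  qed
  have "T ` V = T ` local.span D"
  proof
    show "T ` V \<subseteq> T ` local.span D"
    proof
      fix y assume "y \<in> T ` V"
      then obtain v where v: "v \<in> local.span (B \<union> D)" "y = T v"
        using C(5) CBD(1) by auto
      then obtain b d where bd: "b \<in> local.span B" "d \<in> local.span D" "v = b + d"
        unfolding local.span_Un by blast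
      have "T b = 0"
        using bd(1) B(5) by simp
      then have "y = T d"
        using bd v by (simp add: T.add)
      then show "y \<in> T ` local.span D"
        using bd(2) by blast
    qed
    show "T ` local.span D \<subseteq> T ` V"
      using local.span_mono[OF \<open>D \<subseteq> C\<close>] C(5) by auto
  qed
  then have "local.span (T ` D) = T ` V"
    by (simp only: T.span_image)
  moreover have "local.independent (T ` D)"
    using T.dependent_inj_imageD[OF _ inj] local.independent_mono[OF C(4) \<open>D \<subseteq> C\<close>] by blast
  ultimately have "local.dim (T ` V) = card (T ` D)"
    using local.dim_span_eq_card_independent by metis
  also have "\<dots> = card D"
    using inj_on_subset[OF inj local.span_superset] by (rule card_image)
  finally have "local.dim (T ` V) = card D" .
  moreover have "finite D"
    using C(1) by (simp add: D_def)
  then have "card C = card B + card D"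
    unfolding CBD(1) by (rule card_Un_disjoint[OF B(1) _ CBD(2)])
  ultimately show ?thesis
    using B(6) C(6) by linarith
qed

lemma fin_subspace_sum:
  assumes X: "fin_subspace X" and Y: "fin_subspace Y"
  shows "fin_subspace {x + y |x y. x \<in> X \<and> y \<in> Y}"
proof -
  obtain W W' where W: "finite W" "X \<subseteq> local.span W" "finite W'" "Y \<subseteq> local.span W'"
    using X Y by (auto simp: fin_subspace_def)
  have "{x + y |x y. x \<in> X \<and> y \<in> Y} \<subseteq> local.span (W \<union> W')"
    using W unfolding local.span_Un by blast
  moreover have "local.subspace {x + y |x y. x \<in> X \<and> y \<in> Y}"
    using X Y by (intro local.subspace_sums) (auto simp: fin_subspace_def)
  moreover have "finite (W \<union> W')"
    using W by simp
  ultimately show ?thesis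
    unfolding fin_subspace_def by blast
qed

text \<open>\<open>rank_nullity\<close> is applied twice to a map \<open>g\<close> that kills a
  basis of \<open>Y\<close> and fixes the vectors extending it to a basis of the sum. Its kernel is
  \<open>Y\<close> on the sum and \<open>X \<inter> Y\<close> on \<open>X\<close>, and the two
  images agree.\<close>

lemma dim_sum_Int:
  assumes X: "fin_subspace X" and Y: "fin_subspace Y"
  shows "local.dim {x + y |x y. x \<in> X \<and> y \<in> Y} + local.dim (X \<inter> Y) = local.dim X + local.dim Y"
proof -
  let ?S = "{x + y |x y. x \<in> X \<and> y \<in> Y}"
  have S: "fin_subspace ?S" by (rule fin_subspace_sum[OF X Y])
  have 0: "0 \<in> X" "0 \<in> Y"
    using X Y by (auto simp: fin_subspace_def local.subspace_0)
  have YS: "Y \<subseteq> ?S"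
    using 0 by force
  have XS: "X \<subseteq> ?S"
    using 0 by force
  obtain B where B: "finite B" "{} \<subseteq> B" "B \<subseteq> Y" "local.independent B" "local.span B = Y" "card B = local.dim Y"
    by (rule fin_subspace_basis[OF Y empty_subsetI local.independent_empty])
  obtain C where C': "finite C" "B \<subseteq> C" "C \<subseteq> ?S" "local.independent C" "local.span C = ?S" "card C = local.dim ?S"
    by (rule fin_subspace_basis[OF S subset_trans[OF B(3) YS] B(4)])
  note C = C'(1,2,4,5)
  define D where "D = C - B"
  interpret vector_space_pair scale scale ..
  obtain g where g: "Vector_Spaces.linear scale scale g" "\<And>x. x \<in> C \<Longrightarrow> g x = (if x \<in> B then 0 else x)"
    using linear_independent_extend[OF C(3), of "\<lambda>x. if x \<in> B then 0 else x"] by blast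
  interpret g: Vector_Spaces.linear scale scale g by fact
  have gB: "g x = 0" if "x \<in> local.span B" for x
    by (rule g.eq_0_on_span[OF _ that]) (use g(2) C(2) in auto)
  have gD: "g x = x" if "x \<in> local.span D" for x
    using linear_eq_on[OF g(1) linear_id that] g(2) by (auto simp: D_def)
  have ker: "g v = 0 \<longleftrightarrow> v \<in> Y" if v: "v \<in> ?S" for v
  proof
    assume gv: "g v = 0"
    have "C = B \<union> D" using C(2) by (auto simp: D_def)
    then obtain b d where bd: "b \<in> local.span B" "d \<in> local.span D" "v = b + d"
      using v C(4) local.span_Un[of B D] by (smt (verit) mem_Collect_eq)
    then have "g v = d"
      using gB gD by (simp add: g.add)
    then show "v \<in> Y"
      using gv bd B(5) by simp
  next
    assume "v \<in> Y"
    then show "g v = 0" using gB B(5) by simp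
  qed
  have "local.dim X = local.dim {v \<in> X. g v = 0} + local.dim (g ` X)"
    by (rule rank_nullity[OF g(1) X])
  also have "{v \<in> X. g v = 0} = X \<inter> Y"
    using ker XS by blast
  finally have 1: "local.dim X = local.dim (X \<inter> Y) + local.dim (g ` X)" .
  have "local.dim ?S = local.dim {v \<in> ?S. g v = 0} + local.dim (g ` ?S)"
    by (rule rank_nullity[OF g(1) S])
  also have "{v \<in> ?S. g v = 0} = Y"
    using ker YS by blast
  also have "g ` ?S = g ` X"
  proof
    show "g ` ?S \<subseteq> g ` X"
    proof
      fix z assume "z \<in> g ` ?S"
      then obtain x y where xy: "x \<in> X" "y \<in> Y" "z = g (x + y)" by blast
      then have "z = g x"
        using gB B(5) by (simp add: g.add)
      then show "z \<in> g ` X" using xy by blast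
    qed
    show "g ` X \<subseteq> g ` ?S" using XS by blast
  qed
  finally show ?thesis
    using 1 by simp
qed

end

interpretation vec: scaled_space "scale_vec :: 'k::field \<Rightarrow> _"
  by (rule scaled_space.intro[OF vector_space_scale_vec])

section \<open>Finite dimension of the graded pieces\<close>

lemma bd_scale: "bd F i (scale_vec c v) = scale_vec c (bd F i v)"
  by (rule ext) (simp add: bd_def scale_vec_def sum_distrib_left mult.assoc)

lemma linear_bd: "Vector_Spaces.linear scale_vec scale_vec (bd F i)"
  unfolding Vector_Spaces.linear_iff by (intro conjI allI vector_space_scale_vec bd_add bd_scale)

lemma finite_monomials: "finite {m :: indet \<Rightarrow>\<^sub>0 nat. keys m \<subseteq> vars n \<and> mdeg m = d}"
proof (rule finite_imageD)
  have "lookup m v \<le> mdeg m" for m :: "indet \<Rightarrow>\<^sub>0 nat" and v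
  proof (cases "v \<in> keys m")
    case True
    then show ?thesis
      unfolding mdeg_def by (intro member_le_sum) auto
  qed (simp add: in_keys_iff)
  then have "lookup ` {m :: indet \<Rightarrow>\<^sub>0 nat. keys m \<subseteq> vars n \<and> mdeg m = d} \<subseteq>
      {f. \<forall>x. (x \<in> vars n \<longrightarrow> f x \<in> {..d}) \<and> (x \<notin> vars n \<longrightarrow> f x = 0)}"
    by (auto simp: in_keys_iff)
  then show "finite (lookup ` {m :: indet \<Rightarrow>\<^sub>0 nat. keys m \<subseteq> vars n \<and> mdeg m = d})"
    by (rule finite_subset) (intro finite_set_of_finite_funs finite_vars finite_atMost)
  show "inj_on lookup {m :: indet \<Rightarrow>\<^sub>0 nat. keys m \<subseteq> vars n \<and> mdeg m = d}"
    by (rule inj_onI) (simp add: lookup_inject)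
qed

lemma subspace_graded_tensor:
  assumes L: "is_ideal n L"
  shows "vec.subspace (graded_tensor F L i j)"
proof (rule vec.subspaceI)
  show "0 \<in> graded_tensor F L i j"
    by (rule graded_tensor_0[OF ideal_0[OF L]])
  show "u + v \<in> graded_tensor F L i j" if "u \<in> graded_tensor F L i j" "v \<in> graded_tensor F L i j" for u v
    by (rule graded_tensor_add[OF L that])
  show "scale_vec c v \<in> graded_tensor F L i j" if "v \<in> graded_tensor F L i j" for c v
    using that
    by (auto simp: graded_tensor_def tensor_def scale_vec_def intro: ideal_mult[OF L]
        homogeneous_mult'[OF homogeneous_const])
qed

text \<open>Finitely many monomial vectors span a space that contains all vectors of the given
  degree. They may have entries outside \<open>L\<close>, which is why \<open>fin_subspace\<close>
  asks only for an enclosing span.\<close>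

lemma fin_subspace_graded_tensor:
  fixes L :: "'k::field mpoly set"
  assumes L: "is_ideal n L"
  shows "vec.fin_subspace (graded_tensor F L i j)"
proof -
  \<comment> \<open>For a negative degree \<open>nat\<close> gives 0; in that case
    \<open>v a\<close> is 0, and the inclusion of its monomials in \<open>M a\<close> still
    holds.\<close>
  define M where "M a = {m :: indet \<Rightarrow>\<^sub>0 nat. keys m \<subseteq> vars n \<and> mdeg m = nat (j - shift F i a)}" for a
  define e where "e a m = (\<lambda>b. if b = a then single m 1 else 0 :: 'k mpoly)" for a :: nat and m :: "indet \<Rightarrow>\<^sub>0 nat"
  let ?W = "\<Union>a<rk F i. e a ` M a"
  have "finite ?W"
    by (auto simp: M_def finite_monomials)
  moreover have "v \<in> vec.span ?W" if v: "v \<in> graded_tensor F L i j" for v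
  proof -
    have keys: "keys (v a) \<subseteq> M a" if a: "a < rk F i" for a
    proof
      fix m assume m: "m \<in> keys (v a)"
      have "v a \<in> polyring n"
        using tensorD(1)[OF graded_tensorD(1)[OF v] a] ideal_sub[OF L] by blast
      then have "keys m \<subseteq> vars n"
        using m by (rule polyring_keys)
      moreover have "int (mdeg m) = j - shift F i a"
        using graded_tensorD(2)[OF v a] m by (simp add: homogeneous_def)
      ultimately show "m \<in> M a"
        by (simp add: M_def)
    qed
    have "v = (\<Sum>a<rk F i. \<Sum>m\<in>keys (v a). scale_vec (lookup (v a) m) (e a m))"
    proof
      fix b
      have sum_fun: "(\<Sum>x\<in>X. f x) b = (\<Sum>x\<in>X. f x b)" for X and f :: "'x \<Rightarrow> nat \<Rightarrow> 'k mpoly"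
        by (induction X rule: infinite_finite_induct) auto
      have "(\<Sum>a<rk F i. \<Sum>m\<in>keys (v a). scale_vec (lookup (v a) m) (e a m)) b =
          (\<Sum>a<rk F i. \<Sum>m\<in>keys (v a). scale_vec (lookup (v a) m) (e a m) b)"
        by (simp add: sum_fun)
      also have "\<dots> = (\<Sum>a<rk F i. if a = b then \<Sum>m\<in>keys (v a). single m (lookup (v a) m) else 0)"
        by (intro sum.cong) (auto simp: scale_vec_def e_def const_def mult_single)
      also have "\<dots> = v b"
        using tensorD(2)[OF graded_tensorD(1)[OF v], of b] poly_decomp[of "v b"] by simp
      finally show "v b = (\<Sum>a<rk F i. \<Sum>m\<in>keys (v a). scale_vec (lookup (v a) m) (e a m)) b" ..
    qed
    moreover have "(\<Sum>a<rk F i. \<Sum>m\<in>keys (v a). scale_vec (lookup (v a) m) (e a m)) \<in> vec.span ?W"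
      using keys by (intro vec.span_sum vec.span_scale vec.span_base) auto
    ultimately show ?thesis by simp
  qed
  ultimately show ?thesis
    using subspace_graded_tensor[OF L] unfolding vec.fin_subspace_def by blast
qed

lemma fin_subspace_cycles:
  assumes L: "is_ideal n L"
  shows "vec.fin_subspace (tor_cycles F L i j)"
proof (rule vec.fin_subspace_subset[OF fin_subspace_graded_tensor[OF L]])
  interpret bd: Vector_Spaces.linear scale_vec scale_vec "bd F k" for k
    by (rule linear_bd)
  show "vec.subspace (tor_cycles F L i j)"
    using subspace_graded_tensor[OF L, of F i j]
    by (auto simp: tor_cycles_def vec.subspace_def bd.add bd.scale bd.zero simp del: zero_fun_def plus_fun_def)
  show "tor_cycles F L i j \<subseteq> graded_tensor F L i j"
    by (auto simp: tor_cycles_def)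
qed

lemma fin_subspace_image:
  assumes "vec.fin_subspace V"
  shows "vec.fin_subspace (bd F i ` V)"
proof -
  interpret bd: Vector_Spaces.linear scale_vec scale_vec "bd F i"
    by (rule linear_bd)
  obtain W where W: "finite W" "V \<subseteq> vec.span W" "vec.subspace V"
    using assms by (auto simp: vec.fin_subspace_def)
  have "bd F i ` V \<subseteq> vec.span (bd F i ` W)"
    using W(2) unfolding bd.span_image by blast
  then show ?thesis
    using W bd.subspace_image[OF W(3)] unfolding vec.fin_subspace_def by blast
qed

lemma fin_subspace_boundaries: "is_ideal n L \<Longrightarrow> vec.fin_subspace (tor_boundaries F L i j)"
  unfolding tor_boundaries_def by (intro fin_subspace_image fin_subspace_graded_tensor)

lemma bd_graded:
  assumes F: "graded_free_complex n F" and L: "is_ideal n L" and v: "v \<in> graded_tensor F L (Suc i) j"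
  shows "bd F i v \<in> graded_tensor F L i j"
  unfolding bd_lapp by (rule lapp_graded[OF graded_map_bd[OF F] L v])

lemma bd_bd:
  assumes F: "residue_field_resolution n F" and L: "is_ideal n L" and v: "v \<in> graded_tensor F L (Suc (Suc i)) j"
  shows "bd F i (bd F (Suc i) v) = 0"
proof -
  have "v \<in> tensor F (polyring n) (Suc (Suc i))"
    using graded_tensorD(1)[OF v] ideal_sub[OF L] by (auto simp: tensor_def)
  then have "bd F (Suc i) v \<in> {v \<in> tensor F (polyring n) (Suc i). cycle F (Suc i) v}"
    unfolding resolution_exact[OF F] by blast
  then show ?thesis by simp
qed

lemma boundaries_subset_cycles:
  assumes F: "residue_field_resolution n F" and L: "is_ideal n L"
  shows "tor_boundaries F L i j \<subseteq> tor_cycles F L i j"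
  using bd_graded[OF resolution_graded[OF F] L] bd_bd[OF F L]
  by (cases i) (auto simp: tor_boundaries_def tor_cycles_def)

section \<open>The Betti numbers of a sum of ideals\<close>

lemma graded_tensor_sum:
  assumes A: "graded_ideal n A" and B: "graded_ideal n B"
  shows "graded_tensor F (ideal_sum A B) i j =
    {x + y |x y. x \<in> graded_tensor F A i j \<and> y \<in> graded_tensor F B i j}"
proof (intro subset_antisym subsetI)
  fix v assume v: "v \<in> graded_tensor F (ideal_sum A B) i j"
  have "\<exists>a\<in>A. \<exists>b\<in>B. v k = a + b" if "k < rk F i" for k
    using tensorD(1)[OF graded_tensorD(1)[OF v] that] by (auto simp: ideal_sum_def)
  then obtain a b where ab: "\<And>k. k < rk F i \<Longrightarrow> a k \<in> A" "\<And>k. k < rk F i \<Longrightarrow> b k \<in> B"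
    "\<And>k. k < rk F i \<Longrightarrow> v k = a k + b k"
    by metis
  have "vec_comp F i j a \<in> graded_tensor F A i j" "vec_comp F i j b \<in> graded_tensor F B i j"
    using ab(1,2) graded_ideal_comp[OF A] graded_ideal_comp[OF B]
    by (simp_all add: graded_tensor_def tensor_def vec_comp_def)
  moreover have "v = vec_comp F i j a + vec_comp F i j b"
  proof
    fix k
    have "v k = vec_comp F i j v k"
      using vec_comp_id[OF v] by simp
    also have "\<dots> = (vec_comp F i j a + vec_comp F i j b) k"
      using ab(3)[of k] by (simp add: vec_comp_def hom_comp_add)
    finally show "v k = (vec_comp F i j a + vec_comp F i j b) k" .
  qed
  ultimately show "v \<in> {x + y |x y. x \<in> graded_tensor F A i j \<and> y \<in> graded_tensor F B i j}"
    by blast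
next
  fix v assume "v \<in> {x + y |x y. x \<in> graded_tensor F A i j \<and> y \<in> graded_tensor F B i j}"
  then obtain x y where xy: "v = x + y" "x \<in> graded_tensor F A i j" "y \<in> graded_tensor F B i j"
    by blast
  have I: "is_ideal n A" "is_ideal n B" "is_ideal n (ideal_sum A B)"
    using A B by (auto simp: graded_ideal_def is_ideal_sum)
  have "A \<subseteq> ideal_sum A B" "B \<subseteq> ideal_sum A B"
    using ideal_sum_left[OF I(2)] ideal_sum_right[OF I(1)] by auto
  then have "x \<in> graded_tensor F (ideal_sum A B) i j" "y \<in> graded_tensor F (ideal_sum A B) i j"
    using xy graded_tensor_mono by blast+
  then show "v \<in> graded_tensor F (ideal_sum A B) i j"
    unfolding xy(1) by (rule graded_tensor_add[OF I(3)])
qed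

lemma graded_tensor_Int: "graded_tensor F (A \<inter> B) i j = graded_tensor F A i j \<inter> graded_tensor F B i j"
  by (auto simp: graded_tensor_def tensor_def)

lemma tor_cycles_Int: "tor_cycles F (A \<inter> B) i j = tor_cycles F A i j \<inter> tor_cycles F B i j"
  by (auto simp: tor_cycles_def graded_tensor_Int)

lemma tor_cycles_Suc: "tor_cycles F L (Suc k) j = {v \<in> graded_tensor F L (Suc k) j. bd F k v = 0}"
  by (simp add: tor_cycles_def)

context
  fixes n :: nat and F :: "'k::field free_complex" and A B :: "'k mpoly set" and j :: int
  assumes F: "residue_field_resolution n F" and A: "graded_ideal n A" and B: "graded_ideal n B"
begin

lemma ideal_A: "is_ideal n A" and ideal_B: "is_ideal n B" and ideal_Int: "is_ideal n (A \<inter> B)"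
  and ideal_Sum: "is_ideal n (ideal_sum A B)"
  using A B by (auto simp: graded_ideal_def is_ideal_Int is_ideal_sum)

text \<open>Common boundaries are cycles over both ideals, hence over the intersection; the converse
  is the assumed vanishing.\<close>

lemma boundaries_Int:
  assumes "tor_vanish F (A \<inter> B) A i j" "tor_vanish F (A \<inter> B) B i j"
  shows "tor_boundaries F A i j \<inter> tor_boundaries F B i j = tor_cycles F (A \<inter> B) i j"
proof
  show "tor_boundaries F A i j \<inter> tor_boundaries F B i j \<subseteq> tor_cycles F (A \<inter> B) i j"
    using boundaries_subset_cycles[OF F ideal_A] boundaries_subset_cycles[OF F ideal_B]
    unfolding tor_cycles_Int by blast
  show "tor_cycles F (A \<inter> B) i j \<subseteq> tor_boundaries F A i j \<inter> tor_boundaries F B i j"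
    using assms by (simp add: tor_vanish_def)
qed

text \<open>Boundaries over the sum are sums of boundaries, so the dimension formula applies, with
  the intersection given by \<open>boundaries_Int\<close>.\<close>

lemma dim_boundaries_sum:
  assumes "tor_vanish F (A \<inter> B) A i j" "tor_vanish F (A \<inter> B) B i j"
  shows "vec.dim (tor_boundaries F (ideal_sum A B) i j) + vec.dim (tor_cycles F (A \<inter> B) i j) =
    vec.dim (tor_boundaries F A i j) + vec.dim (tor_boundaries F B i j)"
proof -
  have "tor_boundaries F (ideal_sum A B) i j =
      {x + y |x y. x \<in> tor_boundaries F A i j \<and> y \<in> tor_boundaries F B i j}"
    (is "?L = ?R")
  proof (intro subset_antisym subsetI)
    fix z assume "z \<in> ?L"
    then obtain x y where "x \<in> graded_tensor F A (Suc i) j" "y \<in> graded_tensor F B (Suc i) j" "z = bd F i (x + y)"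
      unfolding tor_boundaries_def graded_tensor_sum[OF A B] by blast
    then show "z \<in> ?R"
      unfolding tor_boundaries_def bd_add by blast
  next
    fix z assume "z \<in> ?R"
    then obtain x y where xy: "x \<in> graded_tensor F A (Suc i) j" "y \<in> graded_tensor F B (Suc i) j" "z = bd F i (x + y)"
      unfolding tor_boundaries_def bd_add by blast
    then have "x + y \<in> graded_tensor F (ideal_sum A B) (Suc i) j"
      unfolding graded_tensor_sum[OF A B] by blast
    then show "z \<in> ?L"
      unfolding tor_boundaries_def xy(3) by (rule imageI)
  qed
  then show ?thesis
    using vec.dim_sum_Int[OF fin_subspace_boundaries[OF ideal_A] fin_subspace_boundaries[OF ideal_B], of F i j F i j]
    by (simp only: boundaries_Int[OF assms])
qed

lemma dim_cycles_sum_0: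
  "vec.dim (tor_cycles F (ideal_sum A B) 0 j) + vec.dim (tor_cycles F (A \<inter> B) 0 j) =
    vec.dim (tor_cycles F A 0 j) + vec.dim (tor_cycles F B 0 j)"
proof -
  have "tor_cycles F L 0 j = graded_tensor F L 0 j" for L :: "'k mpoly set"
    by (simp add: tor_cycles_def)
  then show ?thesis
    using vec.dim_sum_Int[OF fin_subspace_graded_tensor[OF ideal_A] fin_subspace_graded_tensor[OF ideal_B], of F 0 j F 0 j]
    by (simp only: graded_tensor_sum[OF A B] graded_tensor_Int)
qed

text \<open>The connecting homomorphism without quotients: \<open>U\<close> is the set of first components of cycles
  of the sum, and the differential maps \<open>U\<close> onto the cycles of the intersection.\<close>

lemma dim_cycles_sum_Suc:
  assumes "tor_vanish F (A \<inter> B) A k j" "tor_vanish F (A \<inter> B) B k j"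
  shows "vec.dim (tor_cycles F (ideal_sum A B) (Suc k) j) + vec.dim (tor_cycles F (A \<inter> B) (Suc k) j)
      + vec.dim (tor_boundaries F (A \<inter> B) k j) =
    vec.dim (tor_cycles F A (Suc k) j) + vec.dim (tor_cycles F B (Suc k) j)
      + vec.dim (tor_cycles F (A \<inter> B) k j)"
proof -
  let ?C = "\<lambda>L. graded_tensor F L (Suc k) j"
  let ?Z = "\<lambda>L. tor_cycles F L (Suc k) j"
  define U where "U = {b \<in> ?C A. bd F k b \<in> tor_boundaries F B k j}"
  interpret bd: Vector_Spaces.linear scale_vec scale_vec "bd F k"
    by (rule linear_bd)
  have subB: "vec.subspace (tor_boundaries F B k j)"
    using fin_subspace_boundaries[OF ideal_B] by (simp add: vec.fin_subspace_def)
  have "vec.subspace U"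
    unfolding U_def
  proof (rule vec.subspaceI)
    have 0: "bd F k 0 = 0" by (rule bd.zero)
    show "0 \<in> {b \<in> ?C A. bd F k b \<in> tor_boundaries F B k j}"
      using vec.subspace_0[OF subB] vec.subspace_0[OF subspace_graded_tensor[OF ideal_A]]
      by (simp only: mem_Collect_eq 0)
    show "x + y \<in> {b \<in> ?C A. bd F k b \<in> tor_boundaries F B k j}"
      if "x \<in> {b \<in> ?C A. bd F k b \<in> tor_boundaries F B k j}" "y \<in> {b \<in> ?C A. bd F k b \<in> tor_boundaries F B k j}" for x y
      using that vec.subspace_add[OF subB] vec.subspace_add[OF subspace_graded_tensor[OF ideal_A]]
      by (simp only: mem_Collect_eq bd_add)
    show "scale_vec c x \<in> {b \<in> ?C A. bd F k b \<in> tor_boundaries F B k j}"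
      if "x \<in> {b \<in> ?C A. bd F k b \<in> tor_boundaries F B k j}" for c x
      using that vec.subspace_scale[OF subB] vec.subspace_scale[OF subspace_graded_tensor[OF ideal_A]]
      by (simp only: mem_Collect_eq bd_scale)
  qed
  then have U: "vec.fin_subspace U"
    by (rule vec.fin_subspace_subset[OF fin_subspace_graded_tensor[OF ideal_A]]) (auto simp: U_def)
  have CB: "vec.fin_subspace (?C B)" and CI: "vec.fin_subspace (?C (A \<inter> B))"
    by (rule fin_subspace_graded_tensor[OF ideal_B], rule fin_subspace_graded_tensor[OF ideal_Int])
  have Z: "vec.fin_subspace (?Z (ideal_sum A B))"
    by (rule fin_subspace_cycles[OF ideal_Sum])
  \<comment> \<open>A cycle over the sum determines its component over \<open>A\<close> only up to
    chains over the intersection. Adding all of \<open>?C B\<close> on both sides removes this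
    ambiguity.\<close>
  have "{x + y |x y. x \<in> ?Z (ideal_sum A B) \<and> y \<in> ?C B} = {x + y |x y. x \<in> U \<and> y \<in> ?C B}"
    (is "?L = ?R")
  proof (intro subset_antisym subsetI)
    fix v assume "v \<in> ?L"
    then obtain z y where zy: "v = z + y" "z \<in> ?Z (ideal_sum A B)" "y \<in> ?C B" by blast
    then obtain a b where ab: "z = a + b" "a \<in> ?C A" "b \<in> ?C B" "bd F k z = 0"
      unfolding tor_cycles_Suc graded_tensor_sum[OF A B] by blast
    have "bd F k a = bd F k (- b)"
      using ab(1,4) by (simp only: bd.neg bd_add add_eq_0_iff2)
    moreover have "- b \<in> ?C B"
      by (rule vec.subspace_neg[OF subspace_graded_tensor[OF ideal_B] ab(3)])
    ultimately have "a \<in> U"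
      using ab(2) unfolding U_def tor_boundaries_def by auto
    moreover have "b + y \<in> ?C B"
      by (rule graded_tensor_add[OF ideal_B ab(3) zy(3)])
    moreover have "v = a + (b + y)"
      unfolding zy(1) ab(1) by (rule add.assoc)
    ultimately show "v \<in> ?R" by blast
  next
    fix v assume "v \<in> ?R"
    then obtain u y where uy: "v = u + y" "u \<in> U" "y \<in> ?C B" by blast
    then obtain b where b: "b \<in> ?C B" "bd F k u = bd F k b" "u \<in> ?C A"
      by (auto simp: U_def tor_boundaries_def)
    have nb: "- b \<in> ?C B"
      by (rule vec.subspace_neg[OF subspace_graded_tensor[OF ideal_B] b(1)])
    have "bd F k (u + - b) = 0"
      by (simp only: bd.add bd.neg b(2) right_minus)
    then have "u + - b \<in> ?Z (ideal_sum A B)"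
      unfolding tor_cycles_Suc graded_tensor_sum[OF A B] using b(3) nb by blast
    moreover have "b + y \<in> ?C B"
      by (rule graded_tensor_add[OF ideal_B b(1) uy(3)])
    moreover have "v = (u + - b) + (b + y)"
      unfolding uy(1) by (simp add: fun_eq_iff)
    ultimately show "v \<in> ?L" by blast
  qed
  moreover have "?Z (ideal_sum A B) \<inter> ?C B = ?Z B"
    using graded_tensor_mono[of B "ideal_sum A B" F "Suc k" j] ideal_sum_right[OF ideal_A, of _ B]
    by (auto simp: tor_cycles_Suc)
  moreover have "U \<inter> ?C B = ?C (A \<inter> B)"
    by (auto simp: U_def tor_boundaries_def graded_tensor_Int)
  ultimately have 1: "vec.dim (?Z (ideal_sum A B)) + vec.dim (?C (A \<inter> B)) = vec.dim U + vec.dim (?Z B)"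
    using vec.dim_sum_Int[OF Z CB] vec.dim_sum_Int[OF U CB] by simp
  \<comment> \<open>The differential maps \<open>U\<close> onto the common boundaries, and by the
    assumed vanishing these are all cycles over the intersection.\<close>
  have "{v \<in> U. bd F k v = 0} = ?Z A"
    using vec.subspace_0[OF subB] by (auto simp: U_def tor_cycles_Suc simp del: zero_fun_def)
  moreover have "bd F k ` U = tor_cycles F (A \<inter> B) k j"
    unfolding boundaries_Int[OF assms, symmetric] by (auto simp: U_def tor_boundaries_def)
  ultimately have 2: "vec.dim U = vec.dim (?Z A) + vec.dim (tor_cycles F (A \<inter> B) k j)"
    using vec.rank_nullity[OF linear_bd[of F k] U] by simp
  have 3: "vec.dim (?C (A \<inter> B)) = vec.dim (?Z (A \<inter> B)) + vec.dim (tor_boundaries F (A \<inter> B) k j)"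
    using vec.rank_nullity[OF linear_bd[of F k] CI] by (simp add: tor_cycles_Suc tor_boundaries_def)
  show ?thesis
    using 1 2 3 by linarith
qed

text \<open>Subtraction of natural numbers is truncated; the inclusion of the boundaries in the
  cycles makes the difference in \<open>dim_tor\<close> a true one.\<close>

lemma dim_tor_diff:
  assumes L: "is_ideal n L"
  shows "vec.dim (tor_cycles F L i j) = dim_tor F L i j + vec.dim (tor_boundaries F L i j)"
  using vec.dim_mono_fin[OF fin_subspace_cycles[OF L] boundaries_subset_cycles[OF F L], of i j]
  by (simp add: dim_tor_def)

text \<open>Vanishing in degree \<open>i\<close> governs the boundaries over the sum, vanishing in
  degree \<open>i - 1\<close> its cycles. In the difference the cycles over the intersection in
  degree \<open>i\<close> cancel, and its homology in degree \<open>i - 1\<close> remains.\<close>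

theorem dim_tor_sum:
  assumes "tor_vanish F (A \<inter> B) A i j" "tor_vanish F (A \<inter> B) B i j"
    and "\<And>k. i = Suc k \<Longrightarrow> tor_vanish F (A \<inter> B) A k j \<and> tor_vanish F (A \<inter> B) B k j"
  shows "dim_tor F (ideal_sum A B) i j = dim_tor F A i j + dim_tor F B i j +
    (case i of 0 \<Rightarrow> 0 | Suc k \<Rightarrow> dim_tor F (A \<inter> B) k j)"
proof -
  note b = dim_boundaries_sum[OF assms(1,2)]
  note d = dim_tor_diff[OF ideal_A] dim_tor_diff[OF ideal_B] dim_tor_diff[OF ideal_Sum]
  show ?thesis
  proof (cases i)
    case 0
    show ?thesis
      using b d[of i] dim_cycles_sum_0 unfolding 0 by simp
  next
    case (Suc k)
    have "vec.dim (tor_cycles F (ideal_sum A B) (Suc k) j) + vec.dim (tor_cycles F (A \<inter> B) (Suc k) j)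
        + vec.dim (tor_boundaries F (A \<inter> B) k j) =
      vec.dim (tor_cycles F A (Suc k) j) + vec.dim (tor_cycles F B (Suc k) j)
        + vec.dim (tor_cycles F (A \<inter> B) k j)"
      using assms(3)[OF Suc] by (intro dim_cycles_sum_Suc) auto
    then show ?thesis
      using b d[of i] dim_tor_diff[OF ideal_Int, of k] unfolding Suc by simp
  qed
qed

end

theorem betti_sum:
  assumes A: "graded_ideal n A" and B: "graded_ideal n B"
    and exact: "\<And>k. 0 \<le> k \<Longrightarrow> k = i \<or> k = i - 1 \<Longrightarrow>
      exact_in n (A \<inter> B) A k j \<and> exact_in n (A \<inter> B) B k j"
  shows "betti n (ideal_sum A B) i j =
    betti n A i j + betti n B i j + betti n (A \<inter> B) (i - 1) j"
proof (cases "i < 0")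
  case True
  then show ?thesis by (simp add: betti_def)
next
  case False
  define F where "F = (SOME F. residue_field_resolution n (F :: 'a free_complex))"
  \<comment> \<open>The Koszul complex shows that a resolution exists, so the one chosen in
    \<open>betti\<close> is a resolution too; nothing else is known about it.\<close>
  have F: "residue_field_resolution n F"
    unfolding F_def by (rule someI[of _ "koszul n"]) (rule residue_field_resolution_koszul)
  note I = graded_ideal_ideal[OF A] graded_ideal_ideal[OF B] is_ideal_Int[OF graded_ideal_ideal[OF A] graded_ideal_ideal[OF B]]
  have van: "tor_vanish F (A \<inter> B) A k j \<and> tor_vanish F (A \<inter> B) B k j" if "int k = i \<or> int k = i - 1" for k
    using exact[of "int k"] that tor_vanishI[OF F I(3) I(1), of k j] tor_vanishI[OF F I(3) I(2), of k j] by simp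
  have "dim_tor F (ideal_sum A B) (nat i) j = dim_tor F A (nat i) j + dim_tor F B (nat i) j +
      (case nat i of 0 \<Rightarrow> 0 | Suc k \<Rightarrow> dim_tor F (A \<inter> B) k j)"
  proof (rule dim_tor_sum[OF F A B])
    show "tor_vanish F (A \<inter> B) A (nat i) j" "tor_vanish F (A \<inter> B) B (nat i) j"
      using van[of "nat i"] False by simp_all
    show "tor_vanish F (A \<inter> B) A k j \<and> tor_vanish F (A \<inter> B) B k j" if "nat i = Suc k" for k
      using van[of k] that by linarith
  qed
  also have "(case nat i of 0 \<Rightarrow> 0 | Suc k \<Rightarrow> dim_tor F (A \<inter> B) k j) = betti n (A \<inter> B) (i - 1) j"
    using False by (cases "nat i") (auto simp: betti_def F_def nat_diff_distrib)
  finally show ?thesis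
    using False by (simp add: betti_def F_def)
qed

section \<open>Minimal generators\<close>

text \<open>\<open>edge_minors\<close> contains each minor together with its negative, so in general
  it is not minimal; a set of ordered pairs selects one orientation for each edge.\<close>

definition pair_minors :: "(nat \<times> nat) set \<Rightarrow> 'k::field mpoly set" where
  "pair_minors R = {minor a b |a b. (a, b) \<in> R}"

text \<open>The term x_a y_b is divisible by a term of a minor only if that minor is on the same two
  columns.\<close>

lemma minor_notin_ideal:
  assumes S: "S \<subseteq> polyring n" and ab: "a \<noteq> b"
    and gens: "\<And>f. f \<in> S \<Longrightarrow> \<exists>c d. f = minor c d \<and> {c, d} \<noteq> {a, b}"
  shows "minor a b \<notin> ideal_gen n (S :: 'k::field mpoly set)"
proof
  assume mem: "minor a b \<in> ideal_gen n S"
  let ?\<mu> = "mon (Xvar a) + mon (Yvar b)"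
  have "lookup (minor a b :: 'k mpoly) ?\<mu> = 0"
  proof (rule ideal_gen_avoid[OF S _ mem])
    fix f m r assume f: "f \<in> S" "lookup f m \<noteq> 0"
    obtain c d where cd: "f = minor c d" "{c, d} \<noteq> {a, b}"
      using gens[OF f(1)] by blast
    show "?\<mu> \<noteq> m + r"
    proof
      assume "?\<mu> = m + r"
      then have "(lookup ?\<mu> (Xvar c) \<noteq> 0 \<and> lookup ?\<mu> (Yvar d) \<noteq> 0) \<or>
          (lookup ?\<mu> (Xvar d) \<noteq> 0 \<and> lookup ?\<mu> (Yvar c) \<noteq> 0)"
        using lookup_minorD[of c d m] f(2) cd(1) mon_dvd by metis
      then show False
        using cd(2) by (auto simp: lookup_add lookup_single when_def split: if_splits)
    qed
  qed
  moreover have "lookup (minor a b :: 'k mpoly) ?\<mu> = 1"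
    using ab by (simp add: lookup_minor mon_eq)
  ultimately show False by simp
qed

lemma minimal_pair_minors:
  assumes R: "\<And>a b. (a, b) \<in> R \<Longrightarrow> a \<in> {1..n} \<and> b \<in> {1..n} \<and> a \<noteq> b"
    and inj: "\<And>a b c d. (a, b) \<in> R \<Longrightarrow> (c, d) \<in> R \<Longrightarrow> {a, b} = {c, d} \<Longrightarrow> (a, b) = (c, d)"
  shows "minimal_homogeneous_gens n (ideal_gen n (pair_minors R)) (pair_minors R :: 'k::field mpoly set)"
  unfolding minimal_homogeneous_gens_def
proof (intro conjI allI impI)
  have sub: "pair_minors R \<subseteq> (polyring n :: 'k mpoly set)"
    using R by (auto simp: pair_minors_def intro!: minor_polyring)
  then show "homogeneous_gens n (ideal_gen n (pair_minors R)) (pair_minors R :: 'k mpoly set)"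
    using homogeneous_minor by (auto simp: homogeneous_gens_def pair_minors_def)
  fix A' :: "'k mpoly set" assume A': "A' \<subset> pair_minors R"
  then obtain a b where ab: "(a, b) \<in> R" "minor a b \<notin> A'"
    by (auto simp: pair_minors_def)
  have "minor a b \<notin> ideal_gen n A'"
  proof (rule minor_notin_ideal)
    show "A' \<subseteq> polyring n" using A' sub by blast
    show "a \<noteq> b" using R[OF ab(1)] by blast
    fix f assume "f \<in> A'"
    then obtain c d where cd: "f = minor c d" "(c, d) \<in> R"
      using A' unfolding pair_minors_def by blast
    then have "{c, d} \<noteq> {a, b}"
      using inj[OF cd(2) ab(1)] ab(2) \<open>f \<in> A'\<close> by auto
    with cd show "\<exists>c d. f = minor c d \<and> {c, d} \<noteq> {a, b}" by blast
  qed
  moreover have "minor a b \<in> ideal_gen n (pair_minors R)"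
    using ab(1) by (intro ideal_gen_base) (auto simp: pair_minors_def)
  ultimately show "ideal_gen n A' \<noteq> ideal_gen n (pair_minors R)"
    by blast
qed

lemma ideal_gen_pair_minors:
  assumes E: "\<And>e. e \<in> E \<Longrightarrow> e \<subseteq> {1..n}" and R: "\<And>a b. (a, b) \<in> R \<Longrightarrow> {a, b} \<in> E"
    and ER: "\<And>a b. {a, b} \<in> E \<Longrightarrow> (a, b) \<in> R \<or> (b, a) \<in> R"
  shows "ideal_gen n (pair_minors R) = (ideal_gen n (edge_minors E) :: 'k::field mpoly set)"
proof (rule ideal_gen_eqI)
  show gE: "hgens n (edge_minors E :: 'k mpoly set)"
    by (rule hgens_edge_minors[OF E])
  have sub: "pair_minors R \<subseteq> (edge_minors E :: 'k mpoly set)"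
    using R by (auto simp: pair_minors_def edge_minors_def)
  then show gR: "hgens n (pair_minors R :: 'k mpoly set)"
    using gE by (auto simp: hgens_def)
  show "pair_minors R \<subseteq> (ideal_gen n (edge_minors E) :: 'k mpoly set)"
    using sub by (auto intro: ideal_gen_base)
  show "edge_minors E \<subseteq> (ideal_gen n (pair_minors R) :: 'k mpoly set)"
  proof
    fix f :: "'k mpoly" assume "f \<in> edge_minors E"
    then obtain a b where ab: "f = minor a b" "{a, b} \<in> E"
      by (auto simp: edge_minors_def)
    have base: "minor c d \<in> ideal_gen n (pair_minors R :: 'k mpoly set)" if "(c, d) \<in> R" for c d
      using that by (intro ideal_gen_base) (auto simp: pair_minors_def)
    show "f \<in> ideal_gen n (pair_minors R)"
      using ER[OF ab(2)] base ideal_uminus[OF hgens_ideal[OF gR] base] unfolding ab(1)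
      by (metis minor_swap)
  qed
qed

section \<open>Generators of the three ideals of the partition\<close>

context vertex_partition
begin

definition star_pairs :: "(nat \<times> nat) set" where
  "star_pairs = {(s, t) |t. t \<in> N}"

definition rest_pairs :: "(nat \<times> nat) set" where
  "rest_pairs = {(t, u). t < u \<and> {t, u} \<in> edges G \<and> t \<noteq> s \<and> u \<noteq> s}"

lemma J1_pairs: "J1 = ideal_gen n (pair_minors star_pairs)"
proof -
  have "pair_minors star_pairs = (star_minors s N :: 'k mpoly set)"
    by (auto simp: pair_minors_def star_pairs_def star_minors_def)
  then show ?thesis by (simp add: J1_alt)
qed

lemma edge_ne: "{a, b} \<in> edges G \<Longrightarrow> a \<noteq> b"
  using simple_graph_edge(1)[OF graph(1)] .

lemma J2_pairs: "J2 = ideal_gen n (pair_minors rest_pairs)"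
  unfolding J2_alt
proof (rule ideal_gen_pair_minors[symmetric])
  show "e \<subseteq> {1..n}" if "e \<in> edges (delete_vertex G s)" for e
    using that edges_sub by (auto simp: delete_vertex_def)
  show "{a, b} \<in> edges (delete_vertex G s)" if "(a, b) \<in> rest_pairs" for a b
    using that by (auto simp: rest_pairs_def delete_vertex_def)
  show "(a, b) \<in> rest_pairs \<or> (b, a) \<in> rest_pairs" if "{a, b} \<in> edges (delete_vertex G s)" for a b
    using that edge_ne[of a b] by (cases a b rule: linorder_cases)
      (auto simp: rest_pairs_def delete_vertex_def insert_commute)
qed

lemma J_pairs: "binomial_edge_ideal n G = (ideal_gen n (pair_minors (star_pairs \<union> rest_pairs)) :: 'k mpoly set)"
  unfolding binomial_edge_ideal_alt
proof (rule ideal_gen_pair_minors[symmetric])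
  show "e \<subseteq> {1..n}" if "e \<in> edges G" for e
    using that by (rule edges_sub)
  show "{a, b} \<in> edges G" if "(a, b) \<in> star_pairs \<union> rest_pairs" for a b
    using that by (auto simp: star_pairs_def rest_pairs_def neighbours_def)
  show "(a, b) \<in> star_pairs \<union> rest_pairs \<or> (b, a) \<in> star_pairs \<union> rest_pairs" if "{a, b} \<in> edges G" for a b
    using that edge_ne[of a b] by (cases a b rule: linorder_cases)
      (auto simp: star_pairs_def rest_pairs_def neighbours_def insert_commute)
qed

lemma pairs_bound: "(a, b) \<in> star_pairs \<union> rest_pairs \<Longrightarrow> a \<in> {1..n} \<and> b \<in> {1..n} \<and> a \<noteq> b"
  using s N edges_sub[of "{a, b}"] by (auto simp: star_pairs_def rest_pairs_def)

lemma pairs_inj: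
  "(a, b) \<in> star_pairs \<union> rest_pairs \<Longrightarrow> (c, d) \<in> star_pairs \<union> rest_pairs \<Longrightarrow> {a, b} = {c, d} \<Longrightarrow> (a, b) = (c, d)"
  using N(2) by (auto simp: star_pairs_def rest_pairs_def doubleton_eq_iff)

lemma pair_minors_Un: "pair_minors (R \<union> R') = pair_minors R \<union> pair_minors R'"
  by (auto simp: pair_minors_def)

lemma minimal_gens:
  "minimal_homogeneous_gens n J1 (pair_minors star_pairs)"
  "minimal_homogeneous_gens n J2 (pair_minors rest_pairs)"
  "minimal_homogeneous_gens n (binomial_edge_ideal n G)
    (pair_minors star_pairs \<union> pair_minors rest_pairs :: 'k mpoly set)"
proof -
  show "minimal_homogeneous_gens n J1 (pair_minors star_pairs)"
    unfolding J1_pairs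
    by (rule minimal_pair_minors) (use pairs_bound pairs_inj in blast)+
  show "minimal_homogeneous_gens n J2 (pair_minors rest_pairs)"
    unfolding J2_pairs
    by (rule minimal_pair_minors) (use pairs_bound pairs_inj in blast)+
  show "minimal_homogeneous_gens n (binomial_edge_ideal n G)
      (pair_minors star_pairs \<union> pair_minors rest_pairs :: 'k mpoly set)"
    unfolding J_pairs pair_minors_Un[symmetric]
    by (rule minimal_pair_minors) (use pairs_bound pairs_inj in blast)+
qed

text \<open>The generators are compared as polynomials: a minor on a pair without \<open>s\<close>
  is not even in the ideal generated by a minor on a pair containing \<open>s\<close>.\<close>

lemma disjoint_gens: "pair_minors star_pairs \<inter> (pair_minors rest_pairs :: 'k mpoly set) = {}"
proof -
  have "minor s t \<notin> (pair_minors rest_pairs :: 'k mpoly set)" if t: "t \<in> N" for t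
  proof
    assume "minor s t \<in> (pair_minors rest_pairs :: 'k mpoly set)"
    then obtain a b where ab: "(a, b) \<in> rest_pairs" "minor s t = (minor a b :: 'k mpoly)"
      by (auto simp: pair_minors_def)
    have st: "s \<noteq> t" using t N by auto
    have "minor a b \<notin> ideal_gen n {minor s t :: 'k mpoly}"
    proof (rule minor_notin_ideal)
      show "{minor s t} \<subseteq> (polyring n :: 'k mpoly set)"
        using s t N by (auto intro!: minor_polyring)
      show "a \<noteq> b" using ab(1) by (auto simp: rest_pairs_def)
      show "\<exists>c d. f = minor c d \<and> {c, d} \<noteq> {a, b}" if "f \<in> {minor s t :: 'k mpoly}" for f
        using that ab(1) by (auto simp: rest_pairs_def doubleton_eq_iff)
    qed
    then show False
      using ab(2) by (metis ideal_gen_base singletonI)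
  qed
  then show ?thesis
    by (auto simp: pair_minors_def star_pairs_def)
qed

lemma J_sum: "binomial_edge_ideal n G = ideal_sum J1 J2"
proof -
  have "pair_minors star_pairs \<subseteq> (polyring n :: 'k mpoly set)" "pair_minors rest_pairs \<subseteq> (polyring n :: 'k mpoly set)"
    using minimal_gens(1,2) by (auto simp: minimal_homogeneous_gens_def homogeneous_gens_def)
  then show ?thesis
    unfolding J_pairs J1_pairs J2_pairs pair_minors_Un by (rule ideal_gen_Un)
qed

text \<open>For \<open>k = i\<close> and \<open>k = i - 1\<close> alike, \<open>i \<ge> c(s)\<close>
  gives \<open>k \<ge> c(s) - 1\<close>, and \<open>j \<ge> i + 4\<close> gives
  \<open>j \<ge> k + 4\<close>.\<close>

theorem betti_partition:
  assumes "i \<ge> int (clique_size_at G s) \<or> j \<ge> i + 4"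
  shows "betti n (binomial_edge_ideal n G :: 'k mpoly set) i j =
    betti n J1 i j + betti n J2 i j + betti n (J1 \<inter> J2) (i - 1) j"
  unfolding J_sum
proof (rule betti_sum[OF graded])
  fix k assume "0 \<le> k" "k = i \<or> k = i - 1"
  then show "exact_in n (J1 \<inter> J2) J1 k j \<and> exact_in n (J1 \<inter> J2) J2 k j"
    using assms by (intro conjI exact_J1 exact_J2) auto
qed

end

theorem theorem1p3:
  fixes n s :: nat and G :: graph and J J1 J2 :: "'k::field mpoly set"
  assumes "simple_graph G" and "verts G = {1..n}" and "s \<in> {1..n}"
    and "J = binomial_edge_ideal n G"
    and "J1 = binomial_edge_ideal n (star_at G s)"
    and "J2 = binomial_edge_ideal n (delete_vertex G s)"
  shows "(\<forall>i j :: int. i \<ge> int (clique_size_at G s) \<or> j \<ge> i + 4 \<longrightarrow>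
            betti n J i j = betti n J1 i j + betti n J2 i j + betti n (J1 \<inter> J2) (i - 1) j) \<and>
         betti_splitting n (int (clique_size_at G s)) 4 J J1 J2"
proof -
  interpret vertex_partition G n s J1 J2
    by unfold_locales (use assms in auto)
  have betti: "\<forall>i j :: int. i \<ge> int (clique_size_at G s) \<or> j \<ge> i + 4 \<longrightarrow>
      betti n J i j = betti n J1 i j + betti n J2 i j + betti n (J1 \<inter> J2) (i - 1) j"
    using betti_partition unfolding assms(4) by blast
  have "homogeneous_ideal n J" "homogeneous_ideal n J1" "homogeneous_ideal n J2"
    using minimal_gens unfolding assms(4) homogeneous_ideal_def minimal_homogeneous_gens_def by metis+
  moreover have "J = ideal_sum J1 J2"
    unfolding assms(4) by (rule J_sum)
  moreover have "\<exists>A B. minimal_homogeneous_gens n J1 A \<and> minimal_homogeneous_gens n J2 B \<and> A \<inter> B = {} \<and>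
      minimal_homogeneous_gens n J (A \<union> B)"
    unfolding assms(4) by (intro exI conjI) (rule minimal_gens disjoint_gens)+
  ultimately have "betti_splitting n (int (clique_size_at G s)) 4 J J1 J2"
    unfolding betti_splitting_def using betti by (intro conjI)
  with betti show ?thesis by blast
qed

end
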